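(* Let $M$ be a simply laced Coxeter diagram of spherical type (i.e. whose Coxeter group is finite). Then the BMW algebra $B(M)$ is finite dimensional as a vector space over $\mathbb{Q}(l,x)$.
   Context: A simply laced Coxeter diagram $M$ of rank $n$ is a finite simple graph with nodes $1,\dots,n$ (no multiple bonds); write $i\sim j$ if nodes $i,j$ are adjacent and $i\not\sim j$ otherwise. Let $l,x$ be indeterminates and $m=(l-l^{-1})/(1-x)\in\mathbb{Q}(l,x)$. The BMW algebra $B(M)$ of type $M$ is the unital associative algebra over $\mathbb{Q}(l,x)$ with generators $g_i,e_i$ ($i=1,\dots,n$) and defining relations: (B1) $g_ig_j=g_jg_i$ when $i\not\sim j$; (B2) $g_ig_jg_i=g_jg_ig_j$ when $i\sim j$; (D1) $me_i=l(g_i^2+mg_i-1)$ for all $i$; (R1) $g_ie_i=l^{-1}e_i$ for all $i$; (R2) $e_ig_je_i=le_i$ when $i\sim j$. *)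

theory Defs
  imports
    "HOL-Algebra.Embedded_Algebras"
    "HOL-Algebra.QuotRing"
    "HOL-Library.Poly_Mapping"
    "HOL-Computational_Algebra.Polynomial"
    "HOL-Computational_Algebra.Fraction_Field"
begin

section \<open>Simply laced Coxeter diagrams and their Coxeter groups\<close>

definition nodes :: "nat \<Rightarrow> nat set" where
  "nodes n = {1..n}"

definition simply_laced_diagram :: "nat \<Rightarrow> (nat \<Rightarrow> nat \<Rightarrow> bool) \<Rightarrow> bool" where
  "simply_laced_diagram n adj \<longleftrightarrow>
     (\<forall>i j. adj i j \<longrightarrow> i \<in> nodes n \<and> j \<in> nodes n \<and> i \<noteq> j \<and> adj j i)"

text \<open>
  Group presentations: a letter \<open>(x, True)\<close> stands for the generator \<open>x\<close> and \<open>(x, False)\<close> for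
  its inverse. The group presented by \<open>X\<close> and \<open>R\<close> consists of the congruence classes of words.
\<close>

definition group_words :: "'a set \<Rightarrow> ('a \<times> bool) list set" where
  "group_words X = lists (X \<times> UNIV)"

inductive pres_cong ::
  "'a set \<Rightarrow> ('a \<times> bool) list set \<Rightarrow> ('a \<times> bool) list \<Rightarrow> ('a \<times> bool) list \<Rightarrow> bool"
  for X R where
  pres_cong_refl: "u \<in> group_words X \<Longrightarrow> pres_cong X R u u"
| pres_cong_sym: "pres_cong X R u v \<Longrightarrow> pres_cong X R v u"
| pres_cong_trans: "pres_cong X R u v \<Longrightarrow> pres_cong X R v w \<Longrightarrow> pres_cong X R u w"
| pres_cong_mult: "pres_cong X R u v \<Longrightarrow> pres_cong X R u' v' \<Longrightarrow> pres_cong X R (u @ u') (v @ v')"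
| pres_cong_cancel: "x \<in> X \<Longrightarrow> pres_cong X R [(x, b), (x, \<not> b)] []"
| pres_cong_relator: "r \<in> R \<Longrightarrow> r \<in> group_words X \<Longrightarrow> pres_cong X R r []"

definition pres_class ::
  "'a set \<Rightarrow> ('a \<times> bool) list set \<Rightarrow> ('a \<times> bool) list \<Rightarrow> ('a \<times> bool) list set" where
  "pres_class X R u = {v. pres_cong X R u v}"

definition presented_group ::
  "'a set \<Rightarrow> ('a \<times> bool) list set \<Rightarrow> ('a \<times> bool) list set monoid" where
  "presented_group X R =
     \<lparr>carrier = pres_class X R ` group_words X,
      monoid.mult = (\<lambda>A B. \<Union>a\<in>A. \<Union>b\<in>B. pres_class X R (a @ b)),
      one = pres_class X R []\<rparr>"

definition coxeter_matrix :: "(nat \<Rightarrow> nat \<Rightarrow> bool) \<Rightarrow> nat \<Rightarrow> nat \<Rightarrow> nat" where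
  "coxeter_matrix adj i j = (if i = j then 1 else if adj i j then 3 else 2)"

definition coxeter_relators :: "nat \<Rightarrow> (nat \<Rightarrow> nat \<Rightarrow> bool) \<Rightarrow> (nat \<times> bool) list set" where
  "coxeter_relators n adj =
     {concat (replicate (coxeter_matrix adj i j) [(i, True), (j, True)]) | i j.
        i \<in> nodes n \<and> j \<in> nodes n}"

definition coxeter_group :: "nat \<Rightarrow> (nat \<Rightarrow> nat \<Rightarrow> bool) \<Rightarrow> (nat \<times> bool) list set monoid" where
  "coxeter_group n adj = presented_group (nodes n) (coxeter_relators n adj)"

definition spherical :: "nat \<Rightarrow> (nat \<Rightarrow> nat \<Rightarrow> bool) \<Rightarrow> bool" where
  "spherical n adj \<longleftrightarrow> finite (carrier (coxeter_group n adj))"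

lemma pres_cong_words: "pres_cong X R u v \<Longrightarrow> u \<in> group_words X \<and> v \<in> group_words X"
  by (induction rule: pres_cong.induct) (auto simp: group_words_def)

lemma pres_class_eq_iff:
  assumes "u \<in> group_words X" "v \<in> group_words X"
  shows "pres_class X R u = pres_class X R v \<longleftrightarrow> pres_cong X R u v"
proof
  assume "pres_class X R u = pres_class X R v"
  moreover have "v \<in> pres_class X R v"
    using pres_cong_refl[OF assms(2)] by (simp add: pres_class_def)
  ultimately have "v \<in> pres_class X R u" by blast
  then show "pres_cong X R u v" by (simp add: pres_class_def)
next
  assume uv: "pres_cong X R u v"
  show "pres_class X R u = pres_class X R v"
    unfolding pres_class_def
    using pres_cong_trans[OF uv] pres_cong_trans[OF pres_cong_sym[OF uv]] by blast
qed

lemma presented_group_mult: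
  assumes "u \<in> group_words X" "v \<in> group_words X"
  shows "pres_class X R u \<otimes>\<^bsub>presented_group X R\<^esub> pres_class X R v = pres_class X R (u @ v)"
proof -
  have eq: "pres_class X R (a @ b) = pres_class X R (u @ v)"
    if "a \<in> pres_class X R u" "b \<in> pres_class X R v" for a b
  proof -
    have uv: "pres_cong X R (u @ v) (a @ b)"
      using that by (intro pres_cong_mult) (simp_all add: pres_class_def)
    then show ?thesis using pres_class_eq_iff pres_cong_words[OF uv] by metis
  qed
  have "u \<in> pres_class X R u" "v \<in> pres_class X R v"
    using pres_cong_refl[OF assms(1)] pres_cong_refl[OF assms(2)] by (simp_all add: pres_class_def)
  then have "(\<Union>a\<in>pres_class X R u. \<Union>b\<in>pres_class X R v. pres_class X R (a @ b))
      = pres_class X R (u @ v)"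
    using eq by blast
  then show ?thesis by (simp add: presented_group_def)
qed

lemma pres_cong_inverse:
  "u \<in> group_words X \<Longrightarrow> pres_cong X R (rev (map (\<lambda>(x, b). (x, \<not> b)) u) @ u) []"
proof (induction u)
  case Nil
  then show ?case by (simp add: pres_cong_refl)
next
  case (Cons a u)
  obtain x b where a: "a = (x, b)" by force
  let ?w = "rev (map (\<lambda>(x, b). (x, \<not> b)) u)"
  have x: "x \<in> X" and u: "u \<in> group_words X"
    using Cons.prems a by (auto simp: group_words_def)
  have w: "?w \<in> group_words X" using u by (auto simp: group_words_def)
  have "pres_cong X R ([(x, \<not> b), (x, b)] @ u) ([] @ u)"
    using pres_cong_cancel[OF x, of R "\<not> b"] pres_cong_refl[OF u] by (intro pres_cong_mult) auto
  then have "pres_cong X R (?w @ [(x, \<not> b), (x, b)] @ u) (?w @ u)"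
    using pres_cong_mult[OF pres_cong_refl[OF w]] by fastforce
  then show ?case using pres_cong_trans[OF _ Cons.IH[OF u]] a by simp
qed

lemma presented_group_group: "group (presented_group X R)"
proof (rule groupI)
  have W: "[] \<in> group_words X" "\<And>u v. u \<in> group_words X \<Longrightarrow> v \<in> group_words X \<Longrightarrow> u @ v \<in> group_words X"
    by (auto simp: group_words_def)
  have C: "carrier (presented_group X R) = pres_class X R ` group_words X"
    and O: "\<one>\<^bsub>presented_group X R\<^esub> = pres_class X R []"
    by (simp_all add: presented_group_def)
  show "\<one>\<^bsub>presented_group X R\<^esub> \<in> carrier (presented_group X R)" using W by (simp add: C O)
  fix A assume "A \<in> carrier (presented_group X R)"
  then obtain u where u: "u \<in> group_words X" "A = pres_class X R u" by (auto simp: C)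
  show "\<one>\<^bsub>presented_group X R\<^esub> \<otimes>\<^bsub>presented_group X R\<^esub> A = A"
    using u W by (simp add: O presented_group_mult)
  let ?w = "rev (map (\<lambda>(x, b). (x, \<not> b)) u)"
  have w: "?w \<in> group_words X" using u by (auto simp: group_words_def)
  show "\<exists>B\<in>carrier (presented_group X R). B \<otimes>\<^bsub>presented_group X R\<^esub> A = \<one>\<^bsub>presented_group X R\<^esub>"
    using w u W pres_cong_inverse[OF u(1), of R]
    by (intro bexI[of _ "pres_class X R ?w"]) (auto simp: O C presented_group_mult pres_class_eq_iff)
  fix B assume "B \<in> carrier (presented_group X R)"
  then obtain v where v: "v \<in> group_words X" "B = pres_class X R v" by (auto simp: C)
  show "A \<otimes>\<^bsub>presented_group X R\<^esub> B \<in> carrier (presented_group X R)"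
    using u v W by (simp add: C presented_group_mult)
  fix D assume "D \<in> carrier (presented_group X R)"
  then obtain w where "w \<in> group_words X" "D = pres_class X R w" by (auto simp: C)
  then show "A \<otimes>\<^bsub>presented_group X R\<^esub> B \<otimes>\<^bsub>presented_group X R\<^esub> D =
      A \<otimes>\<^bsub>presented_group X R\<^esub> (B \<otimes>\<^bsub>presented_group X R\<^esub> D)"
    using u v W by (simp add: presented_group_mult)
qed


section \<open>The field of rational functions in two indeterminates\<close>

text \<open>
  The field of fractions of the polynomial ring in \<open>x\<close> over the polynomial ring in \<open>l\<close> over the
  rationals.
\<close>

type_synonym ratfun = "rat poly poly fract"

definition var_l :: ratfun where "var_l = Fract [:[:0, 1:]:] 1"
definition var_x :: ratfun where "var_x = Fract [:0, 1:] 1"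
definition var_m :: ratfun where "var_m = (var_l - inverse var_l) / (1 - var_x)"


section \<open>The BMW algebra\<close>

text \<open>
  Words form a monoid under concatenation, written additively because \<^typ>\<open>'a \<Rightarrow>\<^sub>0 'b\<close> takes its
  product from addition of exponents. Thus \<open>'a list \<Rightarrow>\<^sub>0 'b\<close> with its library ring structure is the
  free associative algebra: \<open>Poly_Mapping.single w c\<close> is \<open>c\<close> times the word \<open>w\<close>, and the product
  concatenates words.
\<close>

instantiation list :: (type) monoid_add
begin
definition zero_list :: "'a list" where "zero_list = []"
definition plus_list :: "'a list \<Rightarrow> 'a list \<Rightarrow> 'a list" where "plus_list u v = u @ v"
instance by standard (simp_all add: zero_list_def plus_list_def)
end

datatype gen = GenG nat | GenE nat

type_synonym gen_poly = "gen list \<Rightarrow>\<^sub>0 ratfun"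

definition free_algebra :: "nat \<Rightarrow> gen_poly ring" where
  "free_algebra n =
     \<lparr>carrier = {p. Poly_Mapping.keys p \<subseteq> lists (GenG ` nodes n \<union> GenE ` nodes n)},
      monoid.mult = (*), one = 1, zero = 0, add = (+)\<rparr>"

definition bmw_g :: "nat \<Rightarrow> gen_poly" where "bmw_g i = Poly_Mapping.single [GenG i] 1"
definition bmw_e :: "nat \<Rightarrow> gen_poly" where "bmw_e i = Poly_Mapping.single [GenE i] 1"
definition scalar :: "ratfun \<Rightarrow> gen_poly" where "scalar c = Poly_Mapping.single [] c"

text \<open>Each defining relation \<open>p = q\<close> is recorded as the element \<open>p - q\<close>.\<close>

definition BMW_relators :: "nat \<Rightarrow> (nat \<Rightarrow> nat \<Rightarrow> bool) \<Rightarrow> gen_poly set" where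
  "BMW_relators n adj =
     {bmw_g i * bmw_g j - bmw_g j * bmw_g i | i j. i \<in> nodes n \<and> j \<in> nodes n \<and> \<not> adj i j}
   \<union> {bmw_g i * bmw_g j * bmw_g i - bmw_g j * bmw_g i * bmw_g j | i j. i \<in> nodes n \<and> j \<in> nodes n \<and> adj i j}
   \<union> {scalar var_m * bmw_e i - scalar var_l * ((bmw_g i)\<^sup>2 + scalar var_m * bmw_g i - 1) | i. i \<in> nodes n}
   \<union> {bmw_g i * bmw_e i - scalar (inverse var_l) * bmw_e i | i. i \<in> nodes n}
   \<union> {bmw_e i * bmw_g j * bmw_e i - scalar var_l * bmw_e i | i j. i \<in> nodes n \<and> j \<in> nodes n \<and> adj i j}"

definition BMW_ideal :: "nat \<Rightarrow> (nat \<Rightarrow> nat \<Rightarrow> bool) \<Rightarrow> gen_poly set" where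
  "BMW_ideal n adj = Idl\<^bsub>free_algebra n\<^esub> (BMW_relators n adj)"

definition BMW_algebra :: "nat \<Rightarrow> (nat \<Rightarrow> nat \<Rightarrow> bool) \<Rightarrow> gen_poly set ring" where
  "BMW_algebra n adj = free_algebra n Quot BMW_ideal n adj"

text \<open>
  The image of the ground field. \<open>ring.finite_dimension\<close> takes the field as a subset of the ring
  acting by left multiplication; left multiplication by these elements is the scalar action.
\<close>

definition BMW_scalars :: "nat \<Rightarrow> (nat \<Rightarrow> nat \<Rightarrow> bool) \<Rightarrow> gen_poly set set" where
  "BMW_scalars n adj = range (\<lambda>c. BMW_ideal n adj +>\<^bsub>free_algebra n\<^esub> scalar c)"

lemma free_algebra_ring: "ring (free_algebra n)"
proof (rule ringI)
  let ?L = "lists (GenG ` nodes n \<union> GenE ` nodes n)"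
  have add: "Poly_Mapping.keys (p + q) \<subseteq> ?L"
    if "Poly_Mapping.keys p \<subseteq> ?L" "Poly_Mapping.keys q \<subseteq> ?L" for p q :: gen_poly
    using keys_add[of p q] that by blast
  show "abelian_group (free_algebra n)"
  proof (rule abelian_groupI)
    fix p assume p: "p \<in> carrier (free_algebra n)"
    show "\<exists>q\<in>carrier (free_algebra n). q \<oplus>\<^bsub>free_algebra n\<^esub> p = \<zero>\<^bsub>free_algebra n\<^esub>"
      using p by (intro bexI[of _ "- p"]) (auto simp: free_algebra_def)
  qed (use add in \<open>simp_all add: free_algebra_def add_ac\<close>)
  show "monoid (free_algebra n)"
  proof (rule monoidI)
    fix p q assume pq: "p \<in> carrier (free_algebra n)" "q \<in> carrier (free_algebra n)"
    have "a + b \<in> ?L" if "a \<in> Poly_Mapping.keys p" "b \<in> Poly_Mapping.keys q" for a b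
    proof -
      have "a \<in> ?L" "b \<in> ?L" using that pq by (auto simp: free_algebra_def)
      then show ?thesis by (simp add: plus_list_def)
    qed
    then have "Poly_Mapping.keys (p * q) \<subseteq> ?L" using keys_mult[of p q] by blast
    then show "p \<otimes>\<^bsub>free_algebra n\<^esub> q \<in> carrier (free_algebra n)"
      by (simp add: free_algebra_def)
  qed (simp_all add: free_algebra_def mult.assoc zero_list_def)
qed (simp_all add: free_algebra_def distrib_left distrib_right)

lemma free_algebra_scalar [simp]: "scalar c \<in> carrier (free_algebra n)"
  by (simp add: free_algebra_def scalar_def)

lemma free_algebra_gens:
  assumes "i \<in> nodes n"
  shows "bmw_g i \<in> carrier (free_algebra n)" "bmw_e i \<in> carrier (free_algebra n)"
  using assms by (auto simp: free_algebra_def bmw_g_def bmw_e_def)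

lemma BMW_relators_carrier: "BMW_relators n adj \<subseteq> carrier (free_algebra n)"
proof -
  let ?C = "carrier (free_algebra n)"
  interpret ring "free_algebra n" by (rule free_algebra_ring)
  have m: "p * q \<in> ?C" if "p \<in> ?C" "q \<in> ?C" for p q
    using m_closed[OF that] by (simp add: free_algebra_def)
  have a: "p + q \<in> ?C" if "p \<in> ?C" "q \<in> ?C" for p q
    using a_closed[OF that] by (simp add: free_algebra_def)
  have d: "p - q \<in> ?C" if "p \<in> ?C" "q \<in> ?C" for p q
    using a[of p "- q"] that by (simp add: free_algebra_def)
  have "1 \<in> ?C" using one_closed by (simp add: free_algebra_def)
  then show ?thesis
    unfolding BMW_relators_def power2_eq_square
    by (auto intro!: m a d free_algebra_gens free_algebra_scalar)
qed

lemma BMW_ideal_ideal: "ideal (BMW_ideal n adj) (free_algebra n)"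
  unfolding BMW_ideal_def
  by (rule ring.genideal_ideal[OF free_algebra_ring BMW_relators_carrier])

lemma BMW_algebra_ring: "ring (BMW_algebra n adj)"
  unfolding BMW_algebra_def by (rule ideal.quotient_is_ring[OF BMW_ideal_ideal])

end

theory Submission
  imports Defs "HOL-Library.Nat_Bijection"
begin

text \<open>Only an upper bound is sought, so no map below has to be injective, no normal form is
  shown to be unique, and no classification of the spherical diagrams enters. The delicate point is
  that the words attached to the nodes of the smaller diagram satisfy its relations. Each relation
  involves at most two nodes, and any two nodes of the smaller diagram can be moved together from
  \<open>e\<^sub>i\<close> to one \<open>e\<^sub>j\<close>, where they become ordinary letters
  commuting with \<open>e\<^sub>j\<close>; the relation is then one of the original ones. This needs
  at most three neighbours of \<open>i\<close>, so that two pairs of neighbours meet. The same bound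
  makes the induction work: \<open>i\<close> is lost and there are at most as many pairs as
  neighbours. A branch node other than \<open>i\<close> would stop a letter that is carried along a
  path; since \<open>i\<close> has maximal degree, such a node would produce an affine diagram of
  type D. The induction runs over positive definite diagrams because this property passes to the
  smaller diagram by a linear map preserving the form, which sends its nodes to the roots \<alpha>_b
  and \<alpha>_a + \<alpha>_i + \<alpha>_b.\<close>

text \<open>
  Give a word in the generators the number of its letters \<open>g\<^sub>i\<close> as height. Up to scalars and words of
  smaller height, the relations of the algebra present a monoid \<open>M\<close> with zero: \<open>g\<^sub>i g\<^sub>i\<close>,
  \<open>g\<^sub>i e\<^sub>i\<close>, \<open>e\<^sub>i g\<^sub>j e\<^sub>i\<close> and \<open>g\<^sub>i g\<^sub>j e\<^sub>i\<close> vanish. By induction on the height it suffices that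
  \<open>M\<close> is finite, which holds whenever the Cartan form of the diagram is positive definite. Words without
  letters \<open>e\<^sub>i\<close> are treated as in the word problem of Coxeter groups. The diagram may be assumed
  connected, hence a tree; let \<open>i\<close> be its branch node or, without one, any node of maximal degree.
  Every non-zero word starting with \<open>e\<^sub>i\<close> is an element of \<open>e\<^sub>i M e\<^sub>i\<close>, times a path \<open>e\<^sub>i \<dots> e\<^sub>j\<close>, times a
  word in the \<open>g\<^sub>k\<close> that raises the simple root \<open>\<alpha>\<^sub>j\<close> to some positive root step by step. The elements of
  \<open>e\<^sub>i M e\<^sub>i\<close> that arise come from the monoid of a smaller diagram, the one of the roots orthogonal to \<open>\<alpha>\<^sub>i\<close>:
  its nodes are the nodes not adjacent to \<open>i\<close>, with \<open>e\<^sub>i g\<^sub>b\<close> for \<open>g\<^sub>b\<close>, and the pairs of neighbours of \<open>i\<close>, with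
  \<open>e\<^sub>i e\<^sub>a g\<^sub>b e\<^sub>i\<close> for the generator at \<open>{a, b}\<close>.
\<close>

section \<open>Words up to scalars and smaller height\<close>

fun gen_node :: "gen \<Rightarrow> nat" where
  "gen_node (GenG i) = i"
| "gen_node (GenE i) = i"

fun gmap :: "(nat \<Rightarrow> nat) \<Rightarrow> gen \<Rightarrow> gen" where
  "gmap f (GenG i) = GenG (f i)"
| "gmap f (GenE i) = GenE (f i)"

fun is_G :: "gen \<Rightarrow> bool" where
  "is_G (GenG i) = True"
| "is_G (GenE i) = False"

lemma gen_node_gmap [simp]: "gen_node (gmap f a) = f (gen_node a)"
  by (cases a) auto

definition height :: "gen list \<Rightarrow> nat" where
  "height u = length (filter is_G u)"

lemma height_simps [simp]:
  "height [] = 0" "height (a # u) = (if is_G a then 1 else 0) + height u" "height (u @ v) = height u + height v"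
  by (auto simp: height_def)

definition words_on :: "nat set \<Rightarrow> gen list set" where
  "words_on S = {u. gen_node ` set u \<subseteq> S}"

lemma words_on_simps [simp]:
  "[] \<in> words_on S" "a # u \<in> words_on S \<longleftrightarrow> gen_node a \<in> S \<and> u \<in> words_on S"
  "u @ v \<in> words_on S \<longleftrightarrow> u \<in> words_on S \<and> v \<in> words_on S"
  "rev u \<in> words_on S \<longleftrightarrow> u \<in> words_on S"
  by (auto simp: words_on_def)

text \<open>
  In the algebra, two words related by \<open>basic_rel\<close> agree up to a non-zero scalar and a combination
  of words of smaller height, and each \<open>null_word\<close> is a combination of words of smaller height.
\<close>

inductive basic_rel :: "(nat \<Rightarrow> nat \<Rightarrow> bool) \<Rightarrow> gen list \<Rightarrow> gen list \<Rightarrow> bool" for adj where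
  comm: "gen_node a \<noteq> gen_node b \<Longrightarrow> \<not> adj (gen_node a) (gen_node b) \<Longrightarrow> basic_rel adj [a, b] [b, a]"
| idem: "basic_rel adj [GenE i, GenE i] [GenE i]"
| braid: "adj i j \<Longrightarrow> basic_rel adj [GenG i, GenG j, GenG i] [GenG j, GenG i, GenG j]"
| eee: "adj i j \<Longrightarrow> basic_rel adj [GenE i, GenE j, GenE i] [GenE i]"
| gee: "adj i j \<Longrightarrow> basic_rel adj [GenG i, GenE j, GenE i] [GenG j, GenE i]"
| eeg: "adj i j \<Longrightarrow> basic_rel adj [GenE i, GenE j, GenG i] [GenE i, GenG j]"

inductive null_word :: "(nat \<Rightarrow> nat \<Rightarrow> bool) \<Rightarrow> gen list \<Rightarrow> bool" for adj where
  gg: "null_word adj [GenG i, GenG i]"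
| ge: "null_word adj [GenG i, GenE i]"
| eg: "null_word adj [GenE i, GenG i]"
| ege: "adj i j \<Longrightarrow> null_word adj [GenE i, GenG j, GenE i]"
| gge: "adj i j \<Longrightarrow> null_word adj [GenG i, GenG j, GenE i]"
| egg: "adj i j \<Longrightarrow> null_word adj [GenE i, GenG j, GenG i]"

inductive weq :: "(nat \<Rightarrow> nat \<Rightarrow> bool) \<Rightarrow> gen list \<Rightarrow> gen list \<Rightarrow> bool" for adj where
  base: "basic_rel adj u v \<Longrightarrow> weq adj u v"
| refl: "weq adj u u"
| sym: "weq adj u v \<Longrightarrow> weq adj v u"
| trans: "weq adj u v \<Longrightarrow> weq adj v w \<Longrightarrow> weq adj u w"
| append: "weq adj u v \<Longrightarrow> weq adj u' v' \<Longrightarrow> weq adj (u @ u') (v @ v')"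

lemmas [trans] = weq.trans
lemmas [simp, intro] = weq.refl

definition null :: "(nat \<Rightarrow> nat \<Rightarrow> bool) \<Rightarrow> gen list \<Rightarrow> bool" where
  "null adj u \<longleftrightarrow> (\<exists>p a q. null_word adj a \<and> weq adj u (p @ a @ q))"

lemma weq_ctx: "weq adj u v \<Longrightarrow> weq adj (p @ u @ q) (p @ v @ q)"
  by (intro weq.append weq.refl)

lemma weq_left: "weq adj u v \<Longrightarrow> weq adj (p @ u) (p @ v)"
  by (intro weq.append weq.refl)

lemma weq_right: "weq adj u v \<Longrightarrow> weq adj (u @ q) (v @ q)"
  by (intro weq.append weq.refl)

lemma weq_Cons: "weq adj u v \<Longrightarrow> weq adj (a # u) (a # v)"
  using weq_left[of adj u v "[a]"] by simp

lemma null_weq: "weq adj u v \<Longrightarrow> null adj v \<Longrightarrow> null adj u"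
  unfolding null_def using weq.trans by blast

lemma weq_null_trans [trans]: "weq adj u v \<Longrightarrow> null adj v \<Longrightarrow> null adj u"
  by (rule null_weq)

lemma null_ctx: "null adj u \<Longrightarrow> null adj (p @ u @ q)"
  unfolding null_def
proof (elim exE conjE)
  fix p' a q' assume a: "null_word adj a" "weq adj u (p' @ a @ q')"
  have "weq adj (p @ u @ q) ((p @ p') @ a @ (q' @ q))"
    using weq_ctx[OF a(2), of p q] by simp
  with a(1) show "\<exists>p' a q'. null_word adj a \<and> weq adj (p @ u @ q) (p' @ a @ q')" by blast
qed

lemma null_left: "null adj u \<Longrightarrow> null adj (p @ u)"
  using null_ctx[of adj u p "[]"] by simp

lemma null_right: "null adj u \<Longrightarrow> null adj (u @ q)"
  using null_ctx[of adj u "[]" q] by simp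

lemma null_base: "null_word adj a \<Longrightarrow> null adj a"
  unfolding null_def using weq.refl[of adj a] by (metis append_Nil append_Nil2)

text \<open>A basic relation can drop or introduce a node only as an end of an edge, and the edges
  lie in \<open>S\<close>.\<close>

lemma weq_set: "weq adj u v \<Longrightarrow> (\<And>i j. adj i j \<Longrightarrow> i \<in> S \<and> j \<in> S) \<Longrightarrow> u \<in> words_on S \<longleftrightarrow> v \<in> words_on S"
  by (induction rule: weq.induct) (auto elim!: basic_rel.cases)

lemma weq_height: "weq adj u v \<Longrightarrow> height u = height v"
  by (induction rule: weq.induct) (auto elim!: basic_rel.cases)

text \<open>Reversal exchanges \<open>gee\<close> with \<open>eeg\<close> and keeps every other kind
  of relation. This symmetry later allows the part of a word to the left of a letter
  \<open>e\<close> to be treated like the part to its right.\<close>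

lemma basic_rel_rev: "basic_rel adj u v \<Longrightarrow> weq adj (rev u) (rev v)"
proof (induction rule: basic_rel.induct)
  case (comm a b)
  then show ?case using weq.sym[OF weq.base[OF basic_rel.comm]] by simp
qed (auto intro: weq.base basic_rel.intros)

lemma weq_rev: "weq adj u v \<Longrightarrow> weq adj (rev u) (rev v)"
  by (induction rule: weq.induct) (auto intro: basic_rel_rev weq.sym weq.trans weq.append)

lemma null_rev: "null adj u \<Longrightarrow> null adj (rev u)"
proof -
  assume "null adj u"
  then obtain p a q where a: "null_word adj a" "weq adj u (p @ a @ q)" by (auto simp: null_def)
  have "null_word adj (rev a)" using a(1) by cases (auto intro: null_word.intros)
  moreover have "weq adj (rev u) (rev q @ rev a @ rev p)" using weq_rev[OF a(2)] by simp
  ultimately show ?thesis by (auto simp: null_def)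
qed

definition commuting :: "(nat \<Rightarrow> nat \<Rightarrow> bool) \<Rightarrow> nat \<Rightarrow> gen list \<Rightarrow> bool" where
  "commuting adj k w \<longleftrightarrow> (\<forall>a\<in>set w. gen_node a \<noteq> k \<and> \<not> adj k (gen_node a))"

lemma commuting_simps [simp]:
  "commuting adj k []"
  "commuting adj k (a # w) \<longleftrightarrow> gen_node a \<noteq> k \<and> \<not> adj k (gen_node a) \<and> commuting adj k w"
  "commuting adj k (u @ w) \<longleftrightarrow> commuting adj k u \<and> commuting adj k w"
  by (auto simp: commuting_def)

lemma weq_commute_word: "commuting adj (gen_node a) w \<Longrightarrow> weq adj (a # w) (w @ [a])"
proof (induction w)
  case (Cons b w)
  have "weq adj (a # b # w) (b # a # w)"
    using weq_right[OF weq.base[OF basic_rel.comm[of a b adj]], of w] Cons.prems by auto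
  also have "weq adj (b # a # w) (b # w @ [a])"
    by (rule weq_Cons) (use Cons in auto)
  finally show ?case by simp
qed auto

lemma weq_swap:
  assumes "gen_node a \<noteq> gen_node b" "\<not> adj (gen_node a) (gen_node b)"
  shows "weq adj (p @ a # b # q) (p @ b # a # q)"
  using weq_ctx[OF weq.base[OF basic_rel.comm[of a b adj]], of p q] assms by simp

lemma weq_idem: "weq adj (p @ GenE i # GenE i # q) (p @ GenE i # q)"
  using weq_ctx[OF weq.base[OF basic_rel.idem], of adj p i q] by simp

lemma weq_eee: "adj i j \<Longrightarrow> weq adj (p @ GenE i # GenE j # GenE i # q) (p @ GenE i # q)"
  using weq_ctx[OF weq.base[OF basic_rel.eee], of adj i j p q] by simp

lemma weq_gee: "adj i j \<Longrightarrow> weq adj (p @ GenG i # GenE j # GenE i # q) (p @ GenG j # GenE i # q)"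
  using weq_ctx[OF weq.base[OF basic_rel.gee], of adj i j p q] by simp

lemma weq_eeg: "adj i j \<Longrightarrow> weq adj (p @ GenE i # GenE j # GenG i # q) (p @ GenE i # GenG j # q)"
  using weq_ctx[OF weq.base[OF basic_rel.eeg], of adj i j p q] by simp

lemma weq_braid:
  "adj i j \<Longrightarrow> weq adj (p @ GenG i # GenG j # GenG i # q) (p @ GenG j # GenG i # GenG j # q)"
  using weq_ctx[OF weq.base[OF basic_rel.braid], of adj i j p q] by simp

section \<open>Simply laced diagrams and their roots\<close>

locale graph =
  fixes S :: "nat set" and adj :: "nat \<Rightarrow> nat \<Rightarrow> bool"
  assumes fin [simp]: "finite S"
    and adj_in: "adj i j \<Longrightarrow> i \<in> S \<and> j \<in> S"
    and adj_sym: "adj i j \<Longrightarrow> adj j i"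
    and adj_irrefl [simp]: "\<not> adj i i"
begin

abbreviation weq_here (infix "\<approx>" 50) where "u \<approx> v \<equiv> weq adj u v"

text \<open>The coefficient ring is left open because roots have integer coefficients, while
  averaging over a finite group takes place over the reals.\<close>

definition cartan :: "nat \<Rightarrow> nat \<Rightarrow> 'a::comm_ring_1" where
  "cartan k l = (if k = l then 2 else if adj k l then -1 else 0)"

definition ip :: "(nat \<Rightarrow> 'a::comm_ring_1) \<Rightarrow> nat \<Rightarrow> 'a" where
  "ip x k = (\<Sum>l\<in>S. x l * cartan k l)"

definition q :: "(nat \<Rightarrow> 'a::comm_ring_1) \<Rightarrow> 'a" where
  "q x = (\<Sum>k\<in>S. x k * ip x k)"

definition simple :: "nat \<Rightarrow> nat \<Rightarrow> 'a::comm_ring_1" where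
  "simple k = (\<lambda>l. if l = k then 1 else 0)"

definition supp :: "(nat \<Rightarrow> 'a::comm_ring_1) \<Rightarrow> bool" where
  "supp x \<longleftrightarrow> (\<forall>k. k \<notin> S \<longrightarrow> x k = 0)"

definition refl :: "nat \<Rightarrow> (nat \<Rightarrow> 'a::comm_ring_1) \<Rightarrow> nat \<Rightarrow> 'a" where
  "refl k x = x(k := x k - ip x k)"

definition act :: "nat list \<Rightarrow> (nat \<Rightarrow> 'a::comm_ring_1) \<Rightarrow> nat \<Rightarrow> 'a" where
  "act u x = foldr refl u x"

text \<open>A uniform bound on the coordinates, rather than mere positivity, gives finiteness of the
  root set at once and is easily passed to other diagrams with a new constant. By homogeneity
  integer vectors carry the same information as rational ones.\<close>

definition posdef :: bool where
  "posdef \<longleftrightarrow> (\<exists>C\<ge>0. \<forall>x :: nat \<Rightarrow> int. supp x \<longrightarrow> (\<forall>k\<in>S. (x k)\<^sup>2 \<le> C * q x))"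

lemma cartan_sym: "cartan k l = cartan l k"
  using adj_sym by (auto simp: cartan_def)

lemma cartan_self [simp]: "cartan k k = 2"
  by (simp add: cartan_def)

lemma act_simps [simp]: "act [] x = x" "act (k # u) x = refl k (act u x)" "act (u @ v) x = act u (act v x)"
  by (auto simp: act_def)

lemma ip_bump: "k \<in> S \<Longrightarrow> ip (x(k := x k + t)) l = ip x l + t * cartan l k"
proof -
  assume k: "k \<in> S"
  have "ip (x(k := x k + t)) l = (\<Sum>j\<in>S. x j * cartan l j + (if j = k then t * cartan l k else 0))"
    unfolding ip_def by (rule sum.cong) (auto simp: algebra_simps)
  then show ?thesis using k by (simp add: sum.distrib ip_def)
qed

lemma ip_simple: "k \<in> S \<Longrightarrow> ip (simple k) l = cartan l k"
  by (simp add: ip_def simple_def if_distrib[of "\<lambda>y. y * _"] cong: if_cong)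

lemma sum_cartan: "(\<Sum>l\<in>S. x l * cartan l k) = ip x k"
  unfolding ip_def by (rule sum.cong) (auto simp: cartan_sym)

lemma q_bump:
  fixes x :: "nat \<Rightarrow> 'a::comm_ring_1"
  shows "k \<in> S \<Longrightarrow> q (x(k := x k + t)) = q x + 2 * t * ip x k + 2 * t * t"
proof -
  assume k: "k \<in> S"
  let ?y = "x(k := x k + t)"
  have "q ?y = (\<Sum>l\<in>S. ?y l * (ip x l + t * cartan l k))"
    unfolding q_def ip_bump[OF k] by simp
  also have "\<dots> = (\<Sum>l\<in>S. x l * ip x l + t * (x l * cartan l k)
        + (if l = k then t * (ip x k + t * cartan k k) else 0))"
    by (rule sum.cong) (auto simp: algebra_simps)
  also have "\<dots> = q x + t * (\<Sum>l\<in>S. x l * cartan l k) + t * (ip x k + t * 2)"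
    using k by (simp add: sum.distrib q_def sum_distrib_left)
  finally show ?thesis by (simp add: sum_cartan algebra_simps)
qed

lemma q_simple: "k \<in> S \<Longrightarrow> q (simple k :: nat \<Rightarrow> 'a::comm_ring_1) = 2"
proof -
  assume k: "k \<in> S"
  have "q (simple k :: nat \<Rightarrow> 'a) = q ((\<lambda>_. 0)(k := (\<lambda>_. 0) k + 1))"
    by (rule arg_cong[where f = q]) (auto simp: simple_def)
  then show ?thesis using q_bump[OF k, of "\<lambda>_. 0 :: 'a" 1] by (simp add: q_def ip_def)
qed

lemma supp_simple: "k \<in> S \<Longrightarrow> supp (simple k)"
  by (auto simp: supp_def simple_def)

lemma supp_bump: "k \<in> S \<Longrightarrow> supp x \<Longrightarrow> supp (x(k := t))"
  by (auto simp: supp_def)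

lemma refl_eq: "refl k x = x(k := x k + (- ip x k))"
  by (simp add: refl_def)

lemma refl_apply: "refl k x l = (if l = k then x k - ip x k else x l)"
  by (simp add: refl_def)

lemma ip_refl: "k \<in> S \<Longrightarrow> ip (refl k x) l = ip x l - ip x k * cartan l k"
  by (simp only: refl_eq ip_bump) simp

lemma q_refl: "k \<in> S \<Longrightarrow> q (refl k x) = q x"
  by (simp only: refl_eq q_bump) (simp add: algebra_simps)

lemma supp_refl: "k \<in> S \<Longrightarrow> supp x \<Longrightarrow> supp (refl k x)"
  by (simp add: refl_def supp_bump)

lemma refl_invol: "k \<in> S \<Longrightarrow> refl k (refl k x) = x"
  by (subst refl_def) (auto simp: ip_refl, auto simp: refl_def)

lemma refl_comm: "k \<in> S \<Longrightarrow> l \<in> S \<Longrightarrow> \<not> adj k l \<Longrightarrow> refl k (refl l x) = refl l (refl k x)"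
  by (rule ext) (use adj_sym in \<open>auto simp: refl_apply ip_refl cartan_def\<close>)

lemma refl_braid:
  assumes kl: "adj k l" shows "refl k (refl l (refl k x)) = refl l (refl k (refl l x))"
proof -
  have kl': "k \<in> S" "l \<in> S" "k \<noteq> l" "adj l k" using kl adj_in adj_sym by auto
  show ?thesis
    by (rule ext) (use kl kl' in \<open>auto simp: refl_apply ip_refl cartan_def\<close>)
qed

lemma ip_add: "ip (\<lambda>l. x l + y l) k = ip x k + ip y k"
  by (simp add: ip_def algebra_simps sum.distrib)

lemma ip_diff: "ip (\<lambda>l. x l - y l) k = ip x k - ip y k"
  by (simp add: ip_def algebra_simps sum_subtractf)

lemma refl_add: "refl k (\<lambda>l. x l + y l) = (\<lambda>l. refl k x l + refl k y l)"
  by (auto simp: refl_def ip_add)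

lemma act_add: "act u (\<lambda>l. x l + y l) = (\<lambda>l. act u x l + act u y l)"
  by (induction u) (auto simp: refl_add)

lemma refl_simple_self: "k \<in> S \<Longrightarrow> refl k (simple k) = (\<lambda>l. - simple k l)"
  by (auto simp: refl_def ip_simple) (auto simp: simple_def)

lemma refl_simple_comm: "k \<in> S \<Longrightarrow> j \<in> S \<Longrightarrow> k \<noteq> j \<Longrightarrow> \<not> adj k j \<Longrightarrow> refl k (simple j) = simple j"
  by (auto simp: refl_def ip_simple cartan_def)

lemma refl_simple_adj: "adj k j \<Longrightarrow> refl k (simple j) = (\<lambda>l. simple j l + simple k l)"
  using adj_in[of k j] by (auto simp: refl_def ip_simple cartan_def) (auto simp: simple_def)

lemma act_supp: "set u \<subseteq> S \<Longrightarrow> supp x \<Longrightarrow> supp (act u x)"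
  by (induction u) (auto intro: supp_refl)

lemma act_q: "set u \<subseteq> S \<Longrightarrow> q (act u x) = q x"
  by (induction u) (auto simp: q_refl)

text \<open>By \<open>q_bump\<close>, setting one coordinate to zero changes \<open>q\<close> by an
  even amount.\<close>

lemma even_q: "A \<subseteq> S \<Longrightarrow> (\<And>k. k \<notin> A \<Longrightarrow> x k = 0) \<Longrightarrow> even (q (x :: nat \<Rightarrow> int))"
proof (induction "card A" arbitrary: A x)
  case 0
  then have "A = {}" using finite_subset[OF _ fin] by (metis card_eq_0_iff)
  then have "q x = 0" using 0 by (simp add: q_def)
  then show ?case by simp
next
  case (Suc n)
  then obtain k where k: "k \<in> A" by fastforce
  let ?y = "x(k := 0)"
  have "even (q ?y)"
  proof (rule Suc.hyps(1))
    show "n = card (A - {k})" using Suc.hyps(2) k by simp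
  qed (use Suc.prems in auto)
  moreover have "x = ?y(k := ?y k + x k)" by auto
  then have "q x = q ?y + 2 * x k * ip ?y k + 2 * x k * x k" using q_bump[of k ?y "x k"] k Suc.prems by auto
  ultimately show ?case by simp
qed

end

locale posgraph = graph +
  assumes posdef: "posdef"
begin

lemma q_nonneg: "supp (x :: nat \<Rightarrow> int) \<Longrightarrow> q x \<ge> 0"
  and q_zero: "supp (x :: nat \<Rightarrow> int) \<Longrightarrow> q x \<le> 0 \<Longrightarrow> x = (\<lambda>_. 0)"
proof -
  obtain C where C: "C \<ge> 0" "\<And>x :: nat \<Rightarrow> int. supp x \<Longrightarrow> (\<forall>k\<in>S. (x k)\<^sup>2 \<le> C * q x)"
    using posdef unfolding posdef_def by blast
  show z: "x = (\<lambda>_. 0)" if "supp x" "q x \<le> 0" for x :: "nat \<Rightarrow> int"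
  proof
    fix k
    have "(x k)\<^sup>2 \<le> 0" if "k \<in> S"
      using C(2)[OF \<open>supp x\<close>] that \<open>q x \<le> 0\<close> C(1) by (meson mult_nonneg_nonpos order_trans)
    then show "x k = 0" using \<open>supp x\<close> by (auto simp: supp_def)
  qed
  show "q x \<ge> 0" if "supp x" for x :: "nat \<Rightarrow> int"
  proof (rule ccontr)
    assume "\<not> q x \<ge> 0"
    then have "x = (\<lambda>_. 0)" using z[OF that] by simp
    then show False using \<open>\<not> q x \<ge> 0\<close> by (simp add: q_def)
  qed
qed

text \<open>Roots are taken to be the integer vectors of norm two, without reference to the orbits
  of the reflection group.\<close>

definition root :: "(nat \<Rightarrow> int) \<Rightarrow> bool" where
  "root x \<longleftrightarrow> supp x \<and> q x = 2"

lemma root_simple: "k \<in> S \<Longrightarrow> root (simple k)"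
  by (simp add: root_def supp_simple q_simple)

lemma root_act: "set u \<subseteq> S \<Longrightarrow> root x \<Longrightarrow> root (act u x)"
  by (simp add: root_def act_supp act_q)

lemma root_bump: "root x \<Longrightarrow> k \<in> S \<Longrightarrow> ip x k = -1 \<Longrightarrow> root (x(k := x k + 1))"
  using q_bump[of k x 1] by (auto simp: root_def supp_bump)

text \<open>
  The positive and negative parts of a vector have non-positive inner product, and the form takes
  even values.
\<close>

lemma root_pos_or_neg:
  assumes "root x" shows "(\<forall>k. x k \<ge> 0) \<or> (\<forall>k. x k \<le> 0)"
proof (rule ccontr)
  assume neg: "\<not> ?thesis"
  define a b where "a = (\<lambda>k. max (x k) 0)" and "b = (\<lambda>k. max (- x k) 0)"
  have x: "x = (\<lambda>k. a k - b k)" by (auto simp: a_def b_def)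
  have ab: "supp a" "supp b" using assms by (auto simp: root_def supp_def a_def b_def)
  have ne: "a \<noteq> (\<lambda>_. 0)" "b \<noteq> (\<lambda>_. 0)"
    using neg by (auto simp: a_def b_def fun_eq_iff max_def split: if_splits)
  have pos: "q a \<ge> 2" "q b \<ge> 2"
  proof -
    have "q a > 0" "q b > 0" using q_zero[OF ab(1)] q_zero[OF ab(2)] ne by fastforce+
    moreover have "even (q a)" "even (q b)" using even_q[of S] ab by (auto simp: supp_def)
    ultimately show "q a \<ge> 2" "q b \<ge> 2" by presburger+
  qed
  define m where "m = (\<Sum>k\<in>S. a k * ip b k)"
  have m2: "m = (\<Sum>k\<in>S. b k * ip a k)"
    unfolding m_def ip_def sum_distrib_left
    by (subst sum.swap) (auto intro!: sum.cong simp: cartan_sym algebra_simps)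
  have "m \<le> 0"
    unfolding m_def ip_def sum_distrib_left
    by (intro sum_nonpos) (auto simp: a_def b_def cartan_def max_def mult_nonneg_nonneg)
  moreover have "q x = q a + q b - 2 * m"
  proof -
    have "q x = (\<Sum>k\<in>S. a k * ip a k + b k * ip b k - a k * ip b k - b k * ip a k)"
      unfolding q_def by (rule sum.cong) (auto simp: x ip_diff algebra_simps)
    also have "\<dots> = q a + q b - m - m" by (simp add: q_def m2[symmetric] sum.distrib sum_subtractf m_def)
    finally show ?thesis by simp
  qed
  ultimately show False using assms pos by (simp add: root_def)
qed

definition posroot :: "(nat \<Rightarrow> int) \<Rightarrow> bool" where
  "posroot x \<longleftrightarrow> root x \<and> (\<forall>k. x k \<ge> 0)"

lemma posroot_simple: "k \<in> S \<Longrightarrow> posroot (simple k)"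
  by (auto simp: posroot_def root_simple) (auto simp: simple_def)

text \<open>The vectors obtained by adding or subtracting \<alpha>_k have norm
  \<open>4 + 2 * ip x k\<close> and \<open>4 - 2 * ip x k\<close>. Both are non-negative, and norm
  zero forces \<open>x\<close> to be -\<alpha>_k, which is not positive, or \<alpha>_k.\<close>

lemma posroot_ip:
  assumes "posroot x" "k \<in> S"
  shows "ip x k \<in> {-1, 0, 1} \<or> x = simple k"
proof -
  have s: "supp x" and q: "q x = 2" using assms by (auto simp: posroot_def root_def)
  have up: "q (x(k := x k + 1)) = 4 + 2 * ip x k" using q_bump[OF assms(2), of x 1] q by simp
  have down: "q (x(k := x k + (-1))) = 4 - 2 * ip x k" using q_bump[OF assms(2), of x "-1"] q by simp
  have b: "ip x k \<ge> -2" "ip x k \<le> 2"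
    using q_nonneg[OF supp_bump[OF assms(2) s]] up down
    by (smt (verit, best))+
  have "ip x k \<noteq> -2"
  proof
    assume "ip x k = -2"
    then have "x(k := x k + 1) = (\<lambda>_. 0)" using q_zero[OF supp_bump[OF assms(2) s]] up by simp
    then have "x k + 1 = 0" by (metis fun_upd_same)
    moreover have "x k \<ge> 0" using assms by (auto simp: posroot_def)
    ultimately show False by simp
  qed
  moreover have "x = simple k" if "ip x k = 2"
  proof -
    have z: "x(k := x k + (-1)) = (\<lambda>_. 0)" using q_zero[OF supp_bump[OF assms(2) s]] down that by simp
    show ?thesis
    proof
      fix l show "x l = simple k l" using fun_cong[OF z, of l] by (auto simp: simple_def split: if_splits)
    qed
  qed
  moreover have "ip x k = -2 \<or> ip x k = -1 \<or> ip x k = 0 \<or> ip x k = 1 \<or> ip x k = 2" using b by presburger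
  ultimately show ?thesis by auto
qed

lemma posroot_bump: "posroot x \<Longrightarrow> k \<in> S \<Longrightarrow> ip x k = -1 \<Longrightarrow> posroot (x(k := x k + 1))"
  unfolding posroot_def using root_bump by auto

lemma finite_posroots: "finite {x. posroot x}"
proof -
  obtain C where C: "C \<ge> 0" "\<And>x :: nat \<Rightarrow> int. supp x \<Longrightarrow> (\<forall>k\<in>S. (x k)\<^sup>2 \<le> C * q x)"
    using posdef unfolding posdef_def by blast
  have "{x. posroot x} \<subseteq> {x. \<forall>k. (k \<in> S \<longrightarrow> x k \<in> {0..2 * C}) \<and> (k \<notin> S \<longrightarrow> x k = 0)}"
  proof safe
    fix x k assume x: "posroot x"
    then have s: "supp x" "q x = 2" "x k \<ge> 0" by (auto simp: posroot_def root_def)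
    then show "k \<notin> S \<Longrightarrow> x k = 0" by (simp add: supp_def)
    assume "k \<in> S"
    then have "(x k)\<^sup>2 \<le> 2 * C" using C(2)[OF s(1)] s(2) by (simp add: mult.commute)
    moreover have "x k \<le> (x k)\<^sup>2"
      using mult_left_mono[of 1 "x k" "x k"] s(3) by (cases "x k = 0") (auto simp: power2_eq_square)
    ultimately show "x k \<in> {0..2 * C}" using s by simp
  qed
  moreover have "finite \<dots>" by (rule finite_set_of_finite_funs) auto
  ultimately show ?thesis by (rule finite_subset)
qed

end

section \<open>Words in the letters \<open>g\<close> and the exchange condition\<close>

context posgraph
begin

text \<open>The exchange condition, with \<open>null\<close> in place of cancellation of equal
  letters. Let \<open>k\<close> be the last letter of \<open>u\<close> and \<open>u1\<close> the
  rest. If \<open>k\<close> is neither \<open>j\<close> nor adjacent to \<open>j\<close>, it fixes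
  \<alpha>_j and the claim for \<open>u1\<close> is moved across \<open>k\<close>. If it is
  adjacent, \<open>u1\<close> can be made to end in \<open>k j\<close>, and the braid relation turns
  \<open>k j k\<close> into \<open>j k j\<close>. The equality of actions is carried along because
  the adjacent case uses the claim twice.\<close>

lemma neg_last:
  assumes "set u \<subseteq> S" "j \<in> S" "\<forall>k. act u (simple j :: nat \<Rightarrow> int) k \<le> 0"
  shows "null adj (map GenG u) \<or>
    (\<exists>u'. set u' \<subseteq> S \<and> length u = Suc (length u') \<and> map GenG u \<approx> map GenG (u' @ [j]) \<and>
      (\<forall>x :: nat \<Rightarrow> int. act u x = act (u' @ [j]) x))"
  using assms
proof (induction "length u" arbitrary: u j rule: less_induct)
  case less
  let ?s = "simple :: nat \<Rightarrow> nat \<Rightarrow> int"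
  show ?case
  proof (cases u rule: rev_cases)
    case Nil
    then show ?thesis using less.prems(3)[rule_format, of j] by (simp add: simple_def)
  next
    case (snoc u1 k)
    have k: "k \<in> S" "set u1 \<subseteq> S" and j: "j \<in> S" using less.prems snoc by auto
    have lt: "length u1 < length u" using snoc by simp
    show ?thesis
    proof (cases "null adj (map GenG u1)")
      case True
      then show ?thesis using null_right[OF True, of "[GenG k]"] by (simp add: snoc)
    next
      case nn: False
      show ?thesis
      proof (cases "k = j")
        case True
        then show ?thesis using snoc k by auto
      next
        case kj: False
        show ?thesis
        proof (cases "adj k j")
          case False
          then have njk: "\<not> adj j k" using adj_sym by blast
          have a: "act u (?s j) = act u1 (?s j)" using refl_simple_comm[OF k(1) j kj False, where ?'a = int] snoc by simp
          obtain u' where u': "set u' \<subseteq> S" "length u1 = Suc (length u')" "map GenG u1 \<approx> map GenG (u' @ [j])"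
              "\<forall>x :: nat \<Rightarrow> int. act u1 x = act (u' @ [j]) x"
            using less.hyps[OF lt k(2) j] less.prems(3) nn unfolding a by auto
          have "map GenG u \<approx> map GenG (u' @ [j]) @ [GenG k]"
            using weq_right[OF u'(3), of "[GenG k]"] snoc by simp
          also have "\<dots> \<approx> map GenG (u' @ [k, j])"
            using weq_swap[of "GenG j" "GenG k" adj "map GenG u'" "[]"] kj False adj_sym by auto
          finally have "map GenG u \<approx> map GenG ((u' @ [k]) @ [j])" by simp
          moreover have "act u x = act ((u' @ [k]) @ [j]) x" for x :: "nat \<Rightarrow> int"
            using u'(4) refl_comm[OF j k(1) njk, of x] snoc by simp
          ultimately show ?thesis using u'(1,2) k snoc by (intro disjI2 exI[of _ "u' @ [k]"]) auto
        next
          case True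
          have jk: "adj j k" using True adj_sym by blast
          have a: "act u (?s j) = (\<lambda>l. act u1 (?s j) l + act u1 (?s k) l)"
            using refl_simple_adj[OF True, where ?'a = int] snoc by (simp add: act_add)
          have r: "root (act u1 (?s i))" if "i \<in> S" for i
            using that k(2) by (intro root_act root_simple)
          show ?thesis
          proof (cases "\<forall>l. act u1 (?s k) l \<le> 0")
            \<comment> \<open>Here \<open>u1\<close> can be made to end in \<open>k\<close>, so that
              \<open>u\<close> ends in a doubled letter.\<close>
            case True
            then obtain u' where u': "map GenG u1 \<approx> map GenG (u' @ [k])"
              using less.hyps[OF lt k(2) k(1)] nn by auto
            have "map GenG u \<approx> map GenG u' @ [GenG k, GenG k]"
              using weq_right[OF u', of "[GenG k]"] snoc by simp
            also have "null adj \<dots>" by (intro null_left null_base null_word.gg)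
            finally show ?thesis ..
          next
            case kpos: False
            \<comment> \<open>The images of \<alpha>_j and \<alpha>_k are roots, hence each has a
              sign, and their sum is non-positive.\<close>
            have "\<forall>l. act u1 (?s j) l \<le> 0"
            proof (rule ccontr)
              assume "\<not> ?thesis"
              then have "\<forall>l. act u1 (?s j) l \<ge> 0" "\<forall>l. act u1 (?s k) l \<ge> 0"
                using root_pos_or_neg[OF r[OF j]] root_pos_or_neg[OF r[OF k(1)]] kpos by auto
              moreover obtain l where "act u1 (?s k) l > 0" using kpos by (meson not_le)
              ultimately show False using less.prems(3)[rule_format, of l] unfolding a
                by (smt (verit, best))
            qed
            then obtain u2 where u2: "set u2 \<subseteq> S" "length u1 = Suc (length u2)"
                "map GenG u1 \<approx> map GenG (u2 @ [j])" "\<forall>x :: nat \<Rightarrow> int. act u1 x = act (u2 @ [j]) x"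
              using less.hyps[OF lt k(2) j] nn by auto
            \<comment> \<open>Adjacent reflections take each other's simple root to the sum of the
              two. So \<open>u2\<close> sends \<alpha>_k to the negative image of \<alpha>_j under
              \<open>u\<close>, and the claim applies to \<open>u2\<close> and
              \<open>k\<close>.\<close>
            have "refl j (refl k (?s j)) = refl j (refl j (?s k))"
              using refl_simple_adj[OF True, where ?'a = int] refl_simple_adj[OF jk, where ?'a = int]
              by (simp add: add.commute)
            then have "act u (?s j) = act u2 (?s k)" using u2(4) refl_invol[OF j, of "?s k"] snoc by simp
            moreover have "length u2 < length u" using u2(2) lt by simp
            moreover have nn2: "\<not> null adj (map GenG u2)"
              using nn null_weq[OF u2(3)] null_right[of adj "map GenG u2"] by auto
            ultimately obtain u3 where u3: "set u3 \<subseteq> S" "length u2 = Suc (length u3)"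
                "map GenG u2 \<approx> map GenG (u3 @ [k])" "\<forall>x :: nat \<Rightarrow> int. act u2 x = act (u3 @ [k]) x"
              using less.hyps[of u2 k] u2(1) k(1) less.prems(3) by auto
            have "map GenG u \<approx> map GenG u2 @ [GenG j, GenG k]"
              using weq_right[OF u2(3), of "[GenG k]"] snoc by simp
            also have "\<dots> \<approx> map GenG u3 @ [GenG k, GenG j, GenG k]"
              using weq_right[OF u3(3), of "[GenG j, GenG k]"] by simp
            also have "\<dots> \<approx> map GenG u3 @ [GenG j, GenG k, GenG j]"
              using weq_braid[of adj k j "map GenG u3" "[]"] True by simp
            finally have "map GenG u \<approx> map GenG ((u3 @ [j, k]) @ [j])" by simp
            moreover have "act u x = act ((u3 @ [j, k]) @ [j]) x" for x :: "nat \<Rightarrow> int"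
              using u2(4) u3(4) refl_braid[OF True, of x] snoc by simp
            ultimately show ?thesis using u2(2) u3(1,2) k j snoc
              by (intro disjI2 exI[of _ "u3 @ [j, k]"]) auto
          qed
        qed
      qed
    qed
  qed
qed

lemma neg_null:
  assumes "set u \<subseteq> S" "j \<in> S" "\<forall>k. act u (simple j :: nat \<Rightarrow> int) k \<le> 0"
  shows "null adj (map GenG (u @ [j]))"
proof (cases "null adj (map GenG u)")
  case True
  then show ?thesis using null_right by simp
next
  case False
  then obtain u' where u': "map GenG u \<approx> map GenG (u' @ [j])" using neg_last[OF assms] by auto
  have "map GenG (u @ [j]) \<approx> map GenG u' @ [GenG j, GenG j]"
    using weq_right[OF u', of "[GenG j]"] by simp
  also have "null adj \<dots>" by (intro null_left null_base null_word.gg)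
  finally show ?thesis .
qed

text \<open>
  The positive roots made negative by the inverse of a reduced word are distinct, one for each
  letter.
\<close>

lemma G_word_length:
  assumes "set u \<subseteq> S" "\<not> null adj (map GenG u)"
  shows "length u \<le> card {x. posroot x}"
proof -
  define b where "b t = act (take t u) (simple (u ! t) :: nat \<Rightarrow> int)" for t
  have S: "u ! t \<in> S" "set (take t u) \<subseteq> S" "set (drop t u) \<subseteq> S" if "t < length u" for t
    using assms(1) that set_take_subset[of t u] set_drop_subset[of t u] nth_mem[OF that] by blast+
  have sub: "\<not> null adj (map GenG v)" if "u = p @ v @ w" for p v w
    using assms(2) null_ctx[of adj "map GenG v" "map GenG p" "map GenG w"] that by auto
  have pos: "posroot (b t)" if "t < length u" for t
  proof -
    have r: "root (b t)" unfolding b_def by (intro root_act root_simple S that)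
    moreover have "\<not> (\<forall>k. b t k \<le> 0)"
    proof
      assume "\<forall>k. b t k \<le> 0"
      then have "null adj (map GenG (take t u @ [u ! t]))"
        unfolding b_def using that by (intro neg_null S)
      moreover have "u = [] @ (take t u @ [u ! t]) @ drop (Suc t) u"
        using id_take_nth_drop[OF that] by simp
      ultimately show False using sub by blast
    qed
    ultimately show ?thesis using root_pos_or_neg unfolding posroot_def by blast
  qed
  \<comment> \<open>If the two roots agreed, the word \<open>v\<close> between the positions would
    send the simple root at \<open>t\<close> to the negative of the one at \<open>s\<close>, and
    \<open>neg_null\<close> would make a factor of \<open>u\<close> null.\<close>
  have "b s \<noteq> b t" if st: "s < t" "t < length u" for s t
  proof
    assume eq: "b s = b t"
    define v where "v = take (t - Suc s) (drop (Suc s) u)"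
    have dec: "take t u = take s u @ (u ! s) # v"
      unfolding v_def using st
      by (metis Cons_nth_drop_Suc Suc_diff_Suc add_diff_inverse_nat less_trans not_less_iff_gr_or_eq take_Suc_Cons take_add)
    have inv: "act (rev w) (act w x) = x" if "set w \<subseteq> S" for w and x :: "nat \<Rightarrow> int"
      using that by (induction w arbitrary: x) (auto simp: refl_invol)
    have s: "s < length u" using st by simp
    have "set v \<subseteq> S" unfolding v_def using S(3)[OF s] assms(1)
      by (meson order_trans set_drop_subset set_take_subset)
    have "act (take s u) (simple (u ! s) :: nat \<Rightarrow> int) = act (take s u) (refl (u ! s) (act v (simple (u ! t))))"
      using eq dec unfolding b_def by simp
    then have "simple (u ! s) = refl (u ! s) (act v (simple (u ! t) :: nat \<Rightarrow> int))"
      using inv[OF S(2)[OF s]] by metis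
    then have "act v (simple (u ! t) :: nat \<Rightarrow> int) = refl (u ! s) (simple (u ! s))"
      using refl_invol[OF S(1)[OF s]] by metis
    then have "act v (simple (u ! t) :: nat \<Rightarrow> int) = (\<lambda>l. - simple (u ! s) l)"
      using refl_simple_self[OF S(1)[OF s]] by simp
    then have "null adj (map GenG (v @ [u ! t]))"
      by (intro neg_null \<open>set v \<subseteq> S\<close> S(1) st) (simp add: simple_def)
    moreover have "u = (take s u @ [u ! s]) @ (v @ [u ! t]) @ drop (Suc t) u"
      using id_take_nth_drop[OF st(2)] dec by simp
    ultimately show False using sub by blast
  qed
  then have "inj_on b {..<length u}" by (intro inj_onI) (metis lessThan_iff linorder_neqE_nat)
  then have "card {..<length u} \<le> card {x. posroot x}"
    by (rule card_inj_on_le) (use pos finite_posroots in auto)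
  then show ?thesis by simp
qed

end

section \<open>The diagram of the roots orthogonal to a simple root\<close>

lemma basic_rel_gmap:
  assumes "basic_rel adj u v" "u \<in> words_on A" "inj_on f A"
    and "\<And>x y. x \<in> A \<Longrightarrow> y \<in> A \<Longrightarrow> adj' (f x) (f y) \<longleftrightarrow> adj x y"
  shows "basic_rel adj' (map (gmap f) u) (map (gmap f) v)"
  using assms(1)
proof cases
  case (comm a b)
  then show ?thesis
    using basic_rel.comm[of "gmap f a" "gmap f b" adj'] assms by (auto simp: inj_on_def)
qed (use assms in \<open>auto intro: basic_rel.intros\<close>)

lemma null_word_gmap:
  assumes "null_word adj u" "u \<in> words_on A"
    and "\<And>x y. x \<in> A \<Longrightarrow> y \<in> A \<Longrightarrow> adj' (f x) (f y) \<longleftrightarrow> adj x y"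
  shows "null_word adj' (map (gmap f) u)"
  using assms by cases (auto intro: null_word.intros)

text \<open>The relations have rank at most two, so a relation of the smaller diagram can be checked
  after realizing just two of its nodes.\<close>

lemma basic_rel_two_nodes:
  assumes "basic_rel adj u v"
  obtains x y where "u \<in> words_on {x, y}" "v \<in> words_on {x, y}" "x \<in> gen_node ` set u" "y \<in> gen_node ` set u"
  using assms
proof cases
  case (comm a b) then show ?thesis by (intro that[of "gen_node a" "gen_node b"]) auto
next
  case (idem i) then show ?thesis by (intro that[of i i]) auto
next
  case (braid i j) then show ?thesis by (intro that[of i j]) auto
next
  case (eee i j) then show ?thesis by (intro that[of i j]) auto
next
  case (gee i j) then show ?thesis by (intro that[of i j]) auto
next
  case (eeg i j) then show ?thesis by (intro that[of i j]) auto
qed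

lemma null_word_two_nodes:
  assumes "null_word adj u"
  obtains x y where "u \<in> words_on {x, y}" "x \<in> gen_node ` set u" "y \<in> gen_node ` set u"
  using assms
proof cases
  case (gg i) then show ?thesis by (intro that[of i i]) auto
next
  case (ge i) then show ?thesis by (intro that[of i i]) auto
next
  case (eg i) then show ?thesis by (intro that[of i i]) auto
next
  case (ege i j) then show ?thesis by (intro that[of i j]) auto
next
  case (gge i j) then show ?thesis by (intro that[of i j]) auto
next
  case (egg i j) then show ?thesis by (intro that[of i j]) auto
qed

text \<open>Every edge joins a node to its parent and \<open>rk\<close> drops towards the root
  \<open>i\<close>, so the diagram is a tree. By \<open>one_child\<close> it can branch only at
  \<open>i\<close>, which lets letters travel along paths; by \<open>three_nbrs\<close> any two
  pairs of neighbours of \<open>i\<close> meet.\<close>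

locale rooted = posgraph +
  fixes i :: nat and par :: "nat \<Rightarrow> nat" and rk :: "nat \<Rightarrow> nat"
  assumes i_in: "i \<in> S"
    and par_adj: "j \<in> S \<Longrightarrow> j \<noteq> i \<Longrightarrow> adj j (par j) \<and> rk (par j) < rk j"
    and edge: "adj j k \<Longrightarrow> j \<noteq> i \<and> par j = k \<or> k \<noteq> i \<and> par k = j"
    and one_child: "adj j k \<Longrightarrow> adj j l \<Longrightarrow> j \<noteq> i \<Longrightarrow> k \<noteq> par j \<Longrightarrow> l \<noteq> par j \<Longrightarrow> k = l"
    and three_nbrs: "card {k. adj i k} \<le> 3"
begin

lemma par_in: "j \<in> S \<Longrightarrow> j \<noteq> i \<Longrightarrow> par j \<in> S"
  using par_adj adj_in by blast

lemma nbr_par: "adj i a \<Longrightarrow> a \<noteq> i \<and> par a = i"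
  using edge by (metis adj_irrefl)

text \<open>The node of largest rank in a triangle would have two parents.\<close>

lemma no_triangle: "adj j k \<Longrightarrow> adj k l \<Longrightarrow> \<not> adj j l"
proof
  assume a: "adj j k" "adj k l" "adj j l"
  have e: "adj x y \<Longrightarrow> (rk x < rk y \<and> par y = x) \<or> (rk y < rk x \<and> par x = y)" for x y
    using edge[of x y] par_adj adj_in by metis
  show False
    using e[OF a(1)] e[OF a(2)] e[OF a(3)] by (elim disjE conjE; force)
qed

lemma nbrs_not_adj: "adj i a \<Longrightarrow> adj i b \<Longrightarrow> \<not> adj a b"
  using no_triangle by blast

text \<open>Such a node \<open>d\<close> would be a child of both \<open>a\<close> and
  \<open>b\<close>, whose parent is \<open>i\<close>.\<close>

lemma no_square: "adj i a \<Longrightarrow> adj i b \<Longrightarrow> a \<noteq> b \<Longrightarrow> d \<noteq> i \<Longrightarrow> adj a d \<Longrightarrow> \<not> adj b d"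
  using edge nbr_par by metis

function path :: "nat \<Rightarrow> gen list" where
  "path j = (if j \<in> S \<and> j \<noteq> i then path (par j) @ [GenE j] else [GenE j])"
  by pat_completeness auto
termination by (relation "measure rk") (use par_adj in auto)

declare path.simps [simp del]

lemma path_i: "path i = [GenE i]"
  by (simp add: path.simps)

lemma path_par: "j \<in> S \<Longrightarrow> j \<noteq> i \<Longrightarrow> path j = path (par j) @ [GenE j]"
  by (simp add: path.simps)

lemma rk_induct [consumes 1, case_names root step]:
  assumes "j \<in> S" "P i" "\<And>j. j \<in> S \<Longrightarrow> j \<noteq> i \<Longrightarrow> (\<And>k. k \<in> S \<Longrightarrow> rk k < rk j \<Longrightarrow> P k) \<Longrightarrow> P j"
  shows "P j"
  using assms(1) by (induction "rk j" arbitrary: j rule: less_induct) (use assms(2,3) in metis)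

lemma path_last: "\<exists>w. path j = w @ [GenE j]"
  by (subst path.simps) auto

lemma path_hd: "j \<in> S \<Longrightarrow> \<exists>w. path j = GenE i # w"
proof (induction j rule: rk_induct)
  case (step j)
  then obtain w where "path (par j) = GenE i # w" using par_adj[of j] par_in[of j] by metis
  then show ?case using step by (simp add: path_par)
qed (simp add: path_i)

lemma Ei_path: "j \<in> S \<Longrightarrow> GenE i # path j \<approx> path j"
  using path_hd[of j] weq_idem[of adj "[]" i] by auto

text \<open>
  A node \<open>b \<noteq> i\<close> that is not adjacent to \<open>i\<close> is coded as the pair \<open>(b, b)\<close>, a set \<open>{a, b}\<close> of two
  neighbours of \<open>i\<close> as \<open>(a, b)\<close> with \<open>a < b\<close>.
\<close>

definition dnodes :: "nat set" where
  "dnodes = prod_encode ` ({(b, b) |b. b \<in> S \<and> b \<noteq> i \<and> \<not> adj i b} \<union> {(a, b). adj i a \<and> adj i b \<and> a < b})"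

text \<open>Adjacency is inner product -1 of the attached roots, \<alpha>_b for
  \<open>(b, b)\<close> and \<alpha>_a + \<alpha>_i + \<alpha>_b for \<open>(a, b)\<close>. The
  roots of two distinct pairs that share a neighbour are orthogonal, so at least one of two adjacent
  nodes must be single.\<close>

definition dadj :: "nat \<Rightarrow> nat \<Rightarrow> bool" where
  "dadj m n \<longleftrightarrow> m \<in> dnodes \<and> n \<in> dnodes \<and>
     (case prod_decode m of (x, y) \<Rightarrow> case prod_decode n of (u, v) \<Rightarrow>
       (x = y \<or> u = v) \<and> (adj x u \<or> adj x v \<or> adj y u \<or> adj y v))"

definition phi :: "gen \<Rightarrow> gen list" where
  "phi a = (case prod_decode (gen_node a) of (x, y) \<Rightarrow>
     if x = y then [gmap (\<lambda>_. x) a] else [GenE i, GenE x, gmap (\<lambda>_. y) a, GenE i])"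

text \<open>The leading \<open>e\<^sub>i\<close> is the identity of
  \<open>e\<^sub>i M e\<^sub>i\<close>. Every \<open>phi a\<close> commutes with it, so one copy in
  front serves the whole word.\<close>

definition Phi :: "gen list \<Rightarrow> gen list" where
  "Phi u = GenE i # concat (map phi u)"

text \<open>For \<open>w\<close> commuting with \<open>j\<close> this is the image of
  \<open>e\<^sub>j w e\<^sub>j\<close> under multiplication by \<open>e\<^sub>i\<close> from both
  sides, a passage from \<open>e\<^sub>j M e\<^sub>j\<close> to \<open>e\<^sub>i M e\<^sub>i\<close>
  along the edge between \<open>i\<close> and \<open>j\<close>.\<close>

definition transport :: "nat \<Rightarrow> gen list \<Rightarrow> gen list" where
  "transport j w = (if j = i then GenE i # w else [GenE i, GenE j] @ w @ [GenE j, GenE i])"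

text \<open>Seen from \<open>e\<^sub>j\<close>, the generators at the derived node \<open>m\<close>
  are the plain letters at \<open>k\<close>.\<close>

definition realizes :: "nat \<Rightarrow> nat \<Rightarrow> nat \<Rightarrow> bool" where
  "realizes j k m \<longleftrightarrow> (j = i \<or> adj i j) \<and> k \<noteq> j \<and> \<not> adj j k \<and> k \<in> S \<and>
     (\<forall>a. gen_node a = m \<longrightarrow> Phi [a] \<approx> transport j [gmap (\<lambda>_. k) a])"

lemma dnodes_cases:
  assumes "m \<in> dnodes"
  obtains (single) b where "m = prod_encode (b, b)" "b \<in> S" "b \<noteq> i" "\<not> adj i b"
  | (pair) a b where "m = prod_encode (a, b)" "adj i a" "adj i b" "a < b"
  using assms unfolding dnodes_def by blast

lemma dnodesI:
  "b \<in> S \<Longrightarrow> b \<noteq> i \<Longrightarrow> \<not> adj i b \<Longrightarrow> prod_encode (b, b) \<in> dnodes"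
  "adj i a \<Longrightarrow> adj i b \<Longrightarrow> a < b \<Longrightarrow> prod_encode (a, b) \<in> dnodes"
  unfolding dnodes_def by blast+

lemma Phi_Nil [simp]: "Phi [] = [GenE i]"
  by (simp add: Phi_def)

lemma weq_commute_E:
  assumes "commuting adj j w"
  shows "x @ GenE j # w @ y \<approx> x @ w @ GenE j # y"
  using weq_ctx[OF weq_commute_word[of adj "GenE j" w], of x y] assms by simp

text \<open>The inner factor \<open>e\<^sub>j e\<^sub>i e\<^sub>i e\<^sub>j\<close> contracts to
  \<open>e\<^sub>j\<close>, which passes \<open>w\<close> and is absorbed by the first
  \<open>e\<^sub>j\<close>.\<close>

lemma transport_mult:
  assumes "j = i \<or> adj i j" "commuting adj j w"
  shows "transport j w @ transport j w' \<approx> transport j (w @ w')"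
proof (cases "j = i")
  case True
  have "GenE i # w @ GenE i # w' \<approx> GenE i # GenE i # w @ w'"
    using weq.sym[OF weq_commute_E[of i w "[GenE i]" w']] assms True by simp
  also have "\<dots> \<approx> GenE i # w @ w'" using weq_idem[of adj "[]"] by simp
  finally show ?thesis using True by (simp add: transport_def)
next
  case False
  then have a: "adj j i" using assms adj_sym by blast
  have "[GenE i, GenE j] @ w @ [GenE j, GenE i, GenE i, GenE j] @ w' @ [GenE j, GenE i] \<approx>
    [GenE i, GenE j] @ w @ [GenE j, GenE i, GenE j] @ w' @ [GenE j, GenE i]"
    using weq_idem[of adj "[GenE i, GenE j] @ w @ [GenE j]" i "[GenE j] @ w' @ [GenE j, GenE i]"] by simp
  also have "\<dots> \<approx> [GenE i, GenE j] @ w @ [GenE j] @ w' @ [GenE j, GenE i]"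
    using weq_eee[of adj j i "[GenE i, GenE j] @ w" "w' @ [GenE j, GenE i]"] a by simp
  also have "\<dots> \<approx> [GenE i, GenE j, GenE j] @ w @ w' @ [GenE j, GenE i]"
    using weq.sym[OF weq_commute_E[of j w "[GenE i, GenE j]" "w' @ [GenE j, GenE i]"]] assms by simp
  also have "\<dots> \<approx> [GenE i, GenE j] @ w @ w' @ [GenE j, GenE i]"
    using weq_idem[of adj "[GenE i]" j "w @ w' @ [GenE j, GenE i]"] by simp
  finally show ?thesis using False by (simp add: transport_def)
qed

lemma transport_weq: "u \<approx> v \<Longrightarrow> transport j u \<approx> transport j v"
  unfolding transport_def by (auto intro: weq_Cons weq_right)

lemma transport_null: "null adj u \<Longrightarrow> null adj (transport j u)"
  using null_ctx[of adj u "[GenE i]" "[]"] null_ctx[of adj u "[GenE i, GenE j]" "[GenE j, GenE i]"]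
  by (simp add: transport_def)

text \<open>The letter commutes with both \<open>e\<^sub>j\<close> and \<open>e\<^sub>i\<close>;
  pulled out to the right it leaves a word that contracts to \<open>e\<^sub>i\<close>.\<close>

lemma realizes_single:
  assumes "b \<in> S" "b \<noteq> i" "\<not> adj i b" "j = i \<or> adj i j \<and> \<not> adj j b"
  shows "realizes j b (prod_encode (b, b))"
proof -
  have "Phi [a] \<approx> transport j [gmap (\<lambda>_. b) a]" if "gen_node a = prod_encode (b, b)" for a
  proof (cases "j = i")
    case True
    then show ?thesis using that by (simp add: Phi_def phi_def transport_def)
  next
    case False
    let ?x = "gmap (\<lambda>_. b) a"
    have ij: "adj i j" "adj j i" "\<not> adj j b" "b \<noteq> j" using assms False adj_sym by auto
    have "[GenE i, GenE j, ?x, GenE j, GenE i] \<approx> [GenE i, GenE j, GenE j, ?x, GenE i]"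
      using weq.sym[OF weq_commute_E[of j "[?x]" "[GenE i, GenE j]" "[GenE i]"]] ij by simp
    also have "\<dots> \<approx> [GenE i, GenE j, ?x, GenE i]" using weq_idem[of adj "[GenE i]" j] by simp
    also have "\<dots> \<approx> [GenE i, GenE j, GenE i, ?x]"
      using weq.sym[OF weq_commute_E[of i "[?x]" "[GenE i, GenE j]" "[]"]] assms by simp
    also have "\<dots> \<approx> [GenE i, ?x]" using weq_eee[of adj i j "[]"] ij by simp
    finally show ?thesis
      using that False by (simp add: Phi_def phi_def transport_def) (erule weq.sym)
  qed
  then show ?thesis using assms adj_sym unfolding realizes_def by auto
qed

lemma realizes_pair:
  assumes "adj i a" "adj i b" "a < b"
  shows "realizes a b (prod_encode (a, b))" "realizes b a (prod_encode (a, b))"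
proof -
  have ab: "\<not> adj a b" "\<not> adj b a" "a \<noteq> i" "b \<noteq> i" "adj a i" "adj b i" "a \<in> S" "b \<in> S"
    using nbrs_not_adj[OF assms(1,2)] nbrs_not_adj[OF assms(2,1)] nbr_par[OF assms(1)] nbr_par[OF assms(2)]
      adj_sym[OF assms(1)] adj_sym[OF assms(2)] adj_in[OF assms(1)] adj_in[OF assms(2)] by auto
  have 1: "Phi [c] \<approx> [GenE i, GenE a, gmap (\<lambda>_. b) c, GenE i]" if "gen_node c = prod_encode (a, b)" for c
    using that weq_idem[of adj "[]" i] assms(3) by (simp add: Phi_def phi_def)
  have move: "[GenE i, GenE j, x, GenE i] \<approx> transport j [x]"
    if "gen_node x \<noteq> j" "\<not> adj j (gen_node x)" "j \<noteq> i" for j x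
  proof -
    have "[GenE i, GenE j, x, GenE j, GenE i] \<approx> [GenE i, GenE j, GenE j, x, GenE i]"
      using weq.sym[OF weq_commute_E[of j "[x]" "[GenE i, GenE j]" "[GenE i]"]] that by simp
    also have "\<dots> \<approx> [GenE i, GenE j, x, GenE i]" using weq_idem[of adj "[GenE i]" j] by simp
    finally show ?thesis using that by (simp add: transport_def) (erule weq.sym)
  qed
  \<comment> \<open>The two neighbours change roles: for a letter \<open>g\<close>,
    \<open>g\<^sub>b e\<^sub>i\<close> opens to \<open>g\<^sub>i e\<^sub>b e\<^sub>i\<close>, and
    \<open>e\<^sub>i e\<^sub>a g\<^sub>i\<close> closes to \<open>e\<^sub>i g\<^sub>a\<close>. Thus
    the asymmetric choice in \<open>phi\<close> is immaterial.\<close>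
  have sw: "[GenE i, GenE a, gmap (\<lambda>_. b) c, GenE i] \<approx> [GenE i, GenE b, gmap (\<lambda>_. a) c, GenE i]" for c
  proof (cases c)
    case (GenG n)
    have "[GenE i, GenE a, GenG b, GenE i] \<approx> [GenE i, GenE a, GenG i, GenE b, GenE i]"
      using weq.sym[OF weq_gee[of adj i b "[GenE i, GenE a]" "[]"]] assms by simp
    also have "\<dots> \<approx> [GenE i, GenG a, GenE b, GenE i]"
      using weq_eeg[of adj i a "[]" "[GenE b, GenE i]"] assms by simp
    also have "\<dots> \<approx> [GenE i, GenE b, GenG a, GenE i]"
      using weq_swap[of "GenG a" "GenE b" adj "[GenE i]" "[GenE i]"] ab assms by simp
    finally show ?thesis using GenG by simp
  next
    case (GenE n)
    then show ?thesis
      using weq_swap[of "GenE a" "GenE b" adj "[GenE i]" "[GenE i]"] ab assms by simp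
  qed
  show "realizes a b (prod_encode (a, b))"
    unfolding realizes_def
  proof (intro conjI allI impI)
    fix c assume "gen_node c = prod_encode (a, b)"
    then have "Phi [c] \<approx> [GenE i, GenE a, gmap (\<lambda>_. b) c, GenE i]" by (rule 1)
    also have "\<dots> \<approx> transport a [gmap (\<lambda>_. b) c]" by (rule move) (use ab assms in simp_all)
    finally show "Phi [c] \<approx> transport a [gmap (\<lambda>_. b) c]" .
  qed (use ab assms in simp_all)
  show "realizes b a (prod_encode (a, b))"
    unfolding realizes_def
  proof (intro conjI allI impI)
    fix c assume "gen_node c = prod_encode (a, b)"
    then have "Phi [c] \<approx> [GenE i, GenE a, gmap (\<lambda>_. b) c, GenE i]" by (rule 1)
    also have "\<dots> \<approx> [GenE i, GenE b, gmap (\<lambda>_. a) c, GenE i]" by (rule sw)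
    also have "\<dots> \<approx> transport b [gmap (\<lambda>_. a) c]" by (rule move) (use ab assms in simp_all)
    finally show "Phi [c] \<approx> transport b [gmap (\<lambda>_. a) c]" .
  qed (use ab assms in simp_all)
qed

lemma disjoint_pairs:
  assumes "adj i a" "adj i b" "adj i c" "adj i d" "a \<noteq> b" "c \<noteq> d"
  shows "a = c \<or> a = d \<or> b = c \<or> b = d"
proof (rule ccontr)
  assume "\<not> ?thesis"
  then have "card {a, b, c, d} = 4" using assms by auto
  moreover have "finite {k. adj i k}" by (rule finite_subset[OF _ fin]) (use adj_in in auto)
  ultimately show False using card_mono[of "{k. adj i k}" "{a, b, c, d}"] assms three_nbrs by auto
qed

text \<open>The common \<open>j\<close> is \<open>i\<close> for two single nodes. For a pair and a
  single node it is a member of the pair not adjacent to the single node, available by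
  \<open>no_square\<close>; for two pairs it is a shared member, by \<open>disjoint_pairs\<close>. A
  pair is then realized by its other member.\<close>

lemma realize_both:
  assumes "m \<in> dnodes" "n \<in> dnodes"
  obtains j k l where "realizes j k m" "realizes j l n" "adj k l \<longleftrightarrow> dadj m n" "k = l \<longleftrightarrow> m = n"
proof -
  have pair_single: thesis
    if m: "m' = prod_encode (a, b)" "adj i a" "adj i b" "a < b"
    and n: "n' = prod_encode (d, d)" "d \<in> S" "d \<noteq> i" "\<not> adj i d"
    and mn: "\<And>j k l. realizes j k m' \<Longrightarrow> realizes j l n' \<Longrightarrow> adj k l \<longleftrightarrow> dadj m' n' \<Longrightarrow> k \<noteq> l \<Longrightarrow> thesis"
    for m' n' a b d
  proof -
    have dd: "dadj m' n' \<longleftrightarrow> adj a d \<or> adj b d" using m n dnodesI by (auto simp: dadj_def)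
    show thesis
    proof (cases "adj a d")
      case True
      then have "\<not> adj b d" using no_square m n by blast
      then show thesis using True m n dd
        by (intro mn[of b a d]) (auto intro: realizes_pair realizes_single)
    next
      case False
      then show thesis using m n dd
        by (intro mn[of a b d]) (auto intro: realizes_pair realizes_single)
    qed
  qed
  have dsym: "dadj x y \<longleftrightarrow> dadj y x" for x y using adj_sym by (auto simp: dadj_def)
  from assms(1) show thesis
  proof (cases rule: dnodes_cases)
    case m: (single b)
    from assms(2) show ?thesis
    proof (cases rule: dnodes_cases)
      case n: (single d)
      show ?thesis
        by (rule that[of i b d]) (use m n assms in \<open>auto intro: realizes_single simp: dadj_def\<close>)
    next
      case n: (pair c d)
      have ne: "m \<noteq> n" using m n by auto
      show ?thesis
      proof (rule pair_single[OF n(1-4) m(1-4)])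
        fix j k l assume "realizes j k n" "realizes j l m" "adj k l \<longleftrightarrow> dadj n m" "k \<noteq> l"
        then show thesis using that[of j l k] ne dsym[of m n] adj_sym by metis
      qed
    qed
  next
    case m: (pair a b)
    from assms(2) show ?thesis
    proof (cases rule: dnodes_cases)
      case n: (single d)
      have ne: "m \<noteq> n" using m n by auto
      show ?thesis
      proof (rule pair_single[OF m(1-4) n(1-4)])
        fix j k l assume "realizes j k m" "realizes j l n" "adj k l \<longleftrightarrow> dadj m n" "k \<noteq> l"
        then show thesis using that[of j k l] ne by metis
      qed
    next
      case n: (pair c d)
      have nd: "\<not> dadj m n" using m n by (simp add: dadj_def)
      have nadj: "\<not> adj x y" if "x \<in> {a, b, c, d}" "y \<in> {a, b, c, d}" for x y
        using that m n nbrs_not_adj by blast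
      note r = realizes_pair[OF m(2-4), folded m(1)] realizes_pair[OF n(2-4), folded n(1)]
      have eq: "m = n \<longleftrightarrow> a = c \<and> b = d" using m(1) n(1) by simp
      consider "a = c" | "a = d" | "b = c" | "b = d" using disjoint_pairs[OF m(2,3) n(2,3)] m(4) n(4) by auto
      then show ?thesis
      proof cases
        case 1
        show ?thesis by (rule that[of a b d]) (use 1 r nadj nd eq in simp_all)
      next
        case 2
        show ?thesis by (rule that[of a b c]) (use 2 r nadj nd eq m(4) n(4) in auto)
      next
        case 3
        show ?thesis by (rule that[of b a d]) (use 3 r nadj nd eq m(4) n(4) in auto)
      next
        case 4
        show ?thesis by (rule that[of b a c]) (use 4 r nadj nd eq in simp_all)
      qed
    qed
  qed
qed

lemma phi_comm: "gen_node a \<in> dnodes \<Longrightarrow> phi a @ [GenE i] \<approx> GenE i # phi a"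
proof (elim dnodes_cases)
  fix b assume "gen_node a = prod_encode (b, b)" "b \<in> S" "b \<noteq> i" "\<not> adj i b"
  then show ?thesis
    using weq.sym[OF weq_commute_E[of i "[gmap (\<lambda>_. b) a]" "[]" "[]"]] by (simp add: phi_def)
next
  fix x y assume "gen_node a = prod_encode (x, y)" "x < y"
  then show ?thesis
    using weq.trans[OF weq_idem[of adj "[GenE i, GenE x, gmap (\<lambda>_. y) a]" i "[]", simplified]
      weq.sym[OF weq_idem[of adj "[]" i "[GenE x, gmap (\<lambda>_. y) a, GenE i]"], simplified]]
    by (simp add: phi_def)
qed

lemma phis_comm: "u \<in> words_on dnodes \<Longrightarrow> concat (map phi u) @ [GenE i] \<approx> GenE i # concat (map phi u)"
proof (induction u)
  case (Cons a u)
  then have "phi a @ concat (map phi u) @ [GenE i] \<approx> phi a @ GenE i # concat (map phi u)"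
    by (intro weq_left) auto
  also have "\<dots> \<approx> GenE i # phi a @ concat (map phi u)"
    using weq_right[OF phi_comm[of a], of "concat (map phi u)"] Cons.prems by simp
  finally show ?case by simp
qed auto

lemma Phi_append: "u \<in> words_on dnodes \<Longrightarrow> Phi u @ Phi v \<approx> Phi (u @ v)"
proof -
  assume "u \<in> words_on dnodes"
  from weq_ctx[OF phis_comm[OF this], of "[GenE i]" "concat (map phi v)"]
  have "Phi u @ Phi v \<approx> GenE i # GenE i # concat (map phi u) @ concat (map phi v)"
    by (simp add: Phi_def)
  also have "\<dots> \<approx> Phi (u @ v)" using weq_idem[of adj "[]" i] by (simp add: Phi_def)
  finally show ?thesis .
qed

lemma Phi_transport:
  assumes "realizes j k m" "realizes j l n" "m \<in> dnodes" "n \<in> dnodes" "u \<in> words_on {m, n}"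
  shows "u \<noteq> [] \<Longrightarrow> Phi u \<approx> transport j (map (gmap (\<lambda>x. if x = m then k else l)) u)"
  using assms(5)
proof (induction u)
  case (Cons a u)
  let ?f = "gmap (\<lambda>x. if x = m then k else l)"
  let ?k = "if gen_node a = m then k else l"
  have fa: "?f a = gmap (\<lambda>_. ?k) a" by (cases a) simp_all
  have "realizes j ?k (gen_node a)" using assms(1,2) Cons.prems(2) by auto
  then have r: "j = i \<or> adj i j" "?k \<noteq> j" "\<not> adj j ?k" "Phi [a] \<approx> transport j [gmap (\<lambda>_. ?k) a]"
    unfolding realizes_def by blast+
  have a: "Phi [a] \<approx> transport j [?f a]" unfolding fa by (rule r(4))
  have a': "gen_node a \<in> dnodes" "commuting adj j [?f a]"
    using Cons.prems(2) assms(3,4) r(2,3) by auto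
  show ?case
  proof (cases "u = []")
    case False
    have "Phi (a # u) \<approx> Phi [a] @ Phi u" using weq.sym[OF Phi_append[of "[a]" u]] a' by simp
    also have "\<dots> \<approx> transport j [?f a] @ transport j (map ?f u)"
      by (intro weq.append a Cons.IH) (use Cons.prems False in auto)
    also have "\<dots> \<approx> transport j (map ?f (a # u))"
      using transport_mult[OF r(1) a'(2), of "map ?f u"] by simp
    finally show ?thesis .
  next
    case True
    then show ?thesis using a by simp
  qed
qed simp

lemma realize_inj:
  assumes "adj k l \<longleftrightarrow> dadj m n" "k = l \<longleftrightarrow> m = n" "x \<in> {m, n}" "y \<in> {m, n}"
  defines "f \<equiv> \<lambda>x. if x = m then k else l"
  shows "adj (f x) (f y) \<longleftrightarrow> dadj x y" "f x = f y \<longleftrightarrow> x = y"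
proof -
  have "\<not> dadj x x" for x by (auto simp: dadj_def split: prod.splits)
  moreover have "dadj x y \<longleftrightarrow> dadj y x" for x y using adj_sym by (auto simp: dadj_def)
  ultimately show "adj (f x) (f y) \<longleftrightarrow> dadj x y" "f x = f y \<longleftrightarrow> x = y"
    using assms adj_sym by (auto simp: f_def)
qed

lemma dadj_in: "dadj x y \<Longrightarrow> x \<in> dnodes \<and> y \<in> dnodes"
  by (simp add: dadj_def)

lemma words_on_set: "u \<in> words_on A \<Longrightarrow> x \<in> gen_node ` set u \<Longrightarrow> x \<in> A"
  by (auto simp: words_on_def)

lemma Phi_basic:
  assumes "basic_rel dadj u v" "u \<in> words_on dnodes"
  shows "Phi u \<approx> Phi v"
proof -
  obtain m n where uv: "u \<in> words_on {m, n}" "v \<in> words_on {m, n}" "m \<in> gen_node ` set u" "n \<in> gen_node ` set u"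
    by (rule basic_rel_two_nodes[OF assms(1)])
  note mn = uv(1,2) words_on_set[OF assms(2) uv(3)] words_on_set[OF assms(2) uv(4)]
  obtain j k l where r: "realizes j k m" "realizes j l n" "adj k l \<longleftrightarrow> dadj m n" "k = l \<longleftrightarrow> m = n"
    using realize_both[OF mn(3,4)] .
  let ?f = "\<lambda>x. if x = m then k else l"
  have "u \<noteq> []" "v \<noteq> []" using assms(1) by (auto elim: basic_rel.cases)
  have "basic_rel adj (map (gmap ?f) u) (map (gmap ?f) v)"
  proof (rule basic_rel_gmap[OF assms(1) mn(1)])
    show "inj_on ?f {m, n}" by (rule inj_onI) (use realize_inj(2)[OF r(3,4)] in blast)
  qed (rule realize_inj(1)[OF r(3,4)])
  then have "transport j (map (gmap ?f) u) \<approx> transport j (map (gmap ?f) v)"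
    by (intro transport_weq weq.base)
  from weq.trans[OF Phi_transport[OF r(1,2) mn(3,4,1) \<open>u \<noteq> []\<close>] this]
  show ?thesis using weq.sym[OF Phi_transport[OF r(1,2) mn(3,4,2) \<open>v \<noteq> []\<close>]] by (rule weq.trans)
qed

lemma Phi_null_word:
  assumes "null_word dadj u" "u \<in> words_on dnodes"
  shows "null adj (Phi u)"
proof -
  obtain m n where u: "u \<in> words_on {m, n}" "m \<in> gen_node ` set u" "n \<in> gen_node ` set u"
    by (rule null_word_two_nodes[OF assms(1)])
  note mn = u(1) words_on_set[OF assms(2) u(2)] words_on_set[OF assms(2) u(3)]
  obtain j k l where r: "realizes j k m" "realizes j l n" "adj k l \<longleftrightarrow> dadj m n" "k = l \<longleftrightarrow> m = n"
    using realize_both[OF mn(2,3)] .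
  let ?f = "\<lambda>x. if x = m then k else l"
  have "u \<noteq> []" using assms(1) by (auto elim: null_word.cases)
  have "null_word adj (map (gmap ?f) u)"
    by (rule null_word_gmap[OF assms(1) mn(1)]) (rule realize_inj(1)[OF r(3,4)])
  then have "null adj (transport j (map (gmap ?f) u))"
    by (intro transport_null null_base)
  with Phi_transport[OF r(1,2) mn(2,3,1) \<open>u \<noteq> []\<close>] show ?thesis by (rule null_weq)
qed

text \<open>Membership is proved as an equivalence alongside, since the induction passes through
  symmetry and transitivity.\<close>

lemma Phi_weq:
  assumes "weq dadj u v"
  shows "(u \<in> words_on dnodes \<longleftrightarrow> v \<in> words_on dnodes) \<and> (u \<in> words_on dnodes \<longrightarrow> Phi u \<approx> Phi v)"
  using assms
proof (induction rule: weq.induct)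
  case (base u v)
  then show ?case using Phi_basic weq_set[OF weq.base[OF base], of dnodes] dadj_in by blast
next
  case (append u v u' v')
  have "Phi (u @ u') \<approx> Phi (v @ v')" if "u @ u' \<in> words_on dnodes"
  proof -
    have "Phi (u @ u') \<approx> Phi u @ Phi u'" using that by (intro weq.sym[OF Phi_append]) simp
    also have "\<dots> \<approx> Phi v @ Phi v'" using append that by (intro weq.append) auto
    also have "\<dots> \<approx> Phi (v @ v')" using append that by (intro Phi_append) auto
    finally show ?thesis .
  qed
  then show ?case using append by auto
qed (auto intro: weq.sym weq.trans)

lemma Phi_null:
  assumes "null dadj u" "u \<in> words_on dnodes"
  shows "null adj (Phi u)"
proof -
  obtain x a y where a: "null_word dadj a" "weq dadj u (x @ a @ y)" using assms(1) by (auto simp: null_def)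
  have w: "x @ a @ y \<in> words_on dnodes" "Phi u \<approx> Phi (x @ a @ y)" using Phi_weq[OF a(2)] assms(2) by auto
  have "Phi (x @ a @ y) \<approx> Phi x @ Phi (a @ y)" using w by (intro weq.sym[OF Phi_append]) simp
  also have "\<dots> \<approx> Phi x @ Phi a @ Phi y" using w by (intro weq_left weq.sym[OF Phi_append]) simp
  also have "null adj \<dots>" using Phi_null_word[OF a(1)] w by (intro null_ctx) simp
  finally show ?thesis using null_weq[OF w(2)] by blast
qed

end

section \<open>Normal forms of the words that start with a path\<close>

context rooted
begin

definition along :: "nat \<Rightarrow> gen list \<Rightarrow> nat \<Rightarrow> bool" where
  "along j w k \<longleftrightarrow> (\<exists>v\<in>words_on dnodes. path j @ w \<approx> Phi v @ path k)"

text \<open>Either \<open>k\<close> is a child of \<open>j\<close> and the path grows, or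
  \<open>k\<close> is its parent and \<open>e\<^sub>k e\<^sub>j e\<^sub>k\<close> contracts, so the
  path shrinks.\<close>

lemma along_adj:
  assumes "adj j k" shows "along j [GenE k] k"
proof -
  have jk: "j \<in> S" "k \<in> S" "adj k j" using assms adj_in adj_sym by auto
  have "path j @ [GenE k] \<approx> path k"
  proof (cases "k \<noteq> i \<and> par k = j")
    case True
    then show ?thesis using path_par[of k] jk by simp
  next
    case False
    then have "j \<noteq> i" "par j = k" using edge[OF assms] by auto
    then have pj: "path j = path k @ [GenE j]" using path_par[of j] jk by simp
    obtain w where w: "path k = w @ [GenE k]" using path_last by blast
    show ?thesis using weq_eee[of adj k j w "[]"] jk(3) by (simp add: pj w)
  qed
  also have "path k \<approx> Phi [] @ path k" using weq.sym[OF Ei_path[OF jk(2)]] by simp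
  finally show ?thesis unfolding along_def by (intro bexI[of _ "[]"]) auto
qed

text \<open>
  The letter is carried along the path from the root to \<open>j\<close>. When it meets the path, the
  commuting pair sits at two neighbours of a node of the path, and the two change places unless
  this node is the root.
\<close>

lemma along_comm:
  assumes "j \<in> S" "k \<in> S" "k \<noteq> j" "\<not> adj j k" "gen_node a = k"
  shows "along j [a] j"
  using assms
proof (induction j arbitrary: a k rule: rk_induct)
  case root
  let ?b = "gmap (\<lambda>_. prod_encode (k, k)) a"
  have d: "prod_encode (k, k) \<in> dnodes" using root by (intro dnodesI) auto
  have a: "gmap (\<lambda>_. k) a = a" using root(4) by (cases a) auto
  have "[GenE i, a] \<approx> [GenE i, GenE i, a]" using weq.sym[OF weq_idem[of adj "[]" i "[a]"]] by simp
  also have "\<dots> \<approx> Phi [?b] @ path i"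
    using weq_swap[of "GenE i" a adj "[GenE i]" "[]"] root a by (cases a; simp add: Phi_def phi_def path_i)
  finally have "path i @ [a] \<approx> Phi [?b] @ path i" by (simp add: path_i)
  then show ?case unfolding along_def by (rule bexI) (use d in simp)
next
  case (step j)
  define m where "m = par j"
  have m: "m \<in> S" "adj j m" "adj m j" "rk m < rk j" "path j = path m @ [GenE j]"
    unfolding m_def using par_adj[OF step(1,2)] par_in[OF step(1,2)] path_par[OF step(1,2)] adj_sym by auto
  obtain w where w: "path m = w @ [GenE m]" using path_last by blast
  have "k \<noteq> m" using step m by auto
  have jk: "\<not> adj k j" using step adj_sym by blast
  show ?case
  proof (cases "adj m k")
    case False
    from step.IH[OF m(1,4) step.prems(1) \<open>k \<noteq> m\<close> False step.prems(4)]
    obtain v where v: "v \<in> words_on dnodes" "path m @ [a] \<approx> Phi v @ path m" unfolding along_def by blast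
    have "path j @ [a] \<approx> path m @ [a, GenE j]"
      using weq_swap[of "GenE j" a adj "path m" "[]"] step.prems m by simp
    also have "\<dots> \<approx> Phi v @ path j" using weq_right[OF v(2), of "[GenE j]"] m by simp
    finally show ?thesis using v unfolding along_def by blast
  next
    case mk: True
    have km: "adj k m" using mk adj_sym by blast
    show ?thesis
    proof (cases "m = i")
      case True
      have pi: "path j = [GenE i, GenE j]" using m(5) by (simp add: True path_i)
      have ji: "adj i j" "adj i k" "adj j i" "adj k i" using m mk km True by auto
      \<comment> \<open>At the root, the letter at \<open>k\<close> and the path to \<open>j\<close>
        use two neighbours of \<open>i\<close>, so the letter becomes a generator of the derived
        diagram. The minimum and maximum put the pair in its coded order.\<close>
      define mn where "mn = prod_encode (min j k, max j k)"
      have mn: "mn \<in> dnodes" unfolding mn_def using ji step.prems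
        by (intro dnodesI) (auto simp: min_def max_def)
      let ?b = "gmap (\<lambda>_. mn) a"
      have "realizes j k mn"
        using realizes_pair[of j k] realizes_pair[of k j] ji step.prems
        by (auto simp: mn_def min_def max_def not_le split: if_splits)
      then have "Phi [?b] \<approx> transport j [gmap (\<lambda>_. k) ?b]" unfolding realizes_def by simp
      moreover have "gmap (\<lambda>_. k) ?b = a" using step.prems by (cases a) auto
      ultimately have b: "Phi [?b] \<approx> [GenE i, GenE j, a, GenE j, GenE i]"
        using step by (simp add: transport_def)
      have "Phi [?b] @ path j \<approx> [GenE i, GenE j, a, GenE j, GenE i] @ [GenE i, GenE j]"
        unfolding pi by (rule weq_right[OF b])
      also have "\<dots> \<approx> [GenE i, GenE j, a, GenE j, GenE i, GenE j]"
        using weq_idem[of adj "[GenE i, GenE j, a, GenE j]" i "[GenE j]"] by simp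
      also have "\<dots> \<approx> [GenE i, GenE j, a, GenE j]"
        using weq_eee[of adj j i "[GenE i, GenE j, a]" "[]"] ji by simp
      also have "\<dots> \<approx> [GenE i, GenE j, GenE j, a]"
        using weq_swap[of a "GenE j" adj "[GenE i, GenE j]" "[]"] step.prems jk by simp
      also have "\<dots> \<approx> [GenE i, GenE j, a]" using weq_idem[of adj "[GenE i]" j "[a]"] by simp
      finally have "path j @ [a] \<approx> Phi [?b] @ path j" unfolding pi by (simp add: weq.sym)
      then show ?thesis unfolding along_def by (rule bexI) (use mn in simp)
    next
      case False
      \<comment> \<open>The distinct neighbours \<open>j\<close> and \<open>k\<close> of
        \<open>m\<close> cannot both be children of \<open>m\<close>, and \<open>j\<close> is
        one.\<close>
      have "k = par m"
      proof (rule ccontr)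
        assume "k \<noteq> par m"
        moreover have "j \<noteq> par m" using par_adj[OF m(1) False] m(4) by auto
        ultimately show False using one_child[OF m(3) mk False] step.prems by auto
      qed
      then have k: "path m = path k @ [GenE m]" "rk k < rk j"
        using path_par[OF m(1) False] par_adj[OF m(1) False] m(4) by auto
      obtain x where x: "path k = x @ [GenE k]" using path_last by blast
      \<comment> \<open>The roles of the two nodes are exchanged: the hypothesis is used at
        \<open>k\<close>, two steps nearer to the root, for a letter at \<open>j\<close>.\<close>
      have IH: "along k [b] k" if "gen_node b = j" for b
        using step.IH[OF step.prems(1) k(2) step(1) _ jk that] step.prems by auto
      \<comment> \<open>The letter turns from \<open>k\<close> to \<open>j\<close> while passing
        \<open>e\<^sub>m e\<^sub>j\<close>. For a \<open>g\<close> this uses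
        \<open>e\<^sub>k e\<^sub>m g\<^sub>k = e\<^sub>k g\<^sub>m\<close> and
        \<open>g\<^sub>m e\<^sub>j = g\<^sub>j e\<^sub>m e\<^sub>j\<close>.\<close>
      have "\<exists>b. gen_node b = j \<and> [GenE k, GenE m, GenE j, a] \<approx> [GenE k, b, GenE m, GenE j]"
      proof (cases a)
        case (GenE n)
        have "[GenE k, GenE m, GenE j, GenE k] \<approx> [GenE k, GenE m, GenE k, GenE j]"
          using weq_swap[of "GenE j" "GenE k" adj "[GenE k, GenE m]" "[]"] step.prems by auto
        also have "\<dots> \<approx> [GenE k, GenE j]" using weq_eee[of adj k m "[]" "[GenE j]"] km by simp
        also have "\<dots> \<approx> [GenE k, GenE j, GenE m, GenE j]"
          using weq.sym[OF weq_eee[of adj j m "[GenE k]" "[]"]] m by simp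
        finally show ?thesis using GenE step.prems by (intro exI[of _ "GenE j"]) simp
      next
        case (GenG n)
        have "[GenE k, GenE m, GenE j, GenG k] \<approx> [GenE k, GenE m, GenG k, GenE j]"
          using weq_swap[of "GenE j" "GenG k" adj "[GenE k, GenE m]" "[]"] step.prems by auto
        also have "\<dots> \<approx> [GenE k, GenG m, GenE j]" using weq_eeg[of adj k m "[]" "[GenE j]"] km by simp
        also have "\<dots> \<approx> [GenE k, GenG j, GenE m, GenE j]"
          using weq.sym[OF weq_gee[of adj j m "[GenE k]" "[]"]] m by simp
        finally show ?thesis using GenG step.prems by (intro exI[of _ "GenG j"]) simp
      qed
      then obtain b where b: "gen_node b = j" "[GenE k, GenE m, GenE j, a] \<approx> [GenE k, b, GenE m, GenE j]"
        by blast
      obtain v where v: "v \<in> words_on dnodes" "path k @ [b] \<approx> Phi v @ path k"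
        using IH[OF b(1)] unfolding along_def by blast
      have "path j @ [a] \<approx> path k @ [b, GenE m, GenE j]"
        using weq_left[OF b(2), of x] by (simp add: m(5) k(1) x)
      also have "\<dots> \<approx> Phi v @ path j" using weq_right[OF v(2), of "[GenE m, GenE j]"] by (simp add: m(5) k(1))
      finally show ?thesis using v unfolding along_def by blast
    qed
  qed
qed

text \<open>
  Words of the form \<open>\<Phi>(v) p\<^sub>j d\<close> up to equivalence, where the \<open>n\<close> letters of \<open>d\<close> raise the simple
  root at \<open>j\<close> step by step to the root \<open>b\<close>.
\<close>

inductive normal :: "nat \<Rightarrow> (nat \<Rightarrow> int) \<Rightarrow> gen list \<Rightarrow> bool" where
  base: "v \<in> words_on dnodes \<Longrightarrow> j \<in> S \<Longrightarrow> u \<approx> Phi v @ path j \<Longrightarrow> normal 0 (simple j) u"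
| step: "normal n b u \<Longrightarrow> k \<in> S \<Longrightarrow> ip b k = -1 \<Longrightarrow> u' \<approx> u @ [GenG k] \<Longrightarrow>
    normal (Suc n) (b(k := b k + 1)) u'"

lemma normal_weq: "normal n b u \<Longrightarrow> u' \<approx> u \<Longrightarrow> normal n b u'"
  by (induction arbitrary: u' rule: normal.induct) (auto intro: normal.intros weq.trans)

text \<open>Each letter raises the coefficient sum by one. So \<open>n\<close> is determined by the
  root \<open>b\<close>, and finiteness of the positive roots bounds it.\<close>

lemma normal_root: "normal n b u \<Longrightarrow> posroot b \<and> sum b S = int (Suc n)"
proof (induction rule: normal.induct)
  case (base v j u)
  then show ?case using posroot_simple by (simp add: simple_def)
next
  case (step n b u k u')
  have "sum (b(k := b k + 1)) S = (\<Sum>l\<in>S. b l + (if l = k then 1 else 0))"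
    by (rule sum.cong) auto
  then have "sum (b(k := b k + 1)) S = int (Suc (Suc n))" using step by (simp add: sum.distrib)
  then show ?case using step posroot_bump[of b k] by blast
qed

lemma normal_along:
  assumes "normal 0 (simple j) u" "along j w k" "j \<in> S" "k \<in> S"
  shows "normal 0 (simple k) (u @ w)"
  using assms(1)
proof cases
  case (base v j')
  have "j' = j"
  proof (rule ccontr)
    assume "j' \<noteq> j"
    then have "simple j j = (simple j' j :: int)" using base by metis
    then show False using \<open>j' \<noteq> j\<close> by (simp add: simple_def)
  qed
  obtain v' where v': "v' \<in> words_on dnodes" "path j @ w \<approx> Phi v' @ path k"
    using assms(2) unfolding along_def by blast
  have "u @ w \<approx> Phi v @ path j @ w" using weq_right[OF base(4), of w] \<open>j' = j\<close> by simp
  also have "\<dots> \<approx> Phi v @ Phi v' @ path k" by (rule weq_left[OF v'(2)])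
  also have "\<dots> \<approx> Phi (v @ v') @ path k" using weq_right[OF Phi_append[OF base(2)], of v' "path k"] by simp
  finally show ?thesis using base v' assms by (intro normal.base[of "v @ v'"]) auto
qed

lemma normal_0: "normal 0 b u \<Longrightarrow> \<exists>j\<in>S. b = simple j"
  by (auto elim: normal.cases)

lemma normal_simple: "normal n (simple k) u \<Longrightarrow> k \<in> S \<Longrightarrow> n = 0"
  using normal_root[of n "simple k" u] by (simp add: simple_def)

lemma normal_E_last:
  assumes "normal 0 (simple k) u" "k \<in> S"
  obtains w where "u \<approx> w @ [GenE k]"
  using assms(1)
proof cases
  case (base v j)
  have "simple k k = (simple j k :: int)" using base(1) by simp
  then have "j = k" by (simp add: simple_def split: if_splits)
  obtain w where "path j = w @ [GenE j]" using path_last by blast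
  then show ?thesis using that[of "Phi v @ w"] base \<open>j = k\<close> by simp
qed

lemma normal_Suc:
  assumes "normal (Suc n) b u"
  obtains b' u' k where "normal n b' u'" "k \<in> S" "ip b' k = -1" "b = b'(k := b' k + 1)" "u \<approx> u' @ [GenG k]"
    "posroot b'" "ip b k = 1" "\<And>l. ip b l = ip b' l + cartan l k"
  using assms
proof cases
  case (step b' u' k)
  have "ip b l = ip b' l + cartan l k" for l
    unfolding step(1) using ip_bump[OF step(3), of b' 1 l] by simp
  then show ?thesis using that[OF step(2,3,4,1,5)] normal_root[OF step(2)] step(4) by auto
qed

lemma cartan_adj: "adj k l \<Longrightarrow> cartan k l = (-1 :: int)" "adj k l \<Longrightarrow> cartan l k = (-1 :: int)"
  using adj_sym by (auto simp: cartan_def)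

lemma cartan_non: "k \<noteq> l \<Longrightarrow> \<not> adj k l \<Longrightarrow> cartan k l = (0 :: int)"
  "k \<noteq> l \<Longrightarrow> \<not> adj k l \<Longrightarrow> cartan l k = (0 :: int)"
  using adj_sym by (auto simp: cartan_def)

text \<open>Any descent of \<open>b\<close> can be made the last letter. If the last letter
  \<open>l\<close> is adjacent to \<open>k\<close>, the root before it has inner product 2 with
  \<alpha>_k and hence equals \<alpha>_k. Then \<open>e\<^sub>k g\<^sub>l\<close> is replaced by
  \<open>e\<^sub>k e\<^sub>l g\<^sub>k\<close>: the root \<alpha>_k + \<alpha>_l is reached from
  \<alpha>_l instead.\<close>

lemma normal_down:
  assumes "normal n b u" "k \<in> S" "ip b k = 1"
  obtains u' n' where "n = Suc n'" "normal n' (b(k := b k - 1)) u'" "u \<approx> u' @ [GenG k]"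
  using assms
proof (induction n arbitrary: b u thesis)
  case 0
  then obtain j where "j \<in> S" "b = simple j" using normal_0 by blast
  then have "ip b k = cartan k j" using ip_simple[where ?'a = int] by simp
  then show ?case using 0(4) by (auto simp: cartan_def split: if_splits)
next
  case (Suc n)
  obtain b' u' l where s: "normal n b' u'" "l \<in> S" "ip b' l = -1" "b = b'(l := b' l + 1)" "u \<approx> u' @ [GenG l]"
    "posroot b'" "ip b l = 1" "\<And>m. ip b m = ip b' m + cartan m l"
    using normal_Suc[OF Suc.prems(2)] by metis
  show ?case
  proof (cases "k = l")
    case True
    have "b(k := b k - 1) = b'" unfolding s(4) True by simp
    then show ?thesis using Suc.prems(1)[of n u'] s(1,5) True by simp
  next
    case kl: False
    show ?thesis
    proof (cases "adj k l")
      case False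
      have 1: "ip b' k = 1" using s(8)[of k] Suc.prems(4) cartan_non[OF kl False] by simp
      obtain u2 n2 where u2: "n = Suc n2" "normal n2 (b'(k := b' k - 1)) u2" "u' \<approx> u2 @ [GenG k]"
        using Suc.IH[OF _ s(1) Suc.prems(3) 1] by metis
      have "u \<approx> u2 @ [GenG k, GenG l]" using weq.trans[OF s(5) weq_right[OF u2(3), of "[GenG l]"]] by simp
      also have "\<dots> \<approx> u2 @ [GenG l, GenG k]"
        using weq_swap[of "GenG k" "GenG l" adj u2 "[]"] kl False by simp
      finally have "u \<approx> (u2 @ [GenG l]) @ [GenG k]" by simp
      moreover have "ip (b'(k := b' k - 1)) l = -1"
        using ip_bump[OF Suc.prems(3), of b' "-1" l] s(3) cartan_non[OF kl False] by simp
      then have "normal (Suc n2) ((b'(k := b' k - 1))(l := b' l + 1)) (u2 @ [GenG l])"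
        using normal.step[OF u2(2) s(2), of "u2 @ [GenG l]"] kl by simp
      then have "normal n (b(k := b k - 1)) (u2 @ [GenG l])"
        using kl u2(1) s(4) by (simp add: fun_upd_twist)
      ultimately show ?thesis using Suc.prems(1) by blast
    next
      case True
      have "ip b' k = 2" using s(8)[of k] Suc.prems(4) cartan_adj[OF True] by simp
      then have b': "b' = simple k" using posroot_ip[OF s(6) Suc.prems(3)] by auto
      then have n0: "n = 0" using normal_simple s(1) Suc.prems(3) by blast
      then have nk: "normal 0 (simple k) u'" using s(1) b' by simp
      then obtain w where w: "u' \<approx> w @ [GenE k]" using normal_E_last Suc.prems(3) by blast
      have "u \<approx> w @ [GenE k, GenG l]" using weq.trans[OF s(5) weq_right[OF w, of "[GenG l]"]] by simp
      also have "\<dots> \<approx> w @ [GenE k, GenE l, GenG k]"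
        using weq.sym[OF weq_eeg[of adj k l w "[]"]] True by simp
      also have "\<dots> \<approx> u' @ [GenE l, GenG k]"
        using weq.sym[OF weq_right[OF w, of "[GenE l, GenG k]"]] by simp
      finally have "u \<approx> (u' @ [GenE l]) @ [GenG k]" by simp
      moreover have "normal 0 (simple l) (u' @ [GenE l])"
        using normal_along[OF nk along_adj[OF True] Suc.prems(3) s(2)] .
      moreover have "b(k := b k - 1) = simple l"
        using kl unfolding s(4) b' by (auto simp: simple_def)
      ultimately show ?thesis using Suc.prems(1)[of 0] n0 by simp
    qed
  qed
qed

text \<open>A letter orthogonal to the root moves left through the raising letters until
  \<open>along_comm\<close> absorbs it into the factor \<open>Phi v\<close>.\<close>

lemma normal_G_perp:
  assumes "normal n b u" "k \<in> S" "ip b k = 0"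
  shows "normal n b (u @ [GenG k])"
  using assms
proof (induction n arbitrary: b u k rule: less_induct)
  case (less n)
  show ?case
  proof (cases n)
    case 0
    then obtain j where j: "j \<in> S" "b = simple j" using normal_0 less.prems by blast
    then have "cartan k j = (0 :: int)" using ip_simple[where ?'a = int] less.prems by simp
    then have kj: "k \<noteq> j" "\<not> adj j k" using adj_sym by (auto simp: cartan_def split: if_splits)
    show ?thesis
      using normal_along[of j u "[GenG k]" j] along_comm[OF j(1) less.prems(2) kj] less.prems(1) j 0 by simp
  next
    case (Suc n')
    obtain b' u' l where s: "normal n' b' u'" "l \<in> S" "ip b' l = -1" "b = b'(l := b' l + 1)" "u \<approx> u' @ [GenG l]"
      "posroot b'" "ip b l = 1" "\<And>m. ip b m = ip b' m + cartan m l"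
      using normal_Suc less.prems(1) Suc by metis
    have kl: "k \<noteq> l" using s(7) less.prems(3) by auto
    show ?thesis
    proof (cases "adj k l")
      case False
      have 0: "ip b' k = 0" using s(8)[of k] less.prems(3) cartan_non[OF kl False] by simp
      have "u @ [GenG k] \<approx> u' @ [GenG l, GenG k]" using weq_right[OF s(5), of "[GenG k]"] by simp
      also have "\<dots> \<approx> (u' @ [GenG k]) @ [GenG l]"
        using weq_swap[of "GenG l" "GenG k" adj u' "[]"] kl False adj_sym by auto
      finally show ?thesis
        unfolding Suc s(4) by (intro normal.step[OF less.IH[OF _ s(1) less.prems(2) 0] s(2,3)]) (simp_all add: Suc)
    next
      case True
      \<comment> \<open>The word can be made to end in \<open>g\<^sub>k g\<^sub>l g\<^sub>k\<close>,
        which braids to \<open>g\<^sub>l g\<^sub>k g\<^sub>l\<close>. Its first letter is orthogonal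
        to the root two steps below, hence the strong induction.\<close>
      have 1: "ip b' k = 1" using s(8)[of k] less.prems(3) cartan_adj[OF True] by simp
      obtain u2 n2 where u2: "n' = Suc n2" "normal n2 (b'(k := b' k - 1)) u2" "u' \<approx> u2 @ [GenG k]"
        using normal_down[OF s(1) less.prems(2) 1] by metis
      let ?b = "b'(k := b' k - 1)"
      have ipb: "ip ?b m = ip b' m - cartan m k" for m
        using ip_bump[OF less.prems(2), of b' "-1" m] by simp
      have l0: "ip ?b l = 0" using ipb[of l] s(3) cartan_adj[OF True] by simp
      have n1: "normal n2 ?b (u2 @ [GenG l])"
        by (rule less.IH[OF _ u2(2) s(2) l0]) (simp add: Suc u2(1))
      have "ip ?b k = -1" using ipb[of k] 1 by simp
      then have n2: "normal n' b' (u2 @ [GenG l, GenG k])"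
        using normal.step[OF n1 less.prems(2), of "u2 @ [GenG l, GenG k]"] u2(1) by simp
      have "u @ [GenG k] \<approx> u' @ [GenG l, GenG k]" using weq_right[OF s(5), of "[GenG k]"] by simp
      also have "\<dots> \<approx> u2 @ [GenG k, GenG l, GenG k]"
        using weq_right[OF u2(3), of "[GenG l, GenG k]"] by simp
      also have "\<dots> \<approx> (u2 @ [GenG l, GenG k]) @ [GenG l]"
        using weq_braid[of adj k l u2 "[]"] True by simp
      finally show ?thesis unfolding Suc s(4) by (rule normal.step[OF n2 s(2,3)])
    qed
  qed
qed

text \<open>The letter passes the raising letters that are not adjacent to it. At an adjacent one,
  \<open>normal_down\<close> makes the word end in the null word
  \<open>g\<^sub>k g\<^sub>l e\<^sub>k\<close>.\<close>

lemma normal_E_perp: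
  assumes "normal n b u" "k \<in> S" "ip b k = 0"
  shows "null adj (u @ [GenE k]) \<or> normal n b (u @ [GenE k])"
  using assms
proof (induction n arbitrary: b u)
  case 0
  then obtain j where j: "j \<in> S" "b = simple j" using normal_0 by blast
  then have "cartan k j = (0 :: int)" using ip_simple[where ?'a = int] 0 by simp
  then have kj: "k \<noteq> j" "\<not> adj j k" using adj_sym by (auto simp: cartan_def split: if_splits)
  show ?case
    using normal_along[of j u "[GenE k]" j] along_comm[OF j(1) 0(2) kj] 0(1) j by simp
next
  case (Suc n)
  obtain b' u' l where s: "normal n b' u'" "l \<in> S" "ip b' l = -1" "b = b'(l := b' l + 1)" "u \<approx> u' @ [GenG l]"
    "posroot b'" "ip b l = 1" "\<And>m. ip b m = ip b' m + cartan m l"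
    using normal_Suc[OF Suc.prems(1)] by metis
  have kl: "k \<noteq> l" using s(7) Suc.prems(3) by auto
  have u: "u @ [GenE k] \<approx> u' @ [GenG l, GenE k]" using weq_right[OF s(5), of "[GenE k]"] by simp
  show ?case
  proof (cases "adj k l")
    case False
    have 0: "ip b' k = 0" using s(8)[of k] Suc.prems(3) cartan_non[OF kl False] by simp
    note u
    also have "u' @ [GenG l, GenE k] \<approx> (u' @ [GenE k]) @ [GenG l]"
      using weq_swap[of "GenG l" "GenE k" adj u' "[]"] kl False adj_sym by auto
    finally have u: "u @ [GenE k] \<approx> (u' @ [GenE k]) @ [GenG l]" .
    from Suc.IH[OF s(1) Suc.prems(2) 0] show ?thesis
    proof
      assume "null adj (u' @ [GenE k])"
      then show ?thesis using null_weq[OF u] null_right by blast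
    next
      assume "normal n b' (u' @ [GenE k])"
      then show ?thesis using normal.step[OF _ s(2,3) u] unfolding s(4) by blast
    qed
  next
    case True
    have 1: "ip b' k = 1" using s(8)[of k] Suc.prems(3) cartan_adj[OF True] by simp
    obtain u2 where u2: "u' \<approx> u2 @ [GenG k]" using normal_down[OF s(1) Suc.prems(2) 1] by metis
    note u
    also have "u' @ [GenG l, GenE k] \<approx> u2 @ [GenG k, GenG l, GenE k]"
      using weq_right[OF u2, of "[GenG l, GenE k]"] by simp
    also have "null adj \<dots>" using True by (intro null_left null_base null_word.gge)
    finally show ?thesis ..
  qed
qed

text \<open>The raising letters are all swallowed. One not adjacent to \<open>k\<close> is passed
  and then absorbed at the end \<open>k\<close> of the new path. For an adjacent one,
  \<open>g\<^sub>l e\<^sub>k\<close> opens to \<open>g\<^sub>k e\<^sub>l e\<^sub>k\<close>, where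
  \<open>g\<^sub>k\<close> is orthogonal to the preceding root and \<open>e\<^sub>l\<close> again
  meets it with inner product -1.\<close>

lemma normal_E_adj:
  assumes "normal n b u" "k \<in> S" "ip b k = -1"
  shows "null adj (u @ [GenE k]) \<or> normal 0 (simple k) (u @ [GenE k])"
  using assms
proof (induction n arbitrary: b u k)
  case 0
  then obtain j where j: "j \<in> S" "b = simple j" using normal_0 by blast
  then have "cartan k j = (-1 :: int)" using ip_simple[where ?'a = int] 0 by simp
  then have kj: "adj j k" using adj_sym by (auto simp: cartan_def split: if_splits)
  show ?case using normal_along[OF _ along_adj[OF kj] j(1) 0(2)] 0(1) j by simp
next
  case (Suc n)
  obtain b' u' l where s: "normal n b' u'" "l \<in> S" "ip b' l = -1" "b = b'(l := b' l + 1)" "u \<approx> u' @ [GenG l]"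
    "posroot b'" "ip b l = 1" "\<And>m. ip b m = ip b' m + cartan m l"
    using normal_Suc[OF Suc.prems(1)] by metis
  have kl: "k \<noteq> l" using s(7) Suc.prems(3) by auto
  have u: "u @ [GenE k] \<approx> u' @ [GenG l, GenE k]" using weq_right[OF s(5), of "[GenE k]"] by simp
  show ?case
  proof (cases "adj k l")
    case False
    have 1: "ip b' k = -1" using s(8)[of k] Suc.prems(3) cartan_non[OF kl False] by simp
    note u
    also have "u' @ [GenG l, GenE k] \<approx> (u' @ [GenE k]) @ [GenG l]"
      using weq_swap[of "GenG l" "GenE k" adj u' "[]"] kl False adj_sym by auto
    finally have u: "u @ [GenE k] \<approx> (u' @ [GenE k]) @ [GenG l]" .
    from Suc.IH[OF s(1) Suc.prems(2) 1] show ?thesis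
    proof
      assume "null adj (u' @ [GenE k])"
      then show ?thesis using null_weq[OF u] null_right by blast
    next
      assume n: "normal 0 (simple k) (u' @ [GenE k])"
      have "normal 0 (simple k) ((u' @ [GenE k]) @ [GenG l])"
        by (rule normal_along[OF n along_comm]) (use Suc.prems s kl False in auto)
      then show ?thesis using normal_weq[OF _ u] by blast
    qed
  next
    case True
    have 0: "ip b' k = 0" using s(8)[of k] Suc.prems(3) cartan_adj[OF True] by simp
    note u
    also have "u' @ [GenG l, GenE k] \<approx> u' @ [GenG k, GenE l, GenE k]"
      using weq.sym[OF weq_gee[of adj k l u' "[]"]]
        True by simp
    finally have u: "u @ [GenE k] \<approx> ((u' @ [GenG k]) @ [GenE l]) @ [GenE k]" by simp
    from Suc.IH[OF normal_G_perp[OF s(1) Suc.prems(2) 0] s(2,3)] show ?thesis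
    proof
      assume "null adj ((u' @ [GenG k]) @ [GenE l])"
      then show ?thesis using null_weq[OF u] null_right by blast
    next
      assume n: "normal 0 (simple l) ((u' @ [GenG k]) @ [GenE l])"
      have "normal 0 (simple k) (((u' @ [GenG k]) @ [GenE l]) @ [GenE k])"
        by (rule normal_along[OF n along_adj]) (use Suc.prems s True adj_sym in auto)
      then show ?thesis using normal_weq[OF _ u] by blast
    qed
  qed
qed

text \<open>The cases are those of \<open>posroot_ip\<close>. For inner product 1 the word can be
  made to end in \<open>g\<^sub>k\<close>, and either letter at \<open>k\<close> then produces a
  null word. In the case of \<alpha>_k itself the word ends in \<open>e\<^sub>k\<close>, which kills
  \<open>g\<^sub>k\<close> and absorbs \<open>e\<^sub>k\<close>.\<close>

lemma normal_closed:
  assumes "normal n b u" "gen_node a \<in> S"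
  shows "null adj (u @ [a]) \<or> (\<exists>n b. normal n b (u @ [a]))"
proof -
  define k where "k = gen_node a"
  have k: "k \<in> S" and a: "a = GenG k \<or> a = GenE k" using assms(2) unfolding k_def by (cases a; simp)+
  have pr: "posroot b" using normal_root[OF assms(1)] by simp
  consider (zero) "ip b k = 0" | (up) "ip b k = -1" | (down) "ip b k = 1" | (same) "b = simple k"
    using posroot_ip[OF pr k] by auto
  then show ?thesis
  proof cases
    case zero
    then show ?thesis using normal_G_perp[OF assms(1) k] normal_E_perp[OF assms(1) k] a by blast
  next
    case up
    then show ?thesis using normal.step[OF assms(1) k up] normal_E_adj[OF assms(1) k up] a by blast
  next
    case down
    obtain u' where u': "u \<approx> u' @ [GenG k]" using normal_down[OF assms(1) k down] by metis
    have "u @ [a] \<approx> u' @ [GenG k, a]" using weq_right[OF u', of "[a]"] by simp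
    also have "null adj \<dots>" using a by (intro null_left null_base) (auto intro: null_word.intros)
    finally show ?thesis ..
  next
    case same
    then have n0: "normal 0 (simple k) u" using normal_simple assms(1) k by blast
    then obtain w where w: "u \<approx> w @ [GenE k]" using normal_E_last k by blast
    have ua: "u @ [a] \<approx> w @ [GenE k, a]" using weq_right[OF w, of "[a]"] by simp
    from a show ?thesis
    proof
      assume "a = GenG k"
      then have "null adj (w @ [GenE k, a])" by (auto intro: null_left null_base null_word.intros)
      then show ?thesis using null_weq[OF ua] by blast
    next
      assume a: "a = GenE k"
      note ua
      also have "w @ [GenE k, a] \<approx> w @ [GenE k]" using weq_idem[of adj w k "[]"] a by simp
      also have "\<dots> \<approx> u" by (rule weq.sym[OF w])
      finally show ?thesis using normal_weq[OF n0] by blast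
    qed
  qed
qed

lemma normal_words:
  assumes "j \<in> S" "w \<in> words_on S"
  shows "null adj (path j @ w) \<or> (\<exists>n b. normal n b (path j @ w))"
  using assms(2)
proof (induction w rule: rev_induct)
  case Nil
  show ?case using normal.base[of "[]" j "path j"] weq.sym[OF Ei_path[OF assms(1)]] assms(1) by auto
next
  case (snoc a w)
  then have "null adj (path j @ w) \<or> (\<exists>n b. normal n b (path j @ w))" "gen_node a \<in> S" by auto
  then show ?case using null_right[of adj "path j @ w" "[a]"] normal_closed[of _ _ "path j @ w" a] by auto
qed

lemma normal_form:
  assumes "normal n b u"
  obtains v j d where "v \<in> words_on dnodes" "j \<in> S" "d \<in> words_on S" "length d = n" "u \<approx> Phi v @ path j @ d"
  using assms
proof (induction arbitrary: thesis rule: normal.induct)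
  case (base v j u)
  then show ?case by (intro base(4)[of v j "[]"]) auto
next
  case (step n b u k u')
  obtain v j d where d: "v \<in> words_on dnodes" "j \<in> S" "d \<in> words_on S" "length d = n" "u \<approx> Phi v @ path j @ d"
    using step.IH by blast
  have "u' \<approx> Phi v @ path j @ d @ [GenG k]"
    using weq.trans[OF step(4) weq_right[OF d(5), of "[GenG k]"]] by simp
  then show ?case using d step(2) by (intro step(6)[of v j "d @ [GenG k]"]) auto
qed

lemma normal_bound: "\<exists>N. \<forall>n b u. normal n b u \<longrightarrow> n \<le> N"
proof -
  let ?N = "Max (insert 0 ((\<lambda>b. sum b S) ` {b. posroot b}))"
  have "int (Suc n) \<le> ?N" if "normal n b u" for n b u
      using normal_root[OF that] finite_posroots
      by (intro Max_ge finite.insertI finite_imageI insertI2 image_eqI[of _ _ b]) simp_all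
  then have "n \<le> nat ?N" if "normal n b u" for n b u using that by fastforce
  then show ?thesis by blast
qed

lemma finite_words: "finite {d \<in> words_on S. length d \<le> N}"
proof -
  have "{d \<in> words_on S. length d \<le> N} \<subseteq> {d. set d \<subseteq> GenG ` S \<union> GenE ` S \<and> length d \<le> N}"
  proof clarify
    fix d a assume "d \<in> words_on S" "a \<in> set d" "a \<notin> GenE ` S"
    then show "a \<in> GenG ` S" by (cases a) (auto simp: words_on_def)
  qed
  moreover have "finite {d. set d \<subseteq> GenG ` S \<union> GenE ` S \<and> length d \<le> N}"
    by (intro finite_lists_length_le finite_UnI finite_imageI fin)
  ultimately show ?thesis by (rule finite_subset)
qed

end

section \<open>Finiteness of the monoid of a positive definite diagram\<close>

definition fin_words :: "nat set \<Rightarrow> (nat \<Rightarrow> nat \<Rightarrow> bool) \<Rightarrow> bool" where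
  "fin_words S adj \<longleftrightarrow> (\<exists>F. finite F \<and> (\<forall>u\<in>words_on S. null adj u \<or> (\<exists>f\<in>F. weq adj u f)))"

lemma gmap_id: "gmap (\<lambda>x. x) a = a"
  by (cases a) auto

lemma map_gmap_id: "map (gmap (\<lambda>x. x)) u = u"
  by (induction u) (auto simp: gmap_id)

context rooted
begin

text \<open>Undoing the contractions \<open>e\<^sub>j e\<^sub>m e\<^sub>j\<close> along the path
  opens a word at any letter \<open>e\<^sub>j\<close> into two words starting at the root, the left
  one read backwards.\<close>

lemma E_path: "j \<in> S \<Longrightarrow> [GenE j] \<approx> rev (path j) @ path j"
proof (induction j rule: rk_induct)
  case root
  show ?case using weq.sym[OF weq_idem[of adj "[]" i "[]"]] by (simp add: path_i)
next
  case (step j)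
  define m where "m = par j"
  have m: "m \<in> S" "adj j m" "rk m < rk j" "path j = path m @ [GenE j]"
    unfolding m_def using par_adj[OF step(1,2)] par_in[OF step(1,2)] path_par[OF step(1,2)] by auto
  have "[GenE j] \<approx> [GenE j, GenE m, GenE j]" using weq.sym[OF weq_eee[of adj j m "[]" "[]"]] m by simp
  also have "\<dots> \<approx> [GenE j] @ (rev (path m) @ path m) @ [GenE j]"
    using weq_ctx[OF step(3)[OF m(1,3)], of "[GenE j]" "[GenE j]"] by simp
  finally show ?case by (simp add: m(4))
qed

lemma fin_words_rooted:
  assumes "fin_words dnodes dadj"
  shows "fin_words S adj"
proof -
  obtain F where F: "finite F" "\<And>v. v \<in> words_on dnodes \<Longrightarrow> null dadj v \<or> (\<exists>f\<in>F. weq dadj v f)"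
    using assms unfolding fin_words_def by blast
  obtain N where N: "\<And>n b u. normal n b u \<Longrightarrow> n \<le> N" using normal_bound by blast
  define T where "T = (\<lambda>(f, j, d). Phi f @ path j @ d) ` (F \<times> S \<times> {d \<in> words_on S. length d \<le> N})"
  have T: "finite T" unfolding T_def by (intro finite_imageI finite_cartesian_product F fin finite_words)
  have R: "null adj (path j @ w) \<or> (\<exists>t\<in>T. path j @ w \<approx> t)" if jw: "j \<in> S" "w \<in> words_on S" for j w
  proof (cases "null adj (path j @ w)")
    case False
    then obtain n b where n: "normal n b (path j @ w)" using normal_words[OF jw] by blast
    then obtain v k d where d: "v \<in> words_on dnodes" "k \<in> S" "d \<in> words_on S" "length d = n"
        "path j @ w \<approx> Phi v @ path k @ d"
      by (rule normal_form)
    have "\<not> null dadj v"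
      using False null_weq[OF d(5)] null_right[OF Phi_null[OF _ d(1)], of "path k @ d"] by blast
    then obtain f where f: "f \<in> F" "weq dadj v f" using F(2)[OF d(1)] by blast
    have "path j @ w \<approx> Phi f @ path k @ d"
      using weq.trans[OF d(5) weq_right] Phi_weq[OF f(2)] d(1) by blast
    moreover have "Phi f @ path k @ d \<in> T"
      unfolding T_def using f(1) d(2-4) N[OF n] by force
    ultimately show ?thesis by blast
  qed simp
  define L where "L = map GenG ` {u. set u \<subseteq> S \<and> length u \<le> card {x. posroot x}}"
  define TT where "TT = (\<lambda>(t, t'). rev t @ t') ` (T \<times> T)"
  have "finite (L \<union> TT)"
    unfolding L_def TT_def by (intro finite_UnI finite_imageI finite_cartesian_product T finite_lists_length_le fin)
  moreover have "null adj u \<or> (\<exists>f\<in>L \<union> TT. u \<approx> f)" if u: "u \<in> words_on S" for u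
  proof (cases "\<exists>j. GenE j \<in> set u")
    case True
    then obtain j u1 u2 where dec: "u = u1 @ GenE j # u2" by (metis split_list)
    then have S: "j \<in> S" "u1 \<in> words_on S" "u2 \<in> words_on S" using u by auto
    have eq: "u \<approx> rev (path j @ rev u1) @ (path j @ u2)"
      using weq_ctx[OF E_path[OF S(1)], of u1 u2] by (simp add: dec)
    have r: "rev u1 \<in> words_on S" using S by simp
    show ?thesis
    proof (cases "null adj (path j @ rev u1) \<or> null adj (path j @ u2)")
      case True
      then have "null adj (rev (path j @ rev u1) @ (path j @ u2))"
        by (auto intro: null_left null_right null_rev simp del: rev_append)
      then show ?thesis using null_weq[OF eq] by blast
    next
      case False
      then obtain t t' where t: "t \<in> T" "t' \<in> T" "path j @ rev u1 \<approx> t" "path j @ u2 \<approx> t'"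
        using R[OF S(1) r] R[OF S(1,3)] by blast
      have "u \<approx> rev t @ t'" by (rule weq.trans[OF eq weq.append[OF weq_rev[OF t(3)] t(4)]])
      then show ?thesis using t unfolding TT_def by force
    qed
  next
    case False
    have G: "u = map GenG (map gen_node u)"
    proof -
      have "map (\<lambda>a. GenG (gen_node a)) u = map (\<lambda>a. a) u"
      proof (rule map_cong[OF HOL.refl])
        fix a assume "a \<in> set u"
        then show "GenG (gen_node a) = a" using False by (metis gen.exhaust gen_node.simps(1))
      qed
      then show ?thesis by (simp add: comp_def)
    qed
    have s: "set (map gen_node u) \<subseteq> S" using u by (auto simp: words_on_def)
    show ?thesis
    proof (cases "null adj u")
      case nn: False
      then have "length (map gen_node u) \<le> card {x. posroot x}"
        using G_word_length[OF s] G by simp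
      then have "u \<in> L" unfolding L_def using s G by blast
      then show ?thesis using weq.refl by blast
    qed simp
  qed
  ultimately show ?thesis unfolding fin_words_def by blast
qed

end

section \<open>Restriction to subsets of nodes and disconnected diagrams\<close>

context graph
begin

text \<open>For the restricted adjacency a letter outside \<open>A\<close> commutes with all letters
  at other nodes, so only words on \<open>A\<close> can be compared.\<close>

lemma weq_restrict:
  assumes "weq (\<lambda>x y. x \<in> A \<and> y \<in> A \<and> adj x y) u v"
  shows "(u \<in> words_on A \<longleftrightarrow> v \<in> words_on A) \<and> (u \<in> words_on A \<longrightarrow> u \<approx> v)"
  using assms
proof (induction rule: weq.induct)
  case (base u v)
  have "u \<in> words_on A \<longleftrightarrow> v \<in> words_on A" using weq_set[OF weq.base[OF base], of A] by blast
  moreover have "basic_rel adj u v" if "u \<in> words_on A"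
    using basic_rel_gmap[OF base that, of "\<lambda>x. x" adj] by (simp add: map_gmap_id)
  ultimately show ?case using weq.base by blast
qed (auto intro: weq.sym weq.trans weq.append)

lemma null_restrict:
  assumes "null (\<lambda>x y. x \<in> A \<and> y \<in> A \<and> adj x y) u" "u \<in> words_on A"
  shows "null adj u"
proof -
  obtain x a y where a: "null_word (\<lambda>x y. x \<in> A \<and> y \<in> A \<and> adj x y) a"
      "weq (\<lambda>x y. x \<in> A \<and> y \<in> A \<and> adj x y) u (x @ a @ y)"
    using assms(1) by (auto simp: null_def)
  have eq: "x @ a @ y \<in> words_on A" "u \<approx> x @ a @ y" using weq_restrict[OF a(2)] assms(2) by auto
  have "null_word adj a"
    using null_word_gmap[OF a(1), of A adj "\<lambda>x. x"] eq(1) by (simp add: map_gmap_id)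
  then show ?thesis using null_weq[OF eq(2)] null_ctx null_base by blast
qed

lemma graph_restrict: "A \<subseteq> S \<Longrightarrow> graph A (\<lambda>x y. x \<in> A \<and> y \<in> A \<and> adj x y)"
  using finite_subset[OF _ fin] adj_sym by unfold_locales auto

lemma fin_words_restrict:
  assumes "fin_words A (\<lambda>x y. x \<in> A \<and> y \<in> A \<and> adj x y)"
  shows "\<exists>F. finite F \<and> (\<forall>v\<in>words_on A. null adj v \<or> (\<exists>f\<in>F. v \<approx> f))"
proof -
  let ?adj = "\<lambda>x y. x \<in> A \<and> y \<in> A \<and> adj x y"
  obtain F where F: "finite F" "\<And>v. v \<in> words_on A \<Longrightarrow> null ?adj v \<or> (\<exists>f\<in>F. weq ?adj v f)"
    using assms unfolding fin_words_def by blast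
  have "null adj v \<or> (\<exists>f\<in>F. v \<approx> f)" if v: "v \<in> words_on A" for v
    using F(2)[OF v]
  proof
    assume "null ?adj v"
    then show ?thesis using null_restrict[OF _ v] by blast
  next
    assume "\<exists>f\<in>F. weq ?adj v f"
    then show ?thesis using weq_restrict v by blast
  qed
  then show ?thesis using F(1) by blast
qed

text \<open>Letters of the two parts commute, so each word can be sorted into a word on
  \<open>A\<close> followed by one on \<open>B\<close>.\<close>

lemma fin_words_Un:
  assumes AB: "A \<union> B = S" "\<And>x y. x \<in> A \<Longrightarrow> y \<in> B \<Longrightarrow> x \<noteq> y \<and> \<not> adj x y"
    and "fin_words A (\<lambda>x y. x \<in> A \<and> y \<in> A \<and> adj x y)" "fin_words B (\<lambda>x y. x \<in> B \<and> y \<in> B \<and> adj x y)"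
  shows "fin_words S adj"
proof -
  obtain F where F: "finite F" "\<forall>v\<in>words_on A. null adj v \<or> (\<exists>f\<in>F. v \<approx> f)"
    using fin_words_restrict[OF assms(3)] by (elim exE conjE)
  obtain F' where F': "finite F'" "\<forall>v\<in>words_on B. null adj v \<or> (\<exists>f\<in>F'. v \<approx> f)"
    using fin_words_restrict[OF assms(4)] by (elim exE conjE)
  have split: "\<exists>v w. v \<in> words_on A \<and> w \<in> words_on B \<and> u \<approx> v @ w" if "u \<in> words_on S" for u
    using that
  proof (induction u)
    case Nil
    show ?case by (intro exI[of _ "[]"]) auto
  next
    case (Cons a u)
    then have "u \<in> words_on S" by simp
    from Cons.IH[OF this] obtain v w where vw: "v \<in> words_on A" "w \<in> words_on B" "u \<approx> v @ w"
      by (elim exE conjE)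
    show ?case
    proof (cases "gen_node a \<in> A")
      case True
      then show ?thesis using vw(1,2) weq_Cons[OF vw(3), of a]
        by (intro exI[of _ "a # v"] exI[of _ w]) simp
    next
      case False
      then have a: "gen_node a \<in> B" using Cons.prems AB(1) by auto
      have "commuting adj (gen_node a) v"
        unfolding commuting_def
      proof
        fix b assume "b \<in> set v"
        then have "gen_node b \<in> A" using vw(1) by (auto simp: words_on_def)
        from AB(2)[OF this a] show "gen_node b \<noteq> gen_node a \<and> \<not> adj (gen_node a) (gen_node b)"
          using adj_sym by blast
      qed
      then have "a # v @ w \<approx> v @ a # w" using weq_right[OF weq_commute_word, of adj a v w] by simp
      then have "a # u \<approx> v @ a # w" using weq.trans[OF weq_Cons[OF vw(3), of a]] by blast
      then show ?thesis using vw(1,2) a by (intro exI[of _ v] exI[of _ "a # w"]) simp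
    qed
  qed
  have "null adj u \<or> (\<exists>f\<in>(\<lambda>(f, f'). f @ f') ` (F \<times> F'). u \<approx> f)" if u: "u \<in> words_on S" for u
  proof -
    obtain v w where vw: "v \<in> words_on A" "w \<in> words_on B" "u \<approx> v @ w" using split[OF u] by (elim exE conjE)
    show ?thesis
    proof (cases "null adj v \<or> null adj w")
      case True
      then have "null adj (v @ w)" using null_left null_right by blast
      then show ?thesis using null_weq[OF vw(3)] by blast
    next
      case False
      then obtain f f' where f: "f \<in> F" "f' \<in> F'" "v \<approx> f" "w \<approx> f'" using F(2) F'(2) vw(1,2) by blast
      have "u \<approx> f @ f'" by (rule weq.trans[OF vw(3) weq.append[OF f(3,4)]])
      then show ?thesis using f(1,2) by force
    qed
  qed
  moreover have "finite ((\<lambda>(f, f'). f @ f') ` (F \<times> F'))" using F(1) F'(1) by blast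
  ultimately show ?thesis unfolding fin_words_def by blast
qed

text \<open>Extension by zero preserves the form, so the same constant works.\<close>

lemma posgraph_restrict:
  assumes "posdef" "A \<subseteq> S"
  shows "posgraph A (\<lambda>x y. x \<in> A \<and> y \<in> A \<and> adj x y)"
proof -
  let ?adj = "\<lambda>x y. x \<in> A \<and> y \<in> A \<and> adj x y"
  interpret R: graph A ?adj by (rule graph_restrict[OF assms(2)])
  obtain C where C: "C \<ge> 0" "\<And>x :: nat \<Rightarrow> int. supp x \<Longrightarrow> (\<forall>k\<in>S. (x k)\<^sup>2 \<le> C * q x)"
    using assms(1) unfolding posdef_def by blast
  have "(x k)\<^sup>2 \<le> C * R.q x" if "R.supp x" "k \<in> A" for x k
  proof -
    have z: "x l = 0" if "l \<notin> A" for l using \<open>R.supp x\<close> that unfolding R.supp_def by blast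
    have "ip x k = R.ip x k" if "k \<in> A" for k
      unfolding ip_def R.ip_def by (rule sum.mono_neutral_cong_right)
        (use assms(2) z that in \<open>auto simp: cartan_def R.cartan_def\<close>)
    then have "q x = R.q x"
      unfolding q_def R.q_def by (intro sum.mono_neutral_cong_right) (use assms(2) z in auto)
    moreover have "supp x" using z assms(2) unfolding supp_def by blast
    ultimately show ?thesis using C(2)[of x] that assms(2) by auto
  qed
  then have "R.posdef" unfolding R.posdef_def using C(1) by blast
  then show ?thesis by unfold_locales
qed

lemma ip_nbrs:
  assumes "k \<in> S" shows "ip x k = 2 * x k - (\<Sum>l | adj k l. x l)"
proof -
  have "ip x k = (\<Sum>l\<in>S. (if l = k then 2 * x k else 0) - (if adj k l then x l else 0))"
    unfolding ip_def cartan_def by (rule sum.cong) auto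
  also have "\<dots> = 2 * x k - sum x (S \<inter> {l. adj k l})"
    using assms by (simp add: sum_subtractf sum.inter_restrict)
  also have "S \<inter> {l. adj k l} = {l. adj k l}" using adj_in by auto
  finally show ?thesis .
qed

lemma finite_nbrs: "finite {l. adj k l}"
  by (rule finite_subset[OF _ fin]) (use adj_in in auto)

definition ind :: "nat set \<Rightarrow> nat \<Rightarrow> int" where
  "ind X k = (if k \<in> X then 1 else 0)"

lemma ind_insert: "k \<notin> X \<Longrightarrow> ind (insert k X) = (ind X)(k := ind X k + 1)"
  by (auto simp: ind_def)

text \<open>Together with \<open>q_bump\<close>: adjoining to \<open>X\<close> a node with
  \<open>d\<close> neighbours in \<open>X\<close> changes the norm of the indicator by 2 - 2
  d.\<close>

lemma ip_ind:
  assumes "k \<in> S" "k \<notin> X"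
  shows "ip (ind X) k = - int (card {l. l \<in> X \<and> adj k l})"
proof -
  have "(\<Sum>l | adj k l. ind X l) = (\<Sum>l\<in>{l. adj k l} \<inter> {l. l \<in> X}. 1)"
    by (subst sum.inter_restrict[OF finite_nbrs]) (simp add: ind_def)
  also have "{l. adj k l} \<inter> {l. l \<in> X} = {l. l \<in> X \<and> adj k l}" by auto
  finally show ?thesis using ip_nbrs[OF assms(1), of "ind X"] assms(2) by (simp add: ind_def)
qed

end

section \<open>Shape of connected positive definite diagrams\<close>

context posgraph
begin

text \<open>
  The affine diagrams of type D: twice the indicator of a tree plus four neighbours of it is a
  vector of non-positive norm.
\<close>

lemma no_affine_D:
  assumes "Y \<subseteq> S" "q (ind Y) = 2" "distinct [a, b, c, d]"
    and nb: "\<And>x. x \<in> {a, b, c, d} \<Longrightarrow> x \<in> S \<and> x \<notin> Y \<and> (\<exists>y\<in>Y. adj x y)"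
  shows False
proof -
  have ip1: "ip (ind Y) x \<le> -1" if "x \<in> {a, b, c, d}" for x
  proof -
    have "finite {l. l \<in> Y \<and> adj x l}" using finite_subset[OF assms(1) fin] by simp
    moreover have "{l. l \<in> Y \<and> adj x l} \<noteq> {}" using nb[OF that] by auto
    ultimately have "card {l. l \<in> Y \<and> adj x l} > 0" using card_gt_0_iff by blast
    then show ?thesis using ip_ind[of x Y] nb[OF that] by auto
  qed
  define y where "y = (\<lambda>k. 2 * ind Y k)"
  have ipy: "ip y k = 2 * ip (ind Y) k" for k
    unfolding ip_def y_def by (simp add: sum_distrib_left mult.assoc)
  have qy: "q y = 8"
  proof -
    have "q y = (\<Sum>k\<in>S. 4 * (ind Y k * ip (ind Y) k))"
      unfolding q_def ipy by (rule sum.cong) (simp_all add: y_def)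
    then show ?thesis using assms(2) by (simp add: q_def sum_distrib_left[symmetric])
  qed
  have c0: "cartan x z \<le> (0::int)" if "x \<noteq> z" for x z using that by (simp add: cartan_def)
  have S: "a \<in> S" "b \<in> S" "c \<in> S" "d \<in> S" using nb by auto
  define y1 where "y1 = y(a := y a + 1)"
  define y2 where "y2 = y1(b := y1 b + 1)"
  define y3 where "y3 = y2(c := y2 c + 1)"
  define y4 where "y4 = y3(d := y3 d + 1)"
  have i1: "ip y1 k = ip y k + 1 * cartan k a" for k unfolding y1_def by (rule ip_bump[OF S(1)])
  have i2: "ip y2 k = ip y1 k + 1 * cartan k b" for k unfolding y2_def by (rule ip_bump[OF S(2)])
  have i3: "ip y3 k = ip y2 k + 1 * cartan k c" for k unfolding y3_def by (rule ip_bump[OF S(3)])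
  have q1: "q y1 = q y + 2 * 1 * ip y a + 2 * 1 * 1" unfolding y1_def by (rule q_bump[OF S(1)])
  have q2: "q y2 = q y1 + 2 * 1 * ip y1 b + 2 * 1 * 1" unfolding y2_def by (rule q_bump[OF S(2)])
  have q3: "q y3 = q y2 + 2 * 1 * ip y2 c + 2 * 1 * 1" unfolding y3_def by (rule q_bump[OF S(3)])
  have q4: "q y4 = q y3 + 2 * 1 * ip y3 d + 2 * 1 * 1" unfolding y4_def by (rule q_bump[OF S(4)])
  have "q y4 = q y + 2 * ip y a + 2 * ip y1 b + 2 * ip y2 c + 2 * ip y3 d + 8"
    using q1 q2 q3 q4 by simp
  \<comment> \<open>The doubled indicator has norm 8, and each of the four neighbours changes it by
    at most -4 + 2. Adjacency among the neighbours only lowers the result.\<close>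
  also have "\<dots> \<le> 0"
    unfolding i1 i2 i3 ipy qy
    using ip1[of a] ip1[of b] ip1[of c] ip1[of d] assms(3)
      c0[of b a] c0[of c a] c0[of c b] c0[of d a] c0[of d b] c0[of d c] by simp
  finally have "q y4 \<le> 0" .
  moreover have "supp y" using assms(1) by (auto simp: supp_def y_def ind_def)
  then have "supp y4" unfolding y4_def y3_def y2_def y1_def by (intro supp_bump S)
  ultimately have "y4 = (\<lambda>_. 0)" using q_zero by blast
  then have "y4 a = 0" by simp
  moreover have "y4 a = 1" using assms(3) nb[of a] by (simp add: y4_def y3_def y2_def y1_def y_def ind_def)
  ultimately show False by simp
qed

text \<open>A tree is grown from \<open>i\<close> by one adjacent node at a time, as connectedness
  allows. Its indicator keeps norm 2: a node closing a cycle would have two neighbours in the tree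
  and bring the norm down to zero or below.\<close>

lemma tree_structure:
  assumes conn: "\<forall>X. X \<subseteq> S \<longrightarrow> X \<noteq> {} \<longrightarrow> X \<noteq> S \<longrightarrow> (\<exists>j\<in>X. \<exists>k\<in>S - X. adj j k)"
    and i: "i \<in> S"
  obtains par rk where "\<And>j. j \<in> S \<Longrightarrow> j \<noteq> i \<Longrightarrow> adj j (par j) \<and> rk (par j) < (rk j :: nat)"
    "\<And>j k. adj j k \<Longrightarrow> j \<noteq> i \<and> par j = k \<or> k \<noteq> i \<and> par k = j"
proof -
  define tree where "tree X par rk \<longleftrightarrow> X \<subseteq> S \<and> i \<in> X \<and> q (ind X) = 2 \<and>
    (\<forall>j\<in>X. j \<noteq> i \<longrightarrow> par j \<in> X \<and> adj j (par j) \<and> rk (par j) < (rk j :: nat)) \<and>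
    (\<forall>j\<in>X. \<forall>k\<in>X. adj j k \<longrightarrow> j \<noteq> i \<and> par j = k \<or> k \<noteq> i \<and> par k = j)" for X par rk
  have "\<exists>X par rk. card X = Suc n \<and> tree X par rk" if "Suc n \<le> card S" for n
    using that
  proof (induction n)
    case 0
    have "ind {i} = simple i" by (auto simp: ind_def simple_def)
    then show ?case using i q_simple[OF i, where ?'a = int]
      by (intro exI[of _ "{i}"]) (auto simp: tree_def)
  next
    case (Suc n)
    have "Suc n \<le> card S" using Suc.prems by simp
    from Suc.IH[OF this] obtain X par rk where tX: "card X = Suc n" "tree X par rk"
      by (elim exE conjE)
    then have X: "card X = Suc n" "X \<subseteq> S" "i \<in> X" "q (ind X) = 2"
        "\<And>j. j \<in> X \<Longrightarrow> j \<noteq> i \<Longrightarrow> par j \<in> X \<and> adj j (par j) \<and> rk (par j) < (rk j :: nat)"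
        "\<And>j k. j \<in> X \<Longrightarrow> k \<in> X \<Longrightarrow> adj j k \<Longrightarrow> j \<noteq> i \<and> par j = k \<or> k \<noteq> i \<and> par k = j"
      unfolding tree_def by blast+
    have fX: "finite X" using X finite_subset fin by blast
    have "X \<noteq> S" "X \<noteq> {}" using X Suc.prems by auto
    then obtain j k where jk: "j \<in> X" "k \<in> S" "k \<notin> X" "adj j k" using conn X(2) by blast
    let ?N = "{l. l \<in> X \<and> adj k l}"
    have N: "j \<in> ?N" "finite ?N" using jk adj_sym fX by auto
    have qk: "q (ind (insert k X)) = 4 - 2 * int (card ?N)"
      unfolding ind_insert[OF jk(3)] using q_bump[OF jk(2), of "ind X" 1] ip_ind[OF jk(2,3)] X(4) by simp
    have "supp (ind (insert k X))" using X jk by (auto simp: supp_def ind_def)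
    moreover have "ind (insert k X) k \<noteq> 0" by (simp add: ind_def)
    ultimately have "\<not> q (ind (insert k X)) \<le> 0" using q_zero[of "ind (insert k X)"] by metis
    then have "card ?N < 2" unfolding qk by simp
    then have cN: "card ?N = 1" using N card_gt_0_iff[of ?N] by auto
    then have N': "l = j" if "l \<in> X" "adj k l \<or> adj l k" for l
    proof -
      obtain z where z: "?N = {z}" using cN card_1_singletonE by blast
      have "l \<in> ?N" using that adj_sym by blast
      then show ?thesis using N(1) unfolding z by blast
    qed
    \<comment> \<open>The new node hangs below its only neighbour \<open>j\<close> in
      \<open>X\<close>, with rank one higher.\<close>
    have "tree (insert k X) (par(k := j)) (rk(k := Suc (rk j)))"
      unfolding tree_def
    proof (intro conjI ballI impI)
      show "q (ind (insert k X)) = 2" using qk cN by simp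
      fix l assume l: "l \<in> insert k X" "l \<noteq> i"
      then have "l = k \<or> l \<in> X \<and> l \<noteq> k \<and> par l \<in> X \<and> par l \<noteq> k" using X(5)[of l] jk by auto
      then show "(par(k := j)) l \<in> insert k X" "adj l ((par(k := j)) l)"
        "(rk(k := Suc (rk j))) ((par(k := j)) l) < (rk(k := Suc (rk j))) l"
        using X(5)[of l] l jk adj_sym by auto
    next
      fix a b assume ab: "a \<in> insert k X" "b \<in> insert k X" "adj a b"
      have "k \<noteq> i" using jk X(3) by auto
      then show "a \<noteq> i \<and> (par(k := j)) a = b \<or> b \<noteq> i \<and> (par(k := j)) b = a"
        using ab X(6)[of a b] N'[of a] N'[of b] jk by (cases "a = k"; cases "b = k") auto
    qed (use X jk in auto)
    moreover have "card (insert k X) = Suc (Suc n)" using X(1) jk(3) fX by simp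
    ultimately show ?case by blast
  qed
  moreover have "card S = Suc (card S - 1)" using i by (simp add: card_gt_0_iff) (metis Suc_pred card_gt_0_iff empty_iff fin)
  ultimately obtain X par rk where X: "card X = card S" "tree X par rk" by (metis order_refl)
  then have "X = S" using card_subset_eq[OF fin] unfolding tree_def by blast
  then show ?thesis using X(2) adj_in unfolding tree_def by (intro that[of par rk]) blast+
qed

end

section \<open>The derived diagram is positive definite and has fewer nodes\<close>

context rooted
begin

lemma graph_derived: "graph dnodes dadj"
proof
  have "dnodes \<subseteq> prod_encode ` (S \<times> S)"
    unfolding dnodes_def using adj_in by auto
  then show "finite dnodes" by (rule finite_subset) simp
qed (use adj_sym in \<open>auto simp: dadj_def split: prod.splits\<close>)

sublocale D: graph dnodes dadj
  by (rule graph_derived)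

text \<open>These are roots orthogonal to \<alpha>_i; for a pair the products with \<alpha>_i are
  -1, -1 and 2.\<close>

definition vec :: "nat \<Rightarrow> nat \<Rightarrow> int" where
  "vec m = (case prod_decode m of (x, y) \<Rightarrow>
     if x = y then simple x else (\<lambda>k. simple x k + simple y k + simple i k))"

definition pair :: "(nat \<Rightarrow> int) \<Rightarrow> (nat \<Rightarrow> int) \<Rightarrow> int" where
  "pair x y = (\<Sum>k\<in>S. x k * ip y k)"

lemma pair_simple: "k \<in> S \<Longrightarrow> pair (simple k) y = ip y k"
  unfolding pair_def simple_def by (simp add: if_distrib[of "\<lambda>y. y * _"] cong: if_cong)

lemma pair_add: "pair (\<lambda>k. x k + x' k) y = pair x y + pair x' y"
  by (simp add: pair_def algebra_simps sum.distrib)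

text \<open>By \<open>no_square\<close> a single node is adjacent to at most one member of a pair,
  so -2 never occurs. Distinct pairs share exactly one neighbour, and the contributions to the
  product of their roots cancel.\<close>

lemma pair_vec:
  assumes "m \<in> dnodes" "n \<in> dnodes"
  shows "pair (vec m) (vec n) = D.cartan m n"
proof -
  have cs: "cartan a b = (cartan b a :: int)" for a b by (rule cartan_sym)
  have nb: "cartan a i = (-1::int)" "cartan i a = (-1::int)" "a \<in> S" "a \<noteq> i" if "adj i a" for a
    using that adj_in adj_sym nbr_par by (auto simp: cartan_def)
  have nn: "cartan a b = (if a = b then 2 else (0::int))" if "adj i a" "adj i b" for a b
    using that nbrs_not_adj by (auto simp: cartan_def)
  have single_i: "cartan b i = (0::int)" "cartan i b = (0::int)" if "b \<noteq> i" "\<not> adj i b" for b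
    using that adj_sym by (auto simp: cartan_def)
  from assms(1) show ?thesis
  proof (cases rule: dnodes_cases)
    case m: (single b)
    from assms(2) show ?thesis
    proof (cases rule: dnodes_cases)
      case n: (single d)
      then show ?thesis using m assms
        by (simp add: vec_def pair_simple ip_simple D.cartan_def cartan_def dadj_def)
    next
      case n: (pair c d)
      have "cartan b c + cartan b d = (if dadj m n then -1 else (0::int))"
        using m n assms no_square[of c d b] adj_sym by (auto simp: cartan_def dadj_def)
      moreover have "m \<noteq> n" using m n by auto
      ultimately show ?thesis using m n nb[OF n(2)] nb[OF n(3)] i_in single_i[OF m(3,4)]
        by (simp add: vec_def pair_simple ip_add ip_simple D.cartan_def)
    qed
  next
    case m: (pair a b)
    from assms(2) show ?thesis
    proof (cases rule: dnodes_cases)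
      case n: (single d)
      have "cartan a d + cartan b d = (if dadj m n then -1 else (0::int))"
        using m n assms no_square[of a b d] adj_sym by (auto simp: cartan_def dadj_def)
      moreover have "m \<noteq> n" using m n by auto
      ultimately show ?thesis using m n nb[OF m(2)] nb[OF m(3)] i_in single_i[OF n(3,4)]
        by (simp add: vec_def pair_add pair_simple ip_add ip_simple D.cartan_def)
    next
      case n: (pair c d)
      have "\<not> dadj m n" "m = n \<longleftrightarrow> a = c \<and> b = d" using m n by (simp_all add: dadj_def)
      moreover have "a = c \<or> a = d \<or> b = c \<or> b = d" using disjoint_pairs[OF m(2,3) n(2,3)] m(4) n(4) by auto
      ultimately show ?thesis
        using m n nb[OF m(2)] nb[OF m(3)] nb[OF n(2)] nb[OF n(3)] i_in
          nn[OF m(2) n(2)] nn[OF m(2) n(3)] nn[OF m(3) n(2)] nn[OF m(3) n(3)]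
        by (auto simp: vec_def pair_add pair_simple ip_add ip_simple D.cartan_def)
    qed
  qed
qed

definition lift :: "(nat \<Rightarrow> int) \<Rightarrow> nat \<Rightarrow> int" where
  "lift y k = (\<Sum>m\<in>dnodes. y m * vec m k)"

lemma ip_lift: "ip (lift y) k = (\<Sum>m\<in>dnodes. y m * ip (vec m) k)"
  unfolding ip_def lift_def sum_distrib_left sum_distrib_right
  by (subst sum.swap) (simp add: mult.assoc)

lemma q_lift: "q (lift y) = D.q y"
proof -
  have "q (lift y) = (\<Sum>k\<in>S. \<Sum>m\<in>dnodes. \<Sum>n\<in>dnodes. y m * (y n * (vec m k * ip (vec n) k)))"
    unfolding q_def ip_lift lift_def sum_product by (simp add: mult_ac)
  also have "\<dots> = (\<Sum>m\<in>dnodes. \<Sum>n\<in>dnodes. \<Sum>k\<in>S. y m * (y n * (vec m k * ip (vec n) k)))"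
    by (subst sum.swap, rule sum.cong[OF HOL.refl], rule sum.swap)
  also have "\<dots> = (\<Sum>m\<in>dnodes. \<Sum>n\<in>dnodes. y m * (y n * D.cartan m n))"
    by (intro sum.cong HOL.refl) (simp add: pair_vec[symmetric] pair_def sum_distrib_left)
  finally show ?thesis by (simp add: D.q_def D.ip_def sum_distrib_left)
qed

lemma supp_lift: "supp (lift y)"
proof -
  have "vec m k = 0" if "m \<in> dnodes" "k \<notin> S" for m k
    using that(1)
  proof (cases rule: dnodes_cases)
    case (pair a b)
    then have "a \<in> S" "b \<in> S" using adj_in by auto
    then show ?thesis using pair that(2) i_in by (auto simp: vec_def simple_def)
  qed (use that(2) in \<open>auto simp: vec_def simple_def\<close>)
  then show ?thesis by (auto simp: supp_def lift_def)
qed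

lemma vec_values:
  "b \<in> S \<Longrightarrow> b \<noteq> i \<Longrightarrow> \<not> adj i b \<Longrightarrow> m \<in> dnodes \<Longrightarrow> vec m b = (if m = prod_encode (b, b) then 1 else 0)"
  "m \<in> dnodes \<Longrightarrow> vec m i = (if fst (prod_decode m) = snd (prod_decode m) then 0 else 1)"
  "adj i c \<Longrightarrow> m \<in> dnodes \<Longrightarrow> vec m c =
     (if fst (prod_decode m) \<noteq> snd (prod_decode m) \<and> (c = fst (prod_decode m) \<or> c = snd (prod_decode m)) then 1 else 0)"
proof -
  have ni: "a \<noteq> i" if "adj i a" for a using that nbr_par by blast
  show "b \<in> S \<Longrightarrow> b \<noteq> i \<Longrightarrow> \<not> adj i b \<Longrightarrow> m \<in> dnodes \<Longrightarrow> vec m b = (if m = prod_encode (b, b) then 1 else 0)"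
    by (elim dnodes_cases) (auto simp: vec_def simple_def)
  show "m \<in> dnodes \<Longrightarrow> vec m i = (if fst (prod_decode m) = snd (prod_decode m) then 0 else 1)"
    by (elim dnodes_cases) (use ni in \<open>auto simp: vec_def simple_def\<close>)
  show "adj i c \<Longrightarrow> m \<in> dnodes \<Longrightarrow> vec m c =
     (if fst (prod_decode m) \<noteq> snd (prod_decode m) \<and> (c = fst (prod_decode m) \<or> c = snd (prod_decode m)) then 1 else 0)"
    by (elim dnodes_cases) (use ni in \<open>auto simp: vec_def simple_def\<close>)
qed

text \<open>
  A coordinate at a pair of neighbours of \<open>i\<close> is recovered by subtracting the coefficient of the
  lift at a third neighbour, if there is one, from that at \<open>i\<close>.
\<close>

lemma posdef_derived: "D.posdef"
proof -
  obtain C where C: "C \<ge> 0" "\<And>x :: nat \<Rightarrow> int. supp x \<Longrightarrow> (\<forall>k\<in>S. (x k)\<^sup>2 \<le> C * q x)"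
    using posdef unfolding posdef_def by blast
  have "(y m)\<^sup>2 \<le> 4 * C * D.q y" if m: "m \<in> dnodes" for y m
  proof -
    have le: "(lift y k)\<^sup>2 \<le> C * D.q y" if "k \<in> S" for k
      using C(2)[OF supp_lift, of y] that q_lift[of y] by simp
    have nn: "0 \<le> C * D.q y" using le[OF i_in] by (rule order_trans[rotated]) simp
    have only: "(\<Sum>n\<in>dnodes. y n * f n) = y m" if "\<And>n. n \<in> dnodes \<Longrightarrow> f n = (if n = m then 1 else 0)" for f
    proof -
      have "(\<Sum>n\<in>dnodes. y n * f n) = (\<Sum>n\<in>dnodes. if n = m then y m else 0)"
        by (rule sum.cong) (auto simp: that)
      then show ?thesis using m by simp
    qed
    from m show ?thesis
    proof (cases rule: dnodes_cases)
      case (single b)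
      then have "y m = lift y b" unfolding lift_def using vec_values(1)[of b] by (intro only[symmetric]) auto
      then show ?thesis using le[OF single(2)] nn by simp
    next
      case (pair a b)
      show ?thesis
      proof (cases "\<exists>c. adj i c \<and> c \<noteq> a \<and> c \<noteq> b")
        case True
        then obtain c where c: "adj i c" "c \<noteq> a" "c \<noteq> b" by blast
        have "lift y i - lift y c = (\<Sum>n\<in>dnodes. y n * (vec n i - vec n c))"
          unfolding lift_def by (simp add: sum_subtractf algebra_simps)
        also have "\<dots> = y m"
        proof (rule only)
          fix n assume n: "n \<in> dnodes"
          then show "vec n i - vec n c = (if n = m then 1 else 0)"
          proof (cases rule: dnodes_cases)
            case (single d)
            then show ?thesis using vec_values(2)[OF n] vec_values(3)[OF c(1) n] pair by auto
          next
            case n': (pair x z)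
            have "c = x \<or> c = z \<or> a = x \<and> b = z"
              using disjoint_pairs[OF n'(2,3) pair(2) c(1)] disjoint_pairs[OF n'(2,3) pair(3) c(1)]
                disjoint_pairs[OF n'(2,3) pair(2,3)] n'(4) pair(4) c by auto
            then show ?thesis using vec_values(2)[OF n] vec_values(3)[OF c(1) n] n' pair c by auto
          qed
        qed
        finally have y: "y m = lift y i - lift y c" by simp
        \<comment> \<open>Squaring the difference of two lift coordinates, each with square at most
          \<open>C * D.q y\<close>, is the origin of the factor 4.\<close>
        have "(y m)\<^sup>2 \<le> 2 * (lift y i)\<^sup>2 + 2 * (lift y c)\<^sup>2"
          using zero_le_power2[of "lift y i + lift y c"] unfolding y
          by (simp add: power2_eq_square algebra_simps)
        also have "\<dots> \<le> 4 * C * D.q y" using le[OF i_in] le[of c] c adj_in by auto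
        finally show ?thesis .
      next
        case False
        have "y m = lift y i"
          unfolding lift_def
        proof (rule only[symmetric])
          fix n assume n: "n \<in> dnodes"
          then show "vec n i = (if n = m then 1 else 0)"
          proof (cases rule: dnodes_cases)
            case (single d)
            then show ?thesis using vec_values(2)[OF n] pair by auto
          next
            case n': (pair x z)
            then have "x \<in> {a, b}" "z \<in> {a, b}" using False by auto
            then show ?thesis using vec_values(2)[OF n] n' pair by auto
          qed
        qed
        then show ?thesis using le[OF i_in] nn by simp
      qed
    qed
  qed
  then show ?thesis unfolding D.posdef_def using C(1) by (intro exI[of _ "4 * C"]) auto
qed

text \<open>The node \<open>i\<close> is lost, and its d neighbours, with d at most 3, are replaced
  by the d choose 2 pairs, of which there are at most d.\<close>

lemma card_derived: "card dnodes < card S"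
proof -
  let ?N = "{a. adj i a}"
  let ?A = "S - insert i ?N" and ?P = "{T. T \<subseteq> ?N \<and> card T = 2}"
  define f where "f m = (case prod_decode m of (x, y) \<Rightarrow> if x = y then {x} else {x, y})" for m
  have fN: "finite ?N" by (rule finite_nbrs)
  have "inj_on f dnodes"
  proof (rule inj_onI)
    fix m n assume "m \<in> dnodes" "n \<in> dnodes" and eq: "f m = f n"
    from this(1) show "m = n"
    proof (cases rule: dnodes_cases)
      case m: (single b)
      from \<open>n \<in> dnodes\<close> show ?thesis by (cases rule: dnodes_cases) (use m eq in \<open>auto simp: f_def\<close>)
    next
      case m: (pair a b)
      from \<open>n \<in> dnodes\<close> show ?thesis
        by (cases rule: dnodes_cases) (use m eq in \<open>auto simp: f_def doubleton_eq_iff\<close>)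
    qed
  qed
  moreover have "f ` dnodes \<subseteq> (\<lambda>b. {b}) ` ?A \<union> ?P"
  proof (rule image_subsetI)
    fix m assume "m \<in> dnodes"
    then show "f m \<in> (\<lambda>b. {b}) ` ?A \<union> ?P"
      by (cases rule: dnodes_cases) (auto simp: f_def)
  qed
  moreover have fP: "finite ?P" by (rule finite_subset[of _ "Pow ?N"]) (use fN in auto)
  ultimately have "card dnodes \<le> card ((\<lambda>b. {b}) ` ?A \<union> ?P)"
    by (intro card_inj_on_le[of f]) auto
  also have "\<dots> \<le> card ?A + card ?P"
    by (rule order_trans[OF card_Un_le]) (intro add_mono card_image_le; simp)
  also have "card ?P = card ?N choose 2" using n_subsets[OF fN] by simp
  also have "card ?N choose 2 \<le> card ?N"
  proof -
    have "card ?N \<in> {0, 1, 2, 3}" using three_nbrs by auto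
    then show ?thesis by (auto simp: choose_two)
  qed
  finally have "card dnodes \<le> card ?A + card ?N" by simp
  moreover have "card S = card ?A + Suc (card ?N)"
  proof -
    have sub: "insert i ?N \<subseteq> S" using adj_in i_in by auto
    have "card (insert i ?N) = Suc (card ?N)" using fN by simp
    then show ?thesis using card_Diff_subset[OF _ sub] card_mono[OF fin sub] fN by simp
  qed
  ultimately show ?thesis by simp
qed

end

section \<open>Choice of the root\<close>

context posgraph
begin

lemma four_elements:
  assumes "finite A" "card A \<ge> 4"
  obtains a b c d where "distinct [a, b, c, d]" "{a, b, c, d} \<subseteq> A"
proof -
  obtain T where T: "T \<subseteq> A" "card T = 4" using obtain_subset_with_card_n[OF assms(2)] by blast
  then have "finite T" using assms(1) finite_subset by blast
  then obtain xs where xs: "set xs = T" "distinct xs" using finite_distinct_list by blast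
  then have "length xs = 4" using T(2) distinct_card by fastforce
  then obtain a b c d where "xs = [a, b, c, d]" by (auto simp: numeral_eq_Suc length_Suc_conv)
  then show ?thesis using that[of a b c d] xs T by auto
qed

text \<open>A node of maximal degree serves as root. A branch node elsewhere would force degree at
  least three at the root too; the path between the two branch nodes, with two further neighbours at
  each end, is an affine diagram of type D.\<close>

lemma rooted_exists:
  assumes conn: "\<forall>X. X \<subseteq> S \<longrightarrow> X \<noteq> {} \<longrightarrow> X \<noteq> S \<longrightarrow> (\<exists>j\<in>X. \<exists>k\<in>S - X. adj j k)"
    and "S \<noteq> {}"
  obtains i par rk where "rooted S adj i par rk"
proof -
  define deg where "deg k = card {l. adj k l}" for k
  have "Max (deg ` S) \<in> deg ` S" using assms(2) by (intro Max_in) auto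
  then obtain i where i: "i \<in> S" "deg i = Max (deg ` S)" by auto
  have max: "deg k \<le> deg i" if "k \<in> S" for k unfolding i(2) using that by (intro Max_ge) auto
  obtain par rk where par: "\<And>j. j \<in> S \<Longrightarrow> j \<noteq> i \<Longrightarrow> adj j (par j) \<and> rk (par j) < (rk j :: nat)"
    and edge: "\<And>j k. adj j k \<Longrightarrow> j \<noteq> i \<and> par j = k \<or> k \<noteq> i \<and> par k = j"
    by (rule tree_structure[OF conn i(1)]) blast
  have ni: "a \<noteq> i \<and> par a = i" if "adj i a" for a using edge[OF that] that by auto
  have ind_i: "q (ind {i}) = 2"
  proof -
    have "ind {i} = simple i" by (auto simp: ind_def simple_def)
    then show ?thesis using q_simple[OF i(1), where ?'a = int] by simp
  qed
  have three: "card {k. adj i k} \<le> 3"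
  proof (rule ccontr)
    assume "\<not> ?thesis"
    then have "card {k. adj i k} \<ge> 4" by simp
    from four_elements[OF finite_nbrs this] obtain a b c d where
      abcd: "distinct [a, b, c, d]" "{a, b, c, d} \<subseteq> {k. adj i k}" .
    show False
      by (rule no_affine_D[of "{i}" a b c d]) (use abcd i ind_i adj_sym adj_in in auto)
  qed
  \<comment> \<open>\<open>Y\<close> is the set of nodes on the path from \<open>i\<close> to
    \<open>c\<close>. The rank bound keeps the children of \<open>c\<close> outside, and the last
    clause leaves at least two of three neighbours of \<open>i\<close> outside.\<close>
  have branch: "\<exists>Y. Y \<subseteq> S \<and> i \<in> Y \<and> c \<in> Y \<and> q (ind Y) = 2 \<and> (\<forall>y\<in>Y. rk y \<le> rk c) \<and>
      (\<forall>a\<in>Y. \<forall>b\<in>Y. adj i a \<longrightarrow> adj i b \<longrightarrow> a = b)" if "c \<in> S" for c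
    using that
  proof (induction "rk c" arbitrary: c rule: less_induct)
    case less
    show ?case
    proof (cases "c = i")
      case True
      then show ?thesis using i ind_i by (intro exI[of _ "{i}"]) auto
    next
      case False
      define m where "m = par c"
      have m: "adj c m" "rk m < rk c" "m \<in> S" unfolding m_def using par[OF less.prems False] adj_in by auto
      from less.hyps[OF m(2,3)] obtain Y where Y: "Y \<subseteq> S" "i \<in> Y" "m \<in> Y" "q (ind Y) = 2" "\<forall>y\<in>Y. rk y \<le> rk m"
          "\<forall>a\<in>Y. \<forall>b\<in>Y. adj i a \<longrightarrow> adj i b \<longrightarrow> a = b"
        by (elim exE conjE)
      have cY: "c \<notin> Y" using Y(5) m(2) by auto
      have "{l. l \<in> Y \<and> adj c l} = {m}"
      proof -
        \<comment> \<open>Any other neighbour in \<open>Y\<close> would be a child of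
          \<open>c\<close> and have too large a rank.\<close>
        have "l = m" if l: "l \<in> Y" "adj c l" for l
        proof (rule ccontr)
          assume "l \<noteq> m"
          then have li: "l \<noteq> i" "par l = c" using edge[OF l(2)] unfolding m_def by blast+
          then have "rk c < rk l" using par[of l] Y(1) l(1) by blast
          moreover have "rk l \<le> rk m" using Y(5) l(1) by blast
          ultimately show False using m(2) by simp
        qed
        then show ?thesis using Y(3) m(1) by blast
      qed
      then have "q (ind (insert c Y)) = 2"
        unfolding ind_insert[OF cY] using q_bump[OF less.prems, of "ind Y" 1] ip_ind[OF less.prems cY] Y(4) by simp
      moreover have only_c: "a = c" if "adj i c" "a \<in> insert c Y" "adj i a" for a
      proof (rule ccontr)
        assume "a \<noteq> c"
        then have "a \<in> Y" using that by simp
        moreover have "m = i" using ni[OF that(1)] unfolding m_def by blast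
        ultimately have "rk a \<le> rk i" using Y(5) by blast
        moreover have "rk i < rk a" using par[of a] ni[OF that(3)] adj_in[OF that(3)] by auto
        ultimately show False by simp
      qed
      moreover have "rk y \<le> rk c" if "y \<in> insert c Y" for y using that Y(5) m(2) by fastforce
      moreover have "a = b" if "a \<in> insert c Y" "b \<in> insert c Y" "adj i a" "adj i b" for a b
      proof (cases "adj i c")
        case True
        then show ?thesis using only_c that by metis
      next
        case False
        then have "a \<in> Y" "b \<in> Y" using that by auto
        then show ?thesis using Y(6) that by blast
      qed
      ultimately show ?thesis
        using Y(1,2) less.prems by (intro exI[of _ "insert c Y"] conjI ballI impI) blast+
    qed
  qed
  have child: "k = l" if c: "adj c k" "adj c l" "c \<noteq> i" "k \<noteq> par c" "l \<noteq> par c" for c k l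
  proof (rule ccontr)
    assume kl: "k \<noteq> l"
    have cS: "c \<in> S" "k \<in> S" "l \<in> S" using c adj_in by auto
    have ch: "k \<noteq> i" "par k = c" "l \<noteq> i" "par l = c" using edge[OF c(1)] edge[OF c(2)] c by auto
    from branch[OF cS(1)] obtain Y where Y: "Y \<subseteq> S" "i \<in> Y" "c \<in> Y" "q (ind Y) = 2" "\<forall>y\<in>Y. rk y \<le> rk c"
        "\<forall>a\<in>Y. \<forall>b\<in>Y. adj i a \<longrightarrow> adj i b \<longrightarrow> a = b"
      by (elim exE conjE)
    have "{par c, k, l} \<subseteq> {x. adj c x}" using par[OF cS(1) c(3)] c by auto
    from card_mono[OF finite_nbrs this] have "deg c \<ge> 3" using c kl by (simp add: deg_def)
    then have d3: "card {a. adj i a} \<ge> 3" using max[OF cS(1)] by (simp add: deg_def)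
    have "\<exists>z. {a. adj i a} \<inter> Y \<subseteq> {z}" using Y(6) by blast
    then obtain z where "{a. adj i a} \<inter> Y \<subseteq> {z}" ..
    from card_mono[OF _ this] have "card ({a. adj i a} \<inter> Y) \<le> 1" by simp
    moreover have "card ({a. adj i a} - Y) = card {a. adj i a} - card ({a. adj i a} \<inter> Y)"
      by (rule card_Diff_subset_Int) (use finite_nbrs in auto)
    ultimately have "card ({a. adj i a} - Y) \<ge> 2" using d3 by simp
    then obtain T where T: "T \<subseteq> {a. adj i a} - Y" "card T = 2" by (rule obtain_subset_with_card_n)
    then obtain a b where "T = {a, b}" "a \<noteq> b" by (auto simp: card_2_iff)
    with T(1) have ab: "adj i a" "a \<notin> Y" "adj i b" "b \<notin> Y" "a \<noteq> b" by auto
    have "rk c < rk k" "rk c < rk l" using par[of k] par[of l] ch cS by auto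
    then have "k \<notin> Y" "l \<notin> Y" using Y(5) by fastforce+
    moreover have "distinct [k, l, a, b]" using kl ab ch c(3) ni[of a] ni[of b] by auto
    moreover have "x \<in> S \<and> (\<exists>y\<in>Y. adj x y)" if "x \<in> {k, l, a, b}" for x
    proof -
      have "adj k c" "adj l c" "adj a i" "adj b i" using c(1,2) ab(1,3) adj_sym by blast+
      then show ?thesis using that Y(2,3) adj_in by blast
    qed
    ultimately show False
      by (intro no_affine_D[OF Y(1,4), of k l a b]) (use ab in auto)
  qed
  have "rooted S adj i par rk"
  proof
    show "k = l" if "adj j k" "adj j l" "j \<noteq> i" "k \<noteq> par j" "l \<noteq> par j" for j k l
      by (rule child[OF that])
  qed (fact i(1) par edge three)+
  then show ?thesis by (rule that)
qed

end

lemma fin_words_posgraph: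
  assumes "posgraph S adj"
  shows "fin_words S adj"
  using assms
proof (induction "card S" arbitrary: S adj rule: less_induct)
  case less
  interpret posgraph S adj by (rule less.prems)
  show ?case
  proof (cases "S = {}")
    case True
    then have "words_on S = {[]}" by (auto simp: words_on_def)
    then show ?thesis unfolding fin_words_def by (intro exI[of _ "{[]}"]) auto
  next
    case ne: False
    show ?thesis
    proof (cases "\<forall>X. X \<subseteq> S \<longrightarrow> X \<noteq> {} \<longrightarrow> X \<noteq> S \<longrightarrow> (\<exists>j\<in>X. \<exists>k\<in>S - X. adj j k)")
      case True
      obtain i par rk where "rooted S adj i par rk" by (rule rooted_exists[OF True ne])
      then interpret rooted S adj i par rk .
      have "posgraph dnodes dadj"
        using posdef_derived by unfold_locales
      then show ?thesis using less.hyps[OF card_derived] fin_words_rooted by blast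
    next
      case False
      then obtain X where X: "X \<subseteq> S" "X \<noteq> {}" "X \<noteq> S" "\<And>j k. j \<in> X \<Longrightarrow> k \<in> S - X \<Longrightarrow> \<not> adj j k" by blast
      have c: "card X < card S" "card (S - X) < card S"
        using X by (auto intro!: psubset_card_mono)
      have "fin_words X (\<lambda>x y. x \<in> X \<and> y \<in> X \<and> adj x y)"
        by (rule less.hyps[OF c(1) posgraph_restrict[OF posdef X(1)]])
      moreover have "fin_words (S - X) (\<lambda>x y. x \<in> S - X \<and> y \<in> S - X \<and> adj x y)"
        by (rule less.hyps[OF c(2) posgraph_restrict[OF posdef Diff_subset]])
      ultimately show ?thesis using X by (intro fin_words_Un[of X "S - X"]) auto
    qed
  qed
qed

section \<open>Spherical diagrams are positive definite\<close>

context graph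
begin

lemma refl_ext_sum:
  assumes "finite A"
  shows "refl k (\<lambda>l. \<Sum>a\<in>A. c a * f a l) = (\<lambda>l. \<Sum>a\<in>A. c a * refl k (f a) l)"
proof -
  have "ip (\<lambda>l. \<Sum>a\<in>A. c a * f a l) k = (\<Sum>a\<in>A. c a * ip (f a) k)"
    unfolding ip_def sum_distrib_left sum_distrib_right by (subst sum.swap) (simp add: mult.assoc)
  then show ?thesis by (auto simp: refl_apply sum_subtractf algebra_simps)
qed

text \<open>The exponents of the letters are forgotten, since a reflection is its own
  inverse.\<close>

lemma act_pres_cong:
  assumes "pres_cong S R u v"
    and rel: "\<And>r. r \<in> R \<Longrightarrow> r \<in> group_words S \<Longrightarrow> act (map fst r) = (\<lambda>x :: nat \<Rightarrow> real. x)"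
  shows "act (map fst u) = (act (map fst v) :: (nat \<Rightarrow> real) \<Rightarrow> nat \<Rightarrow> real)"
  using assms(1)
proof (induction rule: pres_cong.induct)
  case (pres_cong_cancel x b)
  then show ?case by (auto simp: refl_invol fun_eq_iff)
next
  case (pres_cong_mult u v u' v')
  then show ?case by (intro ext) simp
next
  case (pres_cong_relator r)
  then show ?case using rel by (auto simp: fun_eq_iff)
qed (auto simp: fun_eq_iff)

text \<open>
  A finite group generated by the reflections preserves an inner product. The reflections are
  orthogonal for it, so it determines the Cartan matrix up to a positive factor for each node that
  is constant along edges.
\<close>

lemma posdef_if_finite_orbit:
  assumes "finite ({act u |u. set u \<subseteq> S} :: ((nat \<Rightarrow> real) \<Rightarrow> nat \<Rightarrow> real) set)"
  shows "posdef"
proof -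
  let ?W = "{act u |u. set u \<subseteq> S} :: ((nat \<Rightarrow> real) \<Rightarrow> nat \<Rightarrow> real) set"
  define f where "f x y = (\<Sum>T\<in>?W. \<Sum>k\<in>S. T x k * T y k)" for x y :: "nat \<Rightarrow> real"
  have sym: "f x y = f y x" for x y unfolding f_def by (simp add: mult.commute)
  \<comment> \<open>Precomposition with a reflection permutes \<open>?W\<close>, which reindexes the
    sum.\<close>
  have inv: "f (refl j x) (refl j y) = f x y" if j: "j \<in> S" for j x y
    unfolding f_def
  proof (rule sum.reindex_bij_witness[of _ "\<lambda>T x. T (refl j x)" "\<lambda>T x. T (refl j x)"])
    fix T assume "T \<in> ?W"
    then obtain u where "set u \<subseteq> S" "T = act u" by blast
    then show "(\<lambda>x. T (refl j x)) \<in> ?W" using j by (intro CollectI exI[of _ "u @ [j]"]) auto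
    then show "(\<lambda>x. T (refl j x)) \<in> ?W" .
  qed (simp_all add: refl_invol[OF j])
  have lin: "T (\<lambda>l. \<Sum>a\<in>A. c a * g a l) = (\<lambda>l. \<Sum>a\<in>A. c a * T (g a) l)"
    if "T \<in> ?W" "finite A" for T A and c :: "nat \<Rightarrow> real" and g
  proof -
    obtain u where "T = act u" using \<open>T \<in> ?W\<close> by blast
    moreover have "act u (\<lambda>l. \<Sum>a\<in>A. c a * g a l) = (\<lambda>l. \<Sum>a\<in>A. c a * act u (g a) l)"
      by (induction u) (simp_all add: refl_ext_sum[OF \<open>finite A\<close>])
    ultimately show ?thesis by simp
  qed
  have bil: "f (\<lambda>l. \<Sum>a\<in>A. c a * g a l) y = (\<Sum>a\<in>A. c a * f (g a) y)" if "finite A"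
    for A and c :: "nat \<Rightarrow> real" and g y
  proof -
    have "f (\<lambda>l. \<Sum>a\<in>A. c a * g a l) y = (\<Sum>T\<in>?W. \<Sum>k\<in>S. \<Sum>a\<in>A. c a * (T (g a) k * T y k))"
      unfolding f_def by (intro sum.cong HOL.refl) (simp add: lin[OF _ that] sum_distrib_right mult.assoc)
    also have "\<dots> = (\<Sum>T\<in>?W. \<Sum>a\<in>A. \<Sum>k\<in>S. c a * (T (g a) k * T y k))"
      by (intro sum.cong HOL.refl sum.swap)
    also have "\<dots> = (\<Sum>a\<in>A. \<Sum>T\<in>?W. \<Sum>k\<in>S. c a * (T (g a) k * T y k))"
      by (rule sum.swap)
    finally show ?thesis by (simp add: f_def sum_distrib_left)
  qed
  have id: "(\<lambda>x. x) \<in> ?W" by (intro CollectI exI[of _ "[]"]) auto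
  \<comment> \<open>The term of the identity alone is the sum of squares, and all other terms are
    non-negative.\<close>
  have ge: "f x x \<ge> (\<Sum>k\<in>S. (x k)\<^sup>2)" for x
  proof -
    have "(\<lambda>T. \<Sum>k\<in>S. T x k * T x k) (\<lambda>x. x) \<le> (\<Sum>T\<in>?W. \<Sum>k\<in>S. T x k * T x k)"
      by (rule member_le_sum[OF id _ assms]) (simp add: sum_nonneg)
    then show ?thesis by (simp add: f_def power2_eq_square)
  qed
  let ?s = "simple :: nat \<Rightarrow> nat \<Rightarrow> real"
  define c where "c k = f (?s k) (?s k)" for k
  have c1: "c k \<ge> 1" if "k \<in> S" for k
  proof -
    have "(\<Sum>l\<in>S. (?s k l)\<^sup>2) = (\<Sum>l\<in>S. if l = k then 1 else 0)"
      by (rule sum.cong) (auto simp: simple_def)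
    then show ?thesis using ge[of "?s k"] that by (simp add: c_def)
  qed
  \<comment> \<open>\<open>refl j\<close> negates \<open>?s j\<close> and subtracts
    \<open>ip x j\<close> times it from \<open>x\<close>; invariance of \<open>f\<close> under
    \<open>refl j\<close> then gives the equation.\<close>
  have key: "ip x j * c j = 2 * f x (?s j)" if j: "j \<in> S" for x j
  proof -
    \<comment> \<open>A sum over two indices, so that \<open>bil\<close> applies.\<close>
    have r: "refl j x = (\<lambda>l. \<Sum>a\<in>{0,1::nat}. (if a = 0 then 1 else - ip x j) * (if a = 0 then x else ?s j) l)"
      by (auto simp: refl_apply simple_def)
    have "f (refl j x) (refl j (?s j)) = f x (?s j)" by (rule inv[OF j])
    moreover have m: "refl j (?s j) = (\<lambda>l. \<Sum>a\<in>{0::nat}. (-1) * ?s j l)"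
      using refl_simple_self[OF j, where ?'a = real] by simp
    moreover have "f (refl j x) y = f x y - ip x j * f (?s j) y" for y
      unfolding r by (subst bil) auto
    moreover have "f y (refl j (?s j)) = - f y (?s j)" for y
      unfolding m by (subst sym, subst bil) (auto simp: sym)
    ultimately show ?thesis by (simp add: c_def algebra_simps)
  qed
  \<comment> \<open>Using \<open>key\<close> in both orders shows that \<open>c\<close> agrees at
    the two ends of an edge, so the geometric mean equals either value.\<close>
  have sq: "cartan j k * (sqrt (c j) * sqrt (c k)) = 2 * f (?s j) (?s k)" if jk: "j \<in> S" "k \<in> S" for j k
  proof -
    have a: "cartan k j * c k = 2 * f (?s j) (?s k)" using key[OF jk(2), of "?s j"] ip_simple[OF jk(1), where ?'a = real] by simp
    have b: "cartan j k * c j = 2 * f (?s k) (?s j)" using key[OF jk(1), of "?s k"] ip_simple[OF jk(2), where ?'a = real] by simp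
    show ?thesis
    proof (cases "cartan j k = (0::real)")
      case True
      then show ?thesis using a cartan_sym[of j k, where ?'a = real] by simp
    next
      case False
      have "cartan j k * c j = cartan j k * c k"
        using a b sym[of "?s j" "?s k"] cartan_sym[of j k, where ?'a = real] by simp
      then have "c j = c k" using False by simp
      then show ?thesis using b c1[OF jk(2)] sym by simp
    qed
  qed
  have main: "(x k)\<^sup>2 \<le> c k * q x" if x: "k \<in> S" for x :: "nat \<Rightarrow> real" and k
  proof -
    \<comment> \<open>Dividing the coordinates by \<open>sqrt (c a)\<close> turns the Cartan form
      into twice the invariant form, by \<open>sq\<close>.\<close>
    define y where "y = (\<lambda>l. \<Sum>a\<in>S. (x a / sqrt (c a)) * ?s a l)"
    have yl: "y l = x l / sqrt (c l)" if "l \<in> S" for l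
      using that unfolding y_def simple_def by (simp add: if_distrib cong: if_cong)
    have "f y y = (\<Sum>a\<in>S. (x a / sqrt (c a)) * f (?s a) y)" unfolding y_def by (rule bil) simp
    also have "\<dots> = (\<Sum>a\<in>S. \<Sum>b\<in>S. (x a / sqrt (c a)) * ((x b / sqrt (c b)) * f (?s b) (?s a)))"
      unfolding y_def by (subst sym, subst bil) (simp_all add: sum_distrib_left)
    also have "2 * \<dots> = (\<Sum>a\<in>S. \<Sum>b\<in>S. x a * (x b * cartan a b))"
      unfolding sum_distrib_left
    proof (intro sum.cong HOL.refl)
      fix a b assume ab: "a \<in> S" "b \<in> S"
      have "2 * f (?s b) (?s a) = cartan a b * (sqrt (c a) * sqrt (c b))" using sq[OF ab] sym by simp
      moreover have "sqrt (c a) > 0" "sqrt (c b) > 0" using c1[OF ab(1)] c1[OF ab(2)] by auto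
      ultimately show "2 * (x a / sqrt (c a) * (x b / sqrt (c b) * f (?s b) (?s a))) = x a * (x b * cartan a b)"
        by (simp add: field_simps)
    qed
    also have "\<dots> = q x" by (simp add: q_def ip_def sum_distrib_left)
    finally have qf: "2 * f y y = q x" by simp
    have "(y k)\<^sup>2 \<le> (\<Sum>k\<in>S. (y k)\<^sup>2)" by (rule member_le_sum) (use x in auto)
    also have "\<dots> \<le> f y y" by (rule ge)
    also have "\<dots> \<le> q x"
      using qf ge[of y] sum_nonneg[of S "\<lambda>k. (y k)\<^sup>2"] by simp
    finally have "(x k)\<^sup>2 / c k \<le> q x" using yl[OF x] c1[OF x] by (simp add: power_divide)
    then show ?thesis using c1[OF x] by (simp add: field_simps)
  qed
  define C where "C = Max (insert 0 (c ` S))"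
  have C: "c k \<le> C" if "k \<in> S" for k unfolding C_def using that by (intro Max_ge) auto
  have C0: "C \<ge> 0" unfolding C_def by (intro Max_ge) auto
  \<comment> \<open>An integer constant is required. Enlarging \<open>c k\<close> to it needs
    \<open>q x\<close> to be non-negative, which follows from the real inequality itself.\<close>
  have "(x k)\<^sup>2 \<le> \<lceil>C\<rceil> * q x" if k: "k \<in> S" for x :: "nat \<Rightarrow> int" and k
  proof -
    have q: "real_of_int (q x) = q (\<lambda>k. real_of_int (x k))"
      by (auto simp: q_def ip_def cartan_def intro!: sum.cong)
    have m: "(real_of_int (x k))\<^sup>2 \<le> c k * real_of_int (q x)" unfolding q by (rule main[OF k])
    then have "0 \<le> c k * real_of_int (q x)" by (rule order_trans[rotated]) simp
    then have "0 \<le> real_of_int (q x)" using c1[OF k] by (simp add: zero_le_mult_iff)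
    then have "c k * real_of_int (q x) \<le> real_of_int \<lceil>C\<rceil> * real_of_int (q x)"
      using C[OF k] by (intro mult_right_mono) linarith+
    then have "real_of_int ((x k)\<^sup>2) \<le> real_of_int (\<lceil>C\<rceil> * q x)" using m by simp
    then show ?thesis by (simp only: of_int_le_iff)
  qed
  then show ?thesis unfolding posdef_def using C0 by (intro exI[of _ "\<lceil>C\<rceil>"]) auto
qed

end

lemma posgraph_spherical:
  assumes "simply_laced_diagram n adj" "spherical n adj"
  shows "posgraph (nodes n) adj"
proof -
  interpret graph "nodes n" adj
    using assms(1) by unfold_locales (auto simp: simply_laced_diagram_def nodes_def)
  let ?R = "coxeter_relators n adj"
  let ?act = "act :: nat list \<Rightarrow> (nat \<Rightarrow> real) \<Rightarrow> nat \<Rightarrow> real"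
  have rel: "?act (map fst r) = (\<lambda>x. x)" if r: "r \<in> ?R" for r
  proof -
    obtain i j where ij: "i \<in> nodes n" "j \<in> nodes n"
        "r = concat (replicate (coxeter_matrix adj i j) [(i, True), (j, True)])"
      using r unfolding coxeter_relators_def by blast
    consider "i = j" | "adj i j" | "i \<noteq> j" "\<not> adj i j" by blast
    then show ?thesis
    proof cases
      case 1
      then show ?thesis using ij by (auto simp: coxeter_matrix_def refl_invol)
    next
      case 2
      then have "i \<noteq> j" by auto
      then show ?thesis
        using ij 2 refl_braid[OF 2, where ?'a = real]
        by (intro ext) (simp add: coxeter_matrix_def refl_invol numeral_eq_Suc)
    next
      case 3
      then show ?thesis
        using ij refl_comm[OF ij(1,2) 3(2), where ?'a = real]
        by (intro ext) (simp add: coxeter_matrix_def refl_invol numeral_eq_Suc)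
    qed
  qed
  \<comment> \<open>By \<open>act_pres_cong\<close> any representative of a class acts in the same
    way, so all actions of words form an image of the finite Coxeter group.\<close>
  define h where "h A = ?act (map fst (SOME w. w \<in> A))" for A :: "(nat \<times> bool) list set"
  have "{?act u |u. set u \<subseteq> nodes n} \<subseteq> h ` carrier (coxeter_group n adj)"
  proof clarify
    fix u assume u: "set u \<subseteq> nodes n"
    let ?w = "map (\<lambda>k. (k, True)) u" and ?X = "nodes n"
    have w: "?w \<in> group_words ?X" using u by (auto simp: group_words_def)
    let ?A = "pres_class ?X ?R ?w"
    have "?w \<in> ?A" using pres_cong_refl[OF w] by (simp add: pres_class_def)
    then have "(SOME w. w \<in> ?A) \<in> ?A" by (rule someI)
    then have "pres_cong ?X ?R ?w (SOME w. w \<in> ?A)" by (simp add: pres_class_def)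
    then have "?act (map fst ?w) = h ?A" unfolding h_def by (rule act_pres_cong) (rule rel)
    moreover have "map fst ?w = u" by (simp add: comp_def)
    ultimately have "?act u = h ?A" by simp
    moreover have "?A \<in> carrier (coxeter_group n adj)"
      using w by (simp add: coxeter_group_def presented_group_def)
    ultimately show "?act u \<in> h ` carrier (coxeter_group n adj)" by blast
  qed
  then have "finite {?act u |u. set u \<subseteq> nodes n}"
    using assms(2) finite_subset unfolding spherical_def by blast
  then have "posdef" by (rule posdef_if_finite_orbit)
  then show ?thesis by unfold_locales
qed

section \<open>Algebras satisfying the BMW relations\<close>

text \<open>The quotient enters only through central scalars and the relations. The parameter
  \<open>m\<close> is inverted to express \<open>e i\<close> by \<open>g i\<close>, \<open>x\<close>
  is the factor in \<open>mult_ee\<close> and must be non-zero for \<open>idem\<close>, and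
  \<open>m * l + 1\<close> is cancelled in \<open>mult_eee\<close>.\<close>

locale bmw_ring = ring R for R (structure) +
  fixes s :: "'k::field \<Rightarrow> 'a" and g e :: "nat \<Rightarrow> 'a" and S :: "nat set" and adj :: "nat \<Rightarrow> nat \<Rightarrow> bool"
    and l m x :: 'k
  assumes s_closed [simp]: "s c \<in> carrier R"
    and s_add: "s (c + d) = s c \<oplus> s d"
    and s_mult: "s (c * d) = s c \<otimes> s d"
    and s_one: "s 1 = \<one>"
    and s_central: "y \<in> carrier R \<Longrightarrow> y \<otimes> s c = s c \<otimes> y"
    and g_closed [simp]: "i \<in> S \<Longrightarrow> g i \<in> carrier R"
    and e_closed [simp]: "i \<in> S \<Longrightarrow> e i \<in> carrier R"
    and params: "l \<noteq> 0" "m \<noteq> 0" "x \<noteq> 0" "m * l + 1 \<noteq> 0" "m * x = m - l + inverse l"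
    and adj_in: "adj i j \<Longrightarrow> i \<in> S \<and> j \<in> S"
    and adj_sym: "adj i j \<Longrightarrow> adj j i"
    and B1: "i \<in> S \<Longrightarrow> j \<in> S \<Longrightarrow> \<not> adj i j \<Longrightarrow> g i \<otimes> g j = g j \<otimes> g i"
    and B2: "adj i j \<Longrightarrow> g i \<otimes> (g j \<otimes> g i) = g j \<otimes> (g i \<otimes> g j)"
    and D1: "i \<in> S \<Longrightarrow> s m \<otimes> e i = s l \<otimes> (g i \<otimes> g i \<oplus> s m \<otimes> g i \<oplus> s (-1))"
    and R1: "i \<in> S \<Longrightarrow> g i \<otimes> e i = s (inverse l) \<otimes> e i"
    and R2: "adj i j \<Longrightarrow> e i \<otimes> (g j \<otimes> e i) = s l \<otimes> e i"
begin

definition smul :: "'k \<Rightarrow> 'a \<Rightarrow> 'a" (infixr "\<bullet>" 75) where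
  "c \<bullet> y = s c \<otimes> y"

lemma s_zero: "s 0 = \<zero>"
proof -
  have "s 0 \<oplus> s 0 = s 0" using s_add[of 0 0] by simp
  then have "\<ominus> s 0 \<oplus> (s 0 \<oplus> s 0) = \<ominus> s 0 \<oplus> s 0" by simp
  then show ?thesis by (simp add: r_neg1 l_neg)
qed

lemma smul_closed [simp]: "y \<in> carrier R \<Longrightarrow> c \<bullet> y \<in> carrier R"
  by (simp add: smul_def)

lemma smul_rules:
  "y \<in> carrier R \<Longrightarrow> z \<in> carrier R \<Longrightarrow> c \<bullet> (y \<oplus> z) = c \<bullet> y \<oplus> c \<bullet> z"
  "y \<in> carrier R \<Longrightarrow> z \<in> carrier R \<Longrightarrow> (c \<bullet> y) \<otimes> z = c \<bullet> (y \<otimes> z)"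
  "y \<in> carrier R \<Longrightarrow> z \<in> carrier R \<Longrightarrow> y \<otimes> (c \<bullet> z) = c \<bullet> (y \<otimes> z)"
  "y \<in> carrier R \<Longrightarrow> c \<bullet> d \<bullet> y = (c * d) \<bullet> y"
  "y \<in> carrier R \<Longrightarrow> 1 \<bullet> y = y"
  "y \<in> carrier R \<Longrightarrow> 0 \<bullet> y = \<zero>"
  "c \<bullet> \<zero> = \<zero>"
proof -
  assume yz: "y \<in> carrier R" "z \<in> carrier R"
  have "y \<otimes> (s c \<otimes> z) = (y \<otimes> s c) \<otimes> z" using yz by (simp add: m_assoc)
  also have "\<dots> = s c \<otimes> (y \<otimes> z)" using yz by (simp add: s_central m_assoc)
  finally show "y \<otimes> (c \<bullet> z) = c \<bullet> (y \<otimes> z)" by (simp add: smul_def)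
qed (simp_all add: smul_def r_distr m_assoc s_mult s_one s_zero)

lemma smul_add: "y \<in> carrier R \<Longrightarrow> c \<bullet> y \<oplus> d \<bullet> y = (c + d) \<bullet> y"
  by (simp add: smul_def s_add l_distr)

lemma smul_add3: "y \<in> carrier R \<Longrightarrow> z \<in> carrier R \<Longrightarrow> c \<bullet> y \<oplus> (d \<bullet> y \<oplus> z) = (c + d) \<bullet> y \<oplus> z"
  by (simp add: a_assoc[symmetric] smul_add)

lemma smul_minus: "y \<in> carrier R \<Longrightarrow> \<ominus> y = (-1) \<bullet> y"
proof -
  assume y: "y \<in> carrier R"
  have "(-1) \<bullet> y \<oplus> y = (-1 + 1) \<bullet> y" using smul_add[OF y, of "-1" 1] by (simp add: smul_rules y)
  then show ?thesis using y by (simp add: smul_rules minus_equality)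
qed

lemma smul_cancel: "c \<noteq> 0 \<Longrightarrow> y \<in> carrier R \<Longrightarrow> z \<in> carrier R \<Longrightarrow> c \<bullet> y = c \<bullet> z \<Longrightarrow> y = z"
proof -
  assume a: "c \<noteq> 0" "y \<in> carrier R" "z \<in> carrier R" "c \<bullet> y = c \<bullet> z"
  have "(inverse c * c) \<bullet> y = inverse c \<bullet> c \<bullet> y" using a(2) by (simp only: smul_rules(4))
  also have "\<dots> = (inverse c * c) \<bullet> z" unfolding a(4) using a(3) by (simp only: smul_rules(4))
  finally show ?thesis using a(1-3) by (simp add: smul_rules(5))
qed

text \<open>This is (D1) solved for \<open>e i\<close>. As a polynomial in \<open>g i\<close>, it
  inherits the commutation and conjugation rules of \<open>g i\<close>.\<close>

lemma e_poly: "i \<in> S \<Longrightarrow> e i = (l / m) \<bullet> (g i \<otimes> g i) \<oplus> (l \<bullet> g i \<oplus> (- (l / m)) \<bullet> \<one>)"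
proof -
  assume i: "i \<in> S"
  have "m \<bullet> e i = l \<bullet> (g i \<otimes> g i \<oplus> m \<bullet> g i \<oplus> (-1) \<bullet> \<one>)" using D1[OF i] by (simp add: smul_def)
  then have "inverse m \<bullet> m \<bullet> e i = inverse m \<bullet> l \<bullet> (g i \<otimes> g i \<oplus> m \<bullet> g i \<oplus> (-1) \<bullet> \<one>)" by simp
  then show ?thesis using i params by (simp add: smul_rules a_assoc field_simps)
qed

lemma g_square: "i \<in> S \<Longrightarrow> g i \<otimes> g i = \<one> \<oplus> ((- m) \<bullet> g i \<oplus> (m / l) \<bullet> e i)"
proof -
  assume i: "i \<in> S"
  have "(m / l) \<bullet> e i = (m / l) \<bullet> ((l / m) \<bullet> (g i \<otimes> g i) \<oplus> (l \<bullet> g i \<oplus> (- (l / m)) \<bullet> \<one>))"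
    using e_poly[OF i] by simp
  also have "\<dots> = g i \<otimes> g i \<oplus> (m \<bullet> g i \<oplus> (-1) \<bullet> \<one>)"
    using i params by (simp add: smul_rules)
  finally have "\<one> \<oplus> ((- m) \<bullet> g i \<oplus> (m / l) \<bullet> e i) =
      \<one> \<oplus> ((- m) \<bullet> g i \<oplus> (g i \<otimes> g i \<oplus> (m \<bullet> g i \<oplus> (-1) \<bullet> \<one>)))" by simp
  also have "\<dots> = (g i \<otimes> g i) \<oplus> (((- m) \<bullet> g i \<oplus> m \<bullet> g i) \<oplus> (1 \<bullet> \<one> \<oplus> (-1) \<bullet> \<one>))"
    using i by (simp add: a_ac smul_rules(5))
  also have "\<dots> = g i \<otimes> g i"
    using i by (simp only: smul_add g_closed one_closed) (simp add: smul_rules)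
  finally show ?thesis by simp
qed

lemma e_comm:
  assumes "i \<in> S" "y \<in> carrier R" "y \<otimes> g i = g i \<otimes> y"
  shows "y \<otimes> e i = e i \<otimes> y"
proof -
  have "y \<otimes> (g i \<otimes> g i) = (g i \<otimes> g i) \<otimes> y"
    using assms by (simp add: m_assoc[symmetric]) (simp add: m_assoc)
  then show ?thesis unfolding e_poly[OF assms(1)] using assms
    by (simp add: r_distr l_distr smul_rules)
qed

lemma mult_eg: "i \<in> S \<Longrightarrow> e i \<otimes> g i = inverse l \<bullet> e i"
  using e_comm[of i "g i"] R1[of i] by (simp add: smul_def)

lemma mult_ge: "i \<in> S \<Longrightarrow> g i \<otimes> e i = inverse l \<bullet> e i"
  using R1[of i] by (simp add: smul_def)

lemma mult_ee: "i \<in> S \<Longrightarrow> e i \<otimes> e i = x \<bullet> e i"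
proof -
  assume i: "i \<in> S"
  have "e i \<otimes> e i = ((l / m) \<bullet> (g i \<otimes> g i) \<oplus> (l \<bullet> g i \<oplus> (- (l / m)) \<bullet> \<one>)) \<otimes> e i"
    using e_poly[OF i] by simp
  also have "\<dots> = (l / m) \<bullet> (g i \<otimes> (g i \<otimes> e i)) \<oplus> (l \<bullet> (g i \<otimes> e i) \<oplus> (- (l / m)) \<bullet> e i)"
    using i by (simp add: l_distr smul_rules m_assoc)
  also have "\<dots> = ((l / m) * (inverse l * inverse l) + (l * inverse l + - (l / m))) \<bullet> e i"
    using i by (simp add: mult_ge smul_rules smul_add)
  \<comment> \<open>Both sides equal 1 - (l - inverse l) / m.\<close>
  also have "(l / m) * (inverse l * inverse l) + (l * inverse l + - (l / m)) = x"
    using params by (simp add: field_simps)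
  finally show ?thesis .
qed

text \<open>The inverse of \<open>g i\<close>, found by absorbing the \<open>e i\<close> of
  \<open>g_square\<close> into a multiple of \<open>g i\<close> through
  \<open>mult_ge\<close>.\<close>

definition gi :: "nat \<Rightarrow> 'a" where
  "gi i = g i \<oplus> (m \<bullet> \<one> \<oplus> (- m) \<bullet> e i)"

lemma gi_closed [simp]: "i \<in> S \<Longrightarrow> gi i \<in> carrier R"
  by (simp add: gi_def)

lemma gi_inv: "i \<in> S \<Longrightarrow> g i \<otimes> gi i = \<one>" "i \<in> S \<Longrightarrow> gi i \<otimes> g i = \<one>"
proof -
  assume i: "i \<in> S"
  have z: "(m / l) \<bullet> e i \<oplus> (- (m / l)) \<bullet> e i = \<zero>" "(- m) \<bullet> g i \<oplus> m \<bullet> g i = \<zero>"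
    using i by (simp_all add: smul_add smul_rules)
  have "\<one> \<oplus> ((- m) \<bullet> g i \<oplus> (m / l) \<bullet> e i) \<oplus> (m \<bullet> g i \<oplus> (- (m / l)) \<bullet> e i) =
    \<one> \<oplus> (((- m) \<bullet> g i \<oplus> m \<bullet> g i) \<oplus> ((m / l) \<bullet> e i \<oplus> (- (m / l)) \<bullet> e i))"
    using i by (simp add: a_ac)
  then have c: "\<one> \<oplus> ((- m) \<bullet> g i \<oplus> (m / l) \<bullet> e i) \<oplus> (m \<bullet> g i \<oplus> (- (m / l)) \<bullet> e i) = \<one>"
    unfolding z by simp
  have "g i \<otimes> gi i = g i \<otimes> g i \<oplus> (m \<bullet> g i \<oplus> (- (m / l)) \<bullet> e i)"
    unfolding gi_def using i by (simp add: r_distr smul_rules mult_ge field_simps)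
  then show "g i \<otimes> gi i = \<one>" using c g_square[OF i] by simp
  have "gi i \<otimes> g i = g i \<otimes> g i \<oplus> (m \<bullet> g i \<oplus> (- (m / l)) \<bullet> e i)"
    unfolding gi_def using i by (simp add: l_distr smul_rules mult_eg field_simps)
  then show "gi i \<otimes> g i = \<one>" using c g_square[OF i] by simp
qed

lemma gi_cancel:
  "i \<in> S \<Longrightarrow> y \<in> carrier R \<Longrightarrow> g i \<otimes> (gi i \<otimes> y) = y"
  "i \<in> S \<Longrightarrow> y \<in> carrier R \<Longrightarrow> gi i \<otimes> (g i \<otimes> y) = y"
  by (simp_all add: m_assoc[symmetric] gi_inv)

lemma e_gi: "i \<in> S \<Longrightarrow> e i \<otimes> gi i = l \<bullet> e i"
proof -
  assume i: "i \<in> S"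
  have "e i = l \<bullet> (e i \<otimes> g i)" using i params by (simp add: mult_eg smul_rules)
  then have "e i \<otimes> gi i = l \<bullet> ((e i \<otimes> g i) \<otimes> gi i)" using i smul_rules(2) by (metis e_closed g_closed gi_closed m_closed)
  then show ?thesis using i by (simp add: m_assoc gi_inv)
qed

lemma mult_ege: "adj i j \<Longrightarrow> e i \<otimes> (g j \<otimes> e i) = l \<bullet> e i"
  using R2[of i j] by (simp add: smul_def)

text \<open>Conjugation by \<open>g\<^sub>j g\<^sub>i\<close> takes \<open>g\<^sub>j\<close> to \<open>g\<^sub>i\<close>, hence \<open>e\<^sub>j\<close> to \<open>e\<^sub>i\<close>.\<close>

lemma gge_egg: "adj i j \<Longrightarrow> g j \<otimes> (g i \<otimes> e j) = e i \<otimes> (g j \<otimes> g i)"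
proof -
  assume ij: "adj i j"
  then have S: "i \<in> S" "j \<in> S" using adj_in by auto
  have b: "g j \<otimes> (g i \<otimes> g j) = g i \<otimes> (g j \<otimes> g i)" using B2[OF ij] by simp
  have "g j \<otimes> (g i \<otimes> (g j \<otimes> g j)) = (g j \<otimes> (g i \<otimes> g j)) \<otimes> g j" using S by (simp add: m_assoc)
  also have "\<dots> = g i \<otimes> (g j \<otimes> (g i \<otimes> g j))" by (subst b) (use S in \<open>simp add: m_assoc\<close>)
  also have "\<dots> = g i \<otimes> (g i \<otimes> (g j \<otimes> g i))" unfolding b ..
  finally have b2: "g j \<otimes> (g i \<otimes> (g j \<otimes> g j)) = g i \<otimes> (g i \<otimes> (g j \<otimes> g i))" .
  show ?thesis
    unfolding e_poly[OF S(1)] e_poly[OF S(2)] using S by (simp add: r_distr l_distr smul_rules b b2 m_assoc)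
qed

text \<open>By \<open>gge_egg\<close> the left side is \<open>e i\<close> times \<open>g j\<close>
  times \<open>g i\<close> times \<open>e i\<close>; the scalars \<open>inverse l\<close> from
  \<open>mult_ge\<close> and \<open>l\<close> from \<open>mult_ege\<close> cancel.\<close>

lemma gg_ee: "adj i j \<Longrightarrow> g j \<otimes> (g i \<otimes> (e j \<otimes> e i)) = e i"
proof -
  assume ij: "adj i j"
  then have S: "i \<in> S" "j \<in> S" using adj_in by auto
  have "g j \<otimes> (g i \<otimes> (e j \<otimes> e i)) = (g j \<otimes> (g i \<otimes> e j)) \<otimes> e i" using S by (simp add: m_assoc)
  also have "\<dots> = e i \<otimes> (g j \<otimes> (g i \<otimes> e i))" unfolding gge_egg[OF ij] using S by (simp add: m_assoc)
  also have "\<dots> = e i" using S params by (simp add: mult_ge mult_ege[OF ij] smul_rules)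
  finally show ?thesis .
qed

lemma ee_gg: "adj i j \<Longrightarrow> e i \<otimes> (e j \<otimes> (g i \<otimes> g j)) = e i"
proof -
  assume ij: "adj i j"
  then have S: "i \<in> S" "j \<in> S" using adj_in by auto
  have "e i \<otimes> (e j \<otimes> (g i \<otimes> g j)) = (e i \<otimes> g i) \<otimes> (g j \<otimes> e i)"
    using gge_egg[OF adj_sym[OF ij]] S by (simp add: m_assoc)
  also have "\<dots> = e i" using S params by (simp add: mult_eg mult_ege[OF ij] smul_rules)
  finally show ?thesis .
qed

text \<open>\<open>gg_ee\<close> multiplied by the inverse of \<open>g j\<close>. Since
  \<open>gi j\<close> is \<open>g j\<close> plus terms without a letter \<open>g\<close>, this is
  the source of \<open>gee\<close>.\<close>

lemma mult_gee: "adj i j \<Longrightarrow> g i \<otimes> (e j \<otimes> e i) = gi j \<otimes> e i"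
proof -
  assume ij: "adj i j"
  then have S: "i \<in> S" "j \<in> S" using adj_in by auto
  have "g i \<otimes> (e j \<otimes> e i) = gi j \<otimes> (g j \<otimes> (g i \<otimes> (e j \<otimes> e i)))" using S by (simp add: gi_cancel)
  then show ?thesis unfolding gg_ee[OF ij] .
qed

lemma mult_eeg: "adj i j \<Longrightarrow> e i \<otimes> (e j \<otimes> g i) = e i \<otimes> gi j"
proof -
  assume ij: "adj i j"
  then have S: "i \<in> S" "j \<in> S" using adj_in by auto
  have "e i \<otimes> gi j = (e i \<otimes> (e j \<otimes> (g i \<otimes> g j))) \<otimes> gi j" unfolding ee_gg[OF ij] ..
  then show ?thesis using S by (simp add: m_assoc gi_inv)
qed

text \<open>Inserting \<open>gi i\<close> and \<open>g i\<close> turns the product into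
  \<open>l\<close> times \<open>e i\<close>, \<open>gi j\<close>, \<open>e i\<close>. Expanding
  \<open>gi j\<close> brings the product back, which leaves a linear equation for it.\<close>

lemma mult_eee: "adj i j \<Longrightarrow> e i \<otimes> (e j \<otimes> e i) = e i"
proof -
  assume ij: "adj i j"
  then have S: "i \<in> S" "j \<in> S" using adj_in by auto
  let ?y = "e i \<otimes> (e j \<otimes> e i)"
  have "?y = e i \<otimes> (gi i \<otimes> (g i \<otimes> (e j \<otimes> e i)))" using S by (simp add: gi_cancel)
  also have "\<dots> = (e i \<otimes> gi i) \<otimes> (gi j \<otimes> e i)" unfolding mult_gee[OF ij] using S by (simp add: m_assoc)
  also have "\<dots> = l \<bullet> (e i \<otimes> (gi j \<otimes> e i))" using S by (simp add: e_gi smul_rules)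
  also have "e i \<otimes> (gi j \<otimes> e i) = l \<bullet> e i \<oplus> ((m * x) \<bullet> e i \<oplus> (- m) \<bullet> ?y)"
    unfolding gi_def using S by (simp add: l_distr r_distr smul_rules mult_ee mult_ege[OF ij])
  also have "l \<bullet> (l \<bullet> e i \<oplus> ((m * x) \<bullet> e i \<oplus> (- m) \<bullet> ?y)) = (l * (l + m * x)) \<bullet> e i \<oplus> (- (l * m)) \<bullet> ?y"
    using S by (simp add: smul_rules smul_add smul_add3 distrib_left)
  finally have y: "?y = (l * (l + m * x)) \<bullet> e i \<oplus> (- (l * m)) \<bullet> ?y" .
  have "(m * l + 1) \<bullet> ?y = (l * m) \<bullet> ?y \<oplus> ?y"
    using smul_add[of ?y "l * m" 1] S by (simp add: smul_rules(5) mult.commute)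
  also have "\<dots> = (l * m) \<bullet> ?y \<oplus> ((l * (l + m * x)) \<bullet> e i \<oplus> (- (l * m)) \<bullet> ?y)"
    by (rule arg_cong[OF y])
  also have "\<dots> = ((l * m) \<bullet> ?y \<oplus> (- (l * m)) \<bullet> ?y) \<oplus> (l * (l + m * x)) \<bullet> e i"
    using S by (simp add: a_ac)
  also have "\<dots> = (l * (l + m * x)) \<bullet> e i" using S by (simp add: smul_add smul_rules(6))
  \<comment> \<open>By the relation between the parameters, both sides of the equation have the same
    coefficient, and it is invertible.\<close>
  also have "l * (l + m * x) = m * l + 1" unfolding params(5) using params(1) by (simp add: field_simps)
  finally have "(m * l + 1) \<bullet> ?y = (m * l + 1) \<bullet> e i" .
  then show ?thesis by (rule smul_cancel[OF params(4), rotated 2]) (use S in simp_all)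
qed

text \<open>\<open>gg_ee\<close> with the two nodes exchanged, multiplied by \<open>e i\<close> and
  contracted by \<open>mult_eee\<close>.\<close>

lemma mult_gge: "adj i j \<Longrightarrow> g i \<otimes> (g j \<otimes> e i) = e j \<otimes> e i"
proof -
  assume ij: "adj i j"
  then have S: "i \<in> S" "j \<in> S" and ji: "adj j i" using adj_in adj_sym by auto
  have "e j \<otimes> e i = (g i \<otimes> (g j \<otimes> (e i \<otimes> e j))) \<otimes> e i" unfolding gg_ee[OF ji] ..
  also have "\<dots> = g i \<otimes> (g j \<otimes> (e i \<otimes> (e j \<otimes> e i)))" using S by (simp add: m_assoc)
  finally show ?thesis unfolding mult_eee[OF ij] by simp
qed

lemma mult_egg: "adj i j \<Longrightarrow> e i \<otimes> (g j \<otimes> g i) = e i \<otimes> e j"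
  using gge_egg[of i j] mult_gge[of j i] adj_sym by simp

end

section \<open>Evaluation of words and the filtration by height\<close>

context bmw_ring
begin

text \<open>Linear span of a possibly infinite set, available also when the scalars do not form a
  field in the algebra; it is compared with \<open>Span\<close> of a finite list only at the
  end.\<close>

inductive_set lin :: "'a set \<Rightarrow> 'a set" for X where
  zero: "\<zero> \<in> lin X"
| step: "w \<in> X \<Longrightarrow> v \<in> lin X \<Longrightarrow> c \<bullet> w \<oplus> v \<in> lin X"

lemma lin_carrier: "X \<subseteq> carrier R \<Longrightarrow> y \<in> lin X \<Longrightarrow> y \<in> carrier R"
  by (rotate_tac 1, induction rule: lin.induct) auto

lemma lin_add: "y \<in> lin X \<Longrightarrow> z \<in> lin X \<Longrightarrow> X \<subseteq> carrier R \<Longrightarrow> y \<oplus> z \<in> lin X"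
proof (induction rule: lin.induct)
  case (step w v c)
  then have "w \<in> carrier R" "v \<in> carrier R" "z \<in> carrier R" using lin_carrier by auto
  then show ?case using lin.step[OF step(1) step.IH[OF step.prems], of c] by (simp add: a_assoc)
qed (simp add: lin_carrier)

lemma lin_image:
  assumes "y \<in> lin X" "X \<subseteq> carrier R"
    and f: "\<And>a b c. a \<in> carrier R \<Longrightarrow> b \<in> carrier R \<Longrightarrow> f (c \<bullet> a \<oplus> b) = c \<bullet> f a \<oplus> f b" "f \<zero> = \<zero>"
    and "\<And>w. w \<in> X \<Longrightarrow> f w \<in> Y"
  shows "f y \<in> lin Y"
  using assms(1)
proof (induction rule: lin.induct)
  case (step w v c)
  then have "f (c \<bullet> w \<oplus> v) = c \<bullet> f w \<oplus> f v" using assms(2) lin_carrier by (intro f) auto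
  then show ?case using lin.step[OF assms(5)[OF step(1)] step.IH] by simp
qed (simp add: f lin.zero)

lemma lin_base: "w \<in> X \<Longrightarrow> X \<subseteq> carrier R \<Longrightarrow> w \<in> lin X"
  using lin.step[OF _ lin.zero, of w X 1] by (auto simp: smul_rules subsetD)

lemma lin_smul: "y \<in> lin X \<Longrightarrow> X \<subseteq> carrier R \<Longrightarrow> c \<bullet> y \<in> lin X"
proof (induction rule: lin.induct)
  case (step w v d)
  then have "w \<in> carrier R" "v \<in> carrier R" using lin_carrier by auto
  then have "c \<bullet> (d \<bullet> w \<oplus> v) = (c * d) \<bullet> w \<oplus> c \<bullet> v" by (simp add: smul_rules)
  then show ?case using lin.step step by simp
qed (simp add: smul_rules lin.zero)

lemma lin_lin: "y \<in> lin X \<Longrightarrow> X \<subseteq> lin Y \<Longrightarrow> Y \<subseteq> carrier R \<Longrightarrow> y \<in> lin Y"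
  by (induction rule: lin.induct) (auto intro: lin.zero lin_add lin_smul)

fun val :: "gen \<Rightarrow> 'a" where
  "val (GenG i) = g i"
| "val (GenE i) = e i"

definition eval :: "gen list \<Rightarrow> 'a" where
  "eval u = foldr (\<lambda>a b. val a \<otimes> b) u \<one>"

definition low :: "nat \<Rightarrow> 'a set" where
  "low h = lin (eval ` {w \<in> words_on S. height w < h})"

lemma eval_simps [simp]: "eval [] = \<one>" "eval (a # u) = val a \<otimes> eval u"
  by (simp_all add: eval_def)

lemma val_closed [simp]: "gen_node a \<in> S \<Longrightarrow> val a \<in> carrier R"
  by (cases a) auto

lemma eval_closed [simp]: "u \<in> words_on S \<Longrightarrow> eval u \<in> carrier R"
  by (induction u) auto

lemma eval_append: "u \<in> words_on S \<Longrightarrow> v \<in> words_on S \<Longrightarrow> eval (u @ v) = eval u \<otimes> eval v"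
  by (induction u) (auto simp: m_assoc)

lemma low_gens: "eval ` {w \<in> words_on S. height w < h} \<subseteq> carrier R"
  by auto

lemma low_closed [simp]: "y \<in> low h \<Longrightarrow> y \<in> carrier R"
  unfolding low_def by (rule lin_carrier[OF low_gens])

lemma low_base: "w \<in> words_on S \<Longrightarrow> height w < h \<Longrightarrow> eval w \<in> low h"
  unfolding low_def by (rule lin_base[OF _ low_gens]) auto

lemma low_add: "y \<in> low h \<Longrightarrow> z \<in> low h \<Longrightarrow> y \<oplus> z \<in> low h"
  unfolding low_def by (rule lin_add[OF _ _ low_gens])

lemma low_smul: "y \<in> low h \<Longrightarrow> c \<bullet> y \<in> low h"
  unfolding low_def by (rule lin_smul[OF _ low_gens])

lemma low_zero: "\<zero> \<in> low h"
  unfolding low_def by (rule lin.zero)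

lemma low_mult_right: "y \<in> low h \<Longrightarrow> v \<in> words_on S \<Longrightarrow> y \<otimes> eval v \<in> low (h + height v)"
  unfolding low_def
proof (erule lin_image[OF _ low_gens])
  fix w assume "v \<in> words_on S" "w \<in> eval ` {w \<in> words_on S. height w < h}"
  then obtain u where "u \<in> words_on S" "height u < h" "w = eval u" by blast
  then show "w \<otimes> eval v \<in> eval ` {w \<in> words_on S. height w < h + height v}"
    using \<open>v \<in> words_on S\<close> by (intro image_eqI[of _ _ "u @ v"]) (auto simp: eval_append)
qed (simp_all add: l_distr smul_rules)

lemma low_mult_left: "y \<in> low h \<Longrightarrow> v \<in> words_on S \<Longrightarrow> eval v \<otimes> y \<in> low (height v + h)"
  unfolding low_def
proof (erule lin_image[OF _ low_gens])
  fix w assume "v \<in> words_on S" "w \<in> eval ` {w \<in> words_on S. height w < h}"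
  then obtain u where "u \<in> words_on S" "height u < h" "w = eval u" by blast
  then show "eval v \<otimes> w \<in> eval ` {w \<in> words_on S. height w < height v + h}"
    using \<open>v \<in> words_on S\<close> by (intro image_eqI[of _ _ "v @ u"]) (auto simp: eval_append)
qed (simp_all add: r_distr smul_rules)

text \<open>The scalar is non-zero so that the relation can be reversed.\<close>

definition similar :: "gen list \<Rightarrow> gen list \<Rightarrow> bool" where
  "similar u v \<longleftrightarrow> (\<exists>c y. c \<noteq> 0 \<and> y \<in> low (height u) \<and> eval u = c \<bullet> eval v \<oplus> y)"

lemma similarI: "c \<noteq> 0 \<Longrightarrow> y \<in> low (height u) \<Longrightarrow> eval u = c \<bullet> eval v \<oplus> y \<Longrightarrow> similar u v"
  unfolding similar_def by blast

lemma similar_eq: "v \<in> words_on S \<Longrightarrow> eval u = eval v \<Longrightarrow> similar u v"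
  by (rule similarI[of 1 \<zero>]) (auto simp: low_zero smul_rules)

lemma similar_basic:
  assumes "basic_rel adj u v" "u \<in> words_on S"
  shows "similar u v"
  using assms(1)
proof cases
  case (comm a b)
  have S: "gen_node a \<in> S" "gen_node b \<in> S" and n: "\<not> adj (gen_node b) (gen_node a)"
    using assms(2) comm adj_sym by auto
  have ge: "g i \<otimes> e j = e j \<otimes> g i" if "i \<in> S" "j \<in> S" "\<not> adj i j" for i j
    by (rule e_comm[OF that(2) g_closed[OF that(1)] B1[OF that]])
  have ee: "e i \<otimes> e j = e j \<otimes> e i" if "i \<in> S" "j \<in> S" "\<not> adj j i" for i j
    by (rule e_comm[OF that(2) e_closed[OF that(1)] ge[OF that(2,1,3), symmetric]])
  have "val a \<otimes> val b = val b \<otimes> val a"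
    using S comm(4) n B1 ge ee by (cases a; cases b) simp_all
  then show ?thesis using comm S by (intro similar_eq) auto
next
  case (idem i)
  then show ?thesis using assms(2) params(3) by (intro similarI[of x \<zero>]) (auto simp: low_zero mult_ee)
next
  case (braid i j)
  then show ?thesis using assms(2) B2[OF braid(3)] by (intro similar_eq) auto
next
  case (eee i j)
  then show ?thesis using assms(2) mult_eee[OF eee(3)] by (intro similar_eq) auto
next
  case (gee i j)
  then have S: "i \<in> S" "j \<in> S" using assms(2) by auto
  \<comment> \<open>The remainder consists of the terms of \<open>gi j\<close> other than
    \<open>g j\<close>, multiplied by \<open>e i\<close>; it has height 0 while \<open>u\<close> has
    height 1.\<close>
  have "m \<bullet> eval [GenE i] \<oplus> (- m) \<bullet> eval [GenE j, GenE i] \<in> low (height u)"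
    using S gee by (intro low_add low_smul low_base) auto
  moreover have "eval u = 1 \<bullet> eval v \<oplus> (m \<bullet> eval [GenE i] \<oplus> (- m) \<bullet> eval [GenE j, GenE i])"
    using S gee mult_gee[OF gee(3)] by (simp add: gi_def l_distr smul_rules)
  ultimately show ?thesis by (intro similarI) auto
next
  case (eeg i j)
  then have S: "i \<in> S" "j \<in> S" using assms(2) by auto
  have "m \<bullet> eval [GenE i] \<oplus> (- m) \<bullet> eval [GenE i, GenE j] \<in> low (height u)"
    using S eeg by (intro low_add low_smul low_base) auto
  moreover have "eval u = 1 \<bullet> eval v \<oplus> (m \<bullet> eval [GenE i] \<oplus> (- m) \<bullet> eval [GenE i, GenE j])"
    using S eeg mult_eeg[OF eeg(3)] by (simp add: gi_def r_distr smul_rules)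
  ultimately show ?thesis by (intro similarI) auto
qed

lemma null_word_low:
  assumes "null_word adj a" "a \<in> words_on S"
  shows "eval a \<in> low (height a)"
  using assms(1)
proof cases
  case (gg i)
  have i: "i \<in> S" using assms(2) gg by auto
  have "1 \<bullet> eval [] \<oplus> ((- m) \<bullet> eval [GenG i] \<oplus> (m / l) \<bullet> eval [GenE i]) \<in> low (height a)"
    using i gg by (intro low_add low_smul low_base) auto
  then show ?thesis using g_square[OF i] gg i by (simp add: smul_rules)
next
  case (ge i)
  have i: "i \<in> S" using assms(2) ge by auto
  have "inverse l \<bullet> eval [GenE i] \<in> low (height a)" using i ge by (intro low_smul low_base) auto
  then show ?thesis using mult_ge[OF i] ge i by simp
next
  case (eg i)
  have i: "i \<in> S" using assms(2) eg by auto
  have "inverse l \<bullet> eval [GenE i] \<in> low (height a)" using i eg by (intro low_smul low_base) auto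
  then show ?thesis using mult_eg[OF i] eg i by simp
next
  case (ege i j)
  have i: "i \<in> S" "j \<in> S" using assms(2) ege by auto
  have "l \<bullet> eval [GenE i] \<in> low (height a)" using i ege by (intro low_smul low_base) auto
  then show ?thesis using mult_ege[OF ege(2)] ege i by simp
next
  case (gge i j)
  have i: "i \<in> S" "j \<in> S" using assms(2) gge by auto
  have "eval [GenE j, GenE i] \<in> low (height a)" using i gge by (intro low_base) auto
  then show ?thesis using mult_gge[OF gge(2)] gge i by simp
next
  case (egg i j)
  have i: "i \<in> S" "j \<in> S" using assms(2) egg by auto
  have "eval [GenE i, GenE j] \<in> low (height a)" using i egg by (intro low_base) auto
  then show ?thesis using mult_egg[OF egg(2)] egg i by simp
qed

text \<open>Equivalent words have equal height, so the error terms stay in one step of the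
  filtration under symmetry and transitivity.\<close>

lemma similar_weq:
  assumes "weq adj u v" "u \<in> words_on S"
  shows "similar u v"
proof -
  have "(u \<in> words_on S \<longleftrightarrow> v \<in> words_on S) \<and> (u \<in> words_on S \<longrightarrow> similar u v)"
    using assms(1)
  proof (induction rule: weq.induct)
    case (base u v)
    then show ?case using similar_basic weq_set[OF weq.base[OF base], of S] adj_in by blast
  next
    case (refl u)
    then show ?case using similar_eq by blast
  next
    case (sym u v)
    have "similar v u" if v: "v \<in> words_on S"
    proof -
      have u: "u \<in> words_on S" using sym v by blast
      then obtain c y where c: "c \<noteq> 0" "y \<in> low (height u)" "eval u = c \<bullet> eval v \<oplus> y"
        using sym unfolding similar_def by blast
      have y: "y \<in> carrier R" "eval v \<in> carrier R" using c(2) v by auto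
      have "inverse c \<bullet> eval u = eval v \<oplus> inverse c \<bullet> y"
        unfolding c(3) using y c(1) by (simp add: smul_rules)
      then have "inverse c \<bullet> eval u \<oplus> (- inverse c) \<bullet> y = eval v \<oplus> (inverse c \<bullet> y \<oplus> (- inverse c) \<bullet> y)"
        using y by (simp add: a_assoc)
      also have "\<dots> = eval v" using y by (simp add: smul_add smul_rules)
      finally have "eval v = inverse c \<bullet> eval u \<oplus> (- inverse c) \<bullet> y" ..
      moreover have "(- inverse c) \<bullet> y \<in> low (height v)"
        using low_smul[OF c(2)] weq_height[OF sym(1)] by simp
      ultimately show ?thesis using c(1) by (intro similarI) auto
    qed
    then show ?case using sym by blast
  next
    case (trans u v w)
    have "similar u w" if u: "u \<in> words_on S"
    proof -
      have v: "v \<in> words_on S" "w \<in> words_on S" using trans u by auto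
      obtain c y where c: "c \<noteq> 0" "y \<in> low (height u)" "eval u = c \<bullet> eval v \<oplus> y"
        using trans u unfolding similar_def by blast
      obtain d z where d: "d \<noteq> 0" "z \<in> low (height v)" "eval v = d \<bullet> eval w \<oplus> z"
        using trans v unfolding similar_def by blast
      have "eval u = (c * d) \<bullet> eval w \<oplus> (c \<bullet> z \<oplus> y)"
        unfolding c(3) d(3) using c(2) d(2) v by (simp add: smul_rules a_assoc)
      moreover have "c \<bullet> z \<oplus> y \<in> low (height u)"
        using d(2) c(2) weq_height[OF trans(1)] by (intro low_add low_smul) auto
      ultimately show ?thesis using c(1) d(1) by (intro similarI) auto
    qed
    then show ?case using trans by blast
  next
    case (append u v u' v')
    have "similar (u @ u') (v @ v')" if uu: "u @ u' \<in> words_on S"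
    proof -
      have u: "u \<in> words_on S" "u' \<in> words_on S" "v \<in> words_on S" "v' \<in> words_on S" using append uu by auto
      obtain c y where c: "c \<noteq> 0" "y \<in> low (height u)" "eval u = c \<bullet> eval v \<oplus> y"
        using append u unfolding similar_def by blast
      obtain d z where d: "d \<noteq> 0" "z \<in> low (height u')" "eval u' = d \<bullet> eval v' \<oplus> z"
        using append u unfolding similar_def by blast
      have yz: "y \<in> carrier R" "z \<in> carrier R" using c(2) d(2) by auto
      have "eval (u @ u') = (c \<bullet> eval v) \<otimes> eval u' \<oplus> y \<otimes> eval u'"
        using u yz c(3) by (simp add: eval_append l_distr)
      also have "(c \<bullet> eval v) \<otimes> eval u' = (c * d) \<bullet> eval (v @ v') \<oplus> c \<bullet> (eval v \<otimes> z)"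
        unfolding d(3) using u yz by (simp add: eval_append r_distr smul_rules mult.commute)
      finally have "eval (u @ u') = (c * d) \<bullet> eval (v @ v') \<oplus> (c \<bullet> (eval v \<otimes> z) \<oplus> y \<otimes> eval u')"
        using u yz by (simp add: a_assoc eval_append)
      moreover have "c \<bullet> (eval v \<otimes> z) \<oplus> y \<otimes> eval u' \<in> low (height (u @ u'))"
        using low_mult_left[OF d(2) u(3)] low_mult_right[OF c(2) u(2)] weq_height[OF append(1)]
        by (intro low_add low_smul) auto
      ultimately show ?thesis using c(1) d(1) by (intro similarI) auto
    qed
    then show ?case using append by auto
  qed
  then show ?thesis using assms(2) by blast
qed

lemma null_low:
  assumes "null adj u" "u \<in> words_on S"
  shows "eval u \<in> low (height u)"
proof -
  obtain p a q where a: "null_word adj a" "weq adj u (p @ a @ q)" using assms(1) by (auto simp: null_def)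
  have w: "p @ a @ q \<in> words_on S" using weq_set[OF a(2), of S] adj_in assms(2) by blast
  then have paq: "p \<in> words_on S" "a \<in> words_on S" "q \<in> words_on S" by auto
  obtain c y where c: "y \<in> low (height u)" "eval u = c \<bullet> eval (p @ a @ q) \<oplus> y"
    using similar_weq[OF a(2) assms(2)] unfolding similar_def by blast
  have "eval p \<otimes> (eval a \<otimes> eval q) \<in> low (height p + (height a + height q))"
    by (intro low_mult_left low_mult_right null_word_low a paq)
  then have "eval (p @ a @ q) \<in> low (height u)"
    using weq_height[OF a(2)] paq by (simp add: eval_append)
  then show ?thesis unfolding c(2) by (intro low_add low_smul c(1))
qed

text \<open>Representatives outside the words on \<open>S\<close> can be discarded by
  \<open>weq_set\<close>; every error term is in the span by the induction on the height.\<close>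

lemma eval_spanned:
  assumes F: "\<And>u. u \<in> words_on S \<Longrightarrow> null adj u \<or> (\<exists>f\<in>F. weq adj u f)"
  shows "u \<in> words_on S \<Longrightarrow> eval u \<in> lin (eval ` (F \<inter> words_on S))"
proof (induction "height u" arbitrary: u rule: less_induct)
  case less
  let ?L = "lin (eval ` (F \<inter> words_on S))"
  have X: "eval ` (F \<inter> words_on S) \<subseteq> carrier R" by auto
  have low: "y \<in> ?L" if "y \<in> low (height u)" for y
    using that unfolding low_def by (rule lin_lin[OF _ _ X]) (use less.hyps in auto)
  from F[OF less.prems] show ?case
  proof
    assume "null adj u"
    then show ?thesis using null_low less.prems low by blast
  next
    assume "\<exists>f\<in>F. weq adj u f"
    then obtain f where f: "f \<in> F" "weq adj u f" by blast
    then have "f \<in> words_on S" using weq_set[OF f(2), of S] adj_in less.prems by blast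
    then have "eval f \<in> ?L" using f(1) by (intro lin_base[OF _ X]) auto
    moreover obtain c y where c: "y \<in> low (height u)" "eval u = c \<bullet> eval f \<oplus> y"
      using similar_weq[OF f(2) less.prems] unfolding similar_def by blast
    ultimately show ?thesis unfolding c(2) using lin_add[OF lin_smul[OF _ X] low[OF c(1)] X] by blast
  qed
qed

lemma subfield_scalars:
  assumes "\<one> \<noteq> \<zero>" shows "subfield (range s) R"
proof (rule subfieldI)
  have nz: "s c \<noteq> \<zero>" if "c \<noteq> 0" for c
  proof
    assume "s c = \<zero>"
    then have "s (inverse c * c) = \<zero>" by (simp only: s_mult) simp
    then show False using that assms s_one by simp
  qed
  have neg: "\<ominus> s c = s (- c)" for c
    using smul_minus[of "s c"] s_mult[of "-1" c] by (simp add: smul_def)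
  have "subring (range s) R"
    by (rule subringI) (auto simp: neg s_mult[symmetric] s_add[symmetric] s_one[symmetric])
  then show "subcring (range s) R"
    by (rule subcringI) (auto simp: s_mult[symmetric] mult.commute)
  show "Units (R\<lparr>carrier := range s\<rparr>) = range s - {\<zero>}"
  proof
    show "Units (R\<lparr>carrier := range s\<rparr>) \<subseteq> range s - {\<zero>}"
      using assms by (auto simp: Units_def s_zero[symmetric])
         (metis mult_zero_right s_mult)
    show "range s - {\<zero>} \<subseteq> Units (R\<lparr>carrier := range s\<rparr>)"
    proof
      fix k assume "k \<in> range s - {\<zero>}"
      then obtain c where k: "k = s c" "c \<noteq> 0" using s_zero by auto
      have "s (inverse c) \<otimes> s c = \<one>" "s c \<otimes> s (inverse c) = \<one>"
        using k(2) by (simp_all add: s_mult[symmetric] s_one)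
      then show "k \<in> Units (R\<lparr>carrier := range s\<rparr>)" unfolding Units_def k(1) by auto
    qed
  qed
qed

theorem finite_dimensional:
  assumes "fin_words S adj" and gen: "carrier R \<subseteq> lin (eval ` words_on S)"
  shows "finite_dimension (range s) (carrier R)"
proof (cases "\<one> = \<zero>")
  \<comment> \<open>The zero algebra is not excluded beforehand; the image of the scalars is then no
    field, and the dimension is 0.\<close>
  case True
  then have "carrier R = {\<zero>}" using one_zeroD by blast
  then show ?thesis using finite_dimensionI[OF zero_dim] by simp
next
  case False
  note K = subfield_scalars[OF False]
  obtain F where F: "finite F" "\<And>u. u \<in> words_on S \<Longrightarrow> null adj u \<or> (\<exists>f\<in>F. weq adj u f)"
    using assms(1) unfolding fin_words_def by blast
  have "finite (eval ` (F \<inter> words_on S))" using F(1) by simp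
  then obtain Us where Us: "set Us = eval ` (F \<inter> words_on S)" using finite_list by blast
  have X: "set Us \<subseteq> carrier R" unfolding Us by auto
  have "y \<in> Span (range s) Us" if "y \<in> lin (set Us)" for y
    using that
  proof (induction rule: lin.induct)
    case zero
    show ?case using Span_subgroup_props(2)[OF K X] .
  next
    case (step w v c)
    have "w \<in> Span (range s) Us" using Span_base_incl[OF K X] step(1) by blast
    then have "c \<bullet> w \<in> Span (range s) Us"
      unfolding smul_def by (intro Span_smult_closed[OF K X]) auto
    then show ?case using step.IH Span_subgroup_props(3)[OF K X] by blast
  qed
  moreover have "carrier R \<subseteq> lin (set Us)"
  proof
    fix y assume "y \<in> carrier R"
    then have "y \<in> lin (eval ` words_on S)" using gen by blast
    then show "y \<in> lin (set Us)"
      by (rule lin_lin[OF _ _ X]) (use eval_spanned[OF F(2)] in \<open>auto simp: Us\<close>)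
  qed
  ultimately have "carrier R = Span (range s) Us" using Span_subgroup_props(1)[OF K X] by blast
  then show ?thesis using Span_finite_dimension[OF K X] by simp
qed

end

section \<open>The BMW algebra\<close>

lemma Fract_poly_eq_iff: "Fract a 1 = Fract b 1 \<longleftrightarrow> a = (b :: rat poly poly)"
  by (simp add: eq_fract)

text \<open>Everything reduces to inequalities between polynomials: l and x are non-zero, x differs
  from 1, and l^2 differs from 1 and from x. The last one is behind
  \<open>var_m * var_l + 1\<close>, which is (l^2 - x) / (1 - x).\<close>

lemma var_params:
  "var_l \<noteq> 0" "var_x \<noteq> 0" "var_m \<noteq> 0" "var_m * var_l + 1 \<noteq> 0"
  "var_m * var_x = var_m - var_l + inverse var_l"
proof -
  have one: "(1 :: ratfun) = Fract 1 1" and zero: "(0 :: ratfun) = Fract 0 1"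
    by (simp_all add: One_fract_def Zero_fract_def)
  show l: "var_l \<noteq> 0" and x: "var_x \<noteq> 0"
    by (simp_all add: var_l_def var_x_def zero Fract_poly_eq_iff)
  have "var_x \<noteq> 1" unfolding var_x_def one Fract_poly_eq_iff by (simp add: one_pCons)
  then have x1: "1 - var_x \<noteq> 0" by simp
  have l1: "var_l * var_l \<noteq> 1"
    unfolding var_l_def one mult_fract Fract_poly_eq_iff mult_1_right by (simp add: one_pCons)
  have lx: "var_l * var_l \<noteq> var_x" by (simp add: var_l_def var_x_def Fract_poly_eq_iff)
  have m: "var_m = (var_l * var_l - 1) / (var_l * (1 - var_x))"
    using l x1 by (simp add: var_m_def field_simps)
  show "var_m \<noteq> 0" using l x1 l1 by (simp add: m)
  have "var_m * var_l + 1 = (var_l * var_l - var_x) / (1 - var_x)"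
    using l x1 by (simp add: m field_simps)
  then show "var_m * var_l + 1 \<noteq> 0" using lx x1 by simp
  have "var_m * (1 - var_x) = var_l - inverse var_l" using x1 by (simp add: var_m_def)
  then show "var_m * var_x = var_m - var_l + inverse var_l" by (simp add: algebra_simps)
qed

text \<open>Turns \<open>update_induct\<close> into an induction that adds one monomial at a
  time.\<close>

lemma update_eq_single_add: "w \<notin> Poly_Mapping.keys p \<Longrightarrow> Poly_Mapping.update w c p = Poly_Mapping.single w c + p"
  by (rule poly_mapping_eqI) (auto simp: lookup_update lookup_add lookup_single in_keys_iff when_def)

lemma scalar_single: "scalar c * Poly_Mapping.single w d = Poly_Mapping.single w (c * d)"
  "Poly_Mapping.single w d * scalar c = Poly_Mapping.single w (c * d)"
  by (simp_all add: scalar_def mult_single plus_list_def mult.commute)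

lemma scalar_central: "scalar c * p = p * scalar c"
proof (induction p rule: update_induct)
  case (update p w d)
  then show ?case by (simp add: update_eq_single_add distrib_left distrib_right scalar_single)
qed simp

lemma scalar_hom: "scalar (c + d) = scalar c + scalar d" "scalar (c * d) = scalar c * scalar d" "scalar 1 = 1"
  by (simp_all add: scalar_def single_add mult_single plus_list_def) (simp add: zero_list_def[symmetric])

lemma free_algebra_simps [simp]:
  "monoid.mult (free_algebra n) = (*)" "one (free_algebra n) = 1" "zero (free_algebra n) = 0" "add (free_algebra n) = (+)"
  by (simp_all add: free_algebra_def)

lemma carrier_free_algebra: "carrier (free_algebra n) = {p. Poly_Mapping.keys p \<subseteq> words_on (nodes n)}"
proof -
  have "lists (GenG ` nodes n \<union> GenE ` nodes n) = words_on (nodes n)"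
  proof -
    have "a \<in> GenG ` nodes n \<union> GenE ` nodes n \<longleftrightarrow> gen_node a \<in> nodes n" for a by (cases a) auto
    then show ?thesis
      by (simp add: words_on_def in_lists_conv_set set_eq_iff image_subset_iff del: Un_iff)
  qed
  then show ?thesis by (simp add: free_algebra_def)
qed

lemma free_algebra_minus:
  assumes "p \<in> carrier (free_algebra n)" "q \<in> carrier (free_algebra n)"
  shows "p \<ominus>\<^bsub>free_algebra n\<^esub> q = p - q"
proof -
  interpret F: ring "free_algebra n" by (rule free_algebra_ring)
  have "- q \<in> carrier (free_algebra n)" using assms(2) by (simp add: carrier_free_algebra)
  then have "\<ominus>\<^bsub>free_algebra n\<^esub> q = - q" using assms(2) by (intro F.minus_equality) simp_all
  then show ?thesis by (simp add: F.minus_eq)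
qed

theorem theorem1p1:
  fixes n :: nat and adj :: "nat \<Rightarrow> nat \<Rightarrow> bool"
  assumes "simply_laced_diagram n adj"
    and "spherical n adj"
  shows "ring.finite_dimension (BMW_algebra n adj) (BMW_scalars n adj) (carrier (BMW_algebra n adj))"
proof -
  let ?F = "free_algebra n" and ?I = "BMW_ideal n adj" and ?R = "BMW_algebra n adj" and ?S = "nodes n"
  interpret F: ring ?F by (rule free_algebra_ring)
  interpret I: ideal ?I ?F by (rule BMW_ideal_ideal)
  interpret R: ring ?R by (rule BMW_algebra_ring)
  define h where "h = (+>\<^bsub>?F\<^esub>) ?I"
  have hom: "h \<in> ring_hom ?F ?R" unfolding h_def BMW_algebra_def by (rule I.rcos_ring_hom)
  have C: "carrier ?R = h ` carrier ?F"
    unfolding h_def BMW_algebra_def FactRing_def A_RCOSETS_def' by auto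
  have h: "h p \<in> carrier ?R" "h (p * q) = h p \<otimes>\<^bsub>?R\<^esub> h q" "h (p + q) = h p \<oplus>\<^bsub>?R\<^esub> h q" "h 1 = \<one>\<^bsub>?R\<^esub>"
    if "p \<in> carrier ?F" "q \<in> carrier ?F" for p q
    using ring_hom_closed[OF hom that(1)] ring_hom_mult[OF hom that] ring_hom_add[OF hom that] ring_hom_one[OF hom]
    by simp_all
  \<comment> \<open>Each defining relation is recorded as a difference, which lies in the ideal; so
    its two sides have the same coset.\<close>
  have h_eq: "h p = h q" if "p - q \<in> BMW_relators n adj" "p \<in> carrier ?F" "q \<in> carrier ?F" for p q
  proof -
    have "p - q \<in> ?I" unfolding BMW_ideal_def using F.genideal_self[OF BMW_relators_carrier] that(1) by blast
    then show ?thesis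
      unfolding h_def
      using F.quotient_eq_iff_same_a_r_cos[OF BMW_ideal_ideal that(2,3)] free_algebra_minus[OF that(2,3)] by simp
  qed
  have mc: "p * q \<in> carrier ?F" and ac: "p + q \<in> carrier ?F" if "p \<in> carrier ?F" "q \<in> carrier ?F" for p q
    using F.m_closed[OF that] F.a_closed[OF that] by simp_all
  note cl = free_algebra_scalar free_algebra_gens mc ac
  have gc: "h (bmw_g i) \<in> carrier ?R" "h (bmw_e i) \<in> carrier ?R" if "i \<in> ?S" for i
    using h(1) cl that by blast+
  have adj: "i \<in> ?S" "j \<in> ?S" "adj j i" if "adj i j" for i j
    using that assms(1) unfolding simply_laced_diagram_def by blast+
  interpret bmw_ring ?R "\<lambda>c. h (scalar c)" "\<lambda>i. h (bmw_g i)" "\<lambda>i. h (bmw_e i)" ?S adj var_l var_m var_x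
  proof
    show "h (scalar c) \<in> carrier ?R" for c using h(1) cl by blast
    show "h (scalar (c + d)) = h (scalar c) \<oplus>\<^bsub>?R\<^esub> h (scalar d)"
      "h (scalar (c * d)) = h (scalar c) \<otimes>\<^bsub>?R\<^esub> h (scalar d)" for c d
      by (simp_all add: scalar_hom h cl)
    show "h (scalar 1) = \<one>\<^bsub>?R\<^esub>" using h(4)[OF cl(1) cl(1)] by (simp add: scalar_hom)
    fix y c assume "y \<in> carrier ?R"
    then obtain p where p: "p \<in> carrier ?F" "y = h p" using C by blast
    then show "y \<otimes>\<^bsub>?R\<^esub> h (scalar c) = h (scalar c) \<otimes>\<^bsub>?R\<^esub> y"
      using h(2)[OF p(1) free_algebra_scalar[of c]] h(2)[OF free_algebra_scalar[of c] p(1)]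
        scalar_central[of c p] by simp
  next
    fix i assume i: "i \<in> ?S"
    show "h (bmw_g i) \<in> carrier ?R" "h (bmw_e i) \<in> carrier ?R" by (fact gc[OF i])+
    let ?q = "scalar var_l * (bmw_g i * bmw_g i + scalar var_m * bmw_g i + scalar (- 1))"
    have "scalar (- 1) = - 1" by (simp add: scalar_def single_uminus zero_list_def[symmetric])
    then have "scalar var_m * bmw_e i - ?q \<in> BMW_relators n adj"
      using i unfolding BMW_relators_def by (auto simp: power2_eq_square)
    then have "h (scalar var_m * bmw_e i) = h ?q" by (rule h_eq) (use i in \<open>auto intro!: cl\<close>)
    then show "h (scalar var_m) \<otimes>\<^bsub>?R\<^esub> h (bmw_e i) = h (scalar var_l) \<otimes>\<^bsub>?R\<^esub>
        (h (bmw_g i) \<otimes>\<^bsub>?R\<^esub> h (bmw_g i) \<oplus>\<^bsub>?R\<^esub> h (scalar var_m) \<otimes>\<^bsub>?R\<^esub> h (bmw_g i) \<oplus>\<^bsub>?R\<^esub> h (scalar (- 1)))"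
      using i by (simp add: h cl)
    have "h (bmw_g i * bmw_e i) = h (scalar (inverse var_l) * bmw_e i)"
      by (rule h_eq) (use i in \<open>auto intro!: cl simp: BMW_relators_def\<close>)
    then show "h (bmw_g i) \<otimes>\<^bsub>?R\<^esub> h (bmw_e i) = h (scalar (inverse var_l)) \<otimes>\<^bsub>?R\<^esub> h (bmw_e i)"
      using i by (simp add: h cl)
  next
    fix i j assume ij: "adj i j"
    show "i \<in> ?S \<and> j \<in> ?S" "adj j i" using adj[OF ij] by auto
    have "h (bmw_g i * bmw_g j * bmw_g i) = h (bmw_g j * bmw_g i * bmw_g j)"
      by (rule h_eq) (use adj[OF ij] ij in \<open>auto intro!: cl simp: BMW_relators_def\<close>)
    then show "h (bmw_g i) \<otimes>\<^bsub>?R\<^esub> (h (bmw_g j) \<otimes>\<^bsub>?R\<^esub> h (bmw_g i)) =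
        h (bmw_g j) \<otimes>\<^bsub>?R\<^esub> (h (bmw_g i) \<otimes>\<^bsub>?R\<^esub> h (bmw_g j))"
      using adj[OF ij] by (simp add: h cl gc R.m_assoc)
    have "h (bmw_e i * bmw_g j * bmw_e i) = h (scalar var_l * bmw_e i)"
      by (rule h_eq) (use adj[OF ij] ij in \<open>auto intro!: cl simp: BMW_relators_def\<close>)
    then show "h (bmw_e i) \<otimes>\<^bsub>?R\<^esub> (h (bmw_g j) \<otimes>\<^bsub>?R\<^esub> h (bmw_e i)) = h (scalar var_l) \<otimes>\<^bsub>?R\<^esub> h (bmw_e i)"
      using adj[OF ij] by (simp add: h cl gc R.m_assoc)
  next
    fix i j assume ij: "i \<in> ?S" "j \<in> ?S" "\<not> adj i j"
    have "h (bmw_g i * bmw_g j) = h (bmw_g j * bmw_g i)"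
      by (rule h_eq) (use ij in \<open>auto intro!: cl simp: BMW_relators_def\<close>)
    then show "h (bmw_g i) \<otimes>\<^bsub>?R\<^esub> h (bmw_g j) = h (bmw_g j) \<otimes>\<^bsub>?R\<^esub> h (bmw_g i)"
      using ij by (simp add: h cl)
  qed (use var_params in simp_all)
  have sc: "Poly_Mapping.single w c \<in> carrier ?F" if "w \<in> words_on ?S" for w c
    using that by (auto simp: carrier_free_algebra)
  have h_word: "h (Poly_Mapping.single w 1) = eval w" if "w \<in> words_on ?S" for w
    using that
  proof (induction w)
    case Nil
    have "Poly_Mapping.single [] 1 = (1 :: gen_poly)" by (simp add: zero_list_def[symmetric])
    then show ?case using h(4)[OF cl(1) cl(1)] by simp
  next
    case (Cons a w)
    have "Poly_Mapping.single (a # w) (1::ratfun) = Poly_Mapping.single [a] 1 * Poly_Mapping.single w 1"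
      by (simp add: mult_single plus_list_def)
    moreover have "h (Poly_Mapping.single [a] 1) = val a"
      by (cases a) (simp_all add: bmw_g_def[symmetric] bmw_e_def[symmetric])
    ultimately show ?case using Cons by (simp add: h(2) sc)
  qed
  have X: "eval ` words_on ?S \<subseteq> carrier ?R" by auto
  have "h p \<in> lin (eval ` words_on ?S)" if "p \<in> carrier ?F" for p
    using that
  proof (induction p rule: update_induct)
    case const
    have "h (0 + 0) = h 0 \<oplus>\<^bsub>?R\<^esub> h 0" by (rule h(3)) (simp_all add: carrier_free_algebra)
    moreover have "h 0 \<in> carrier ?R" by (rule h(1)[of 0 0]) (simp_all add: carrier_free_algebra)
    ultimately have "h 0 = \<zero>\<^bsub>?R\<^esub>" by (metis R.add.r_cancel_one add_0)
    then show ?case using lin.zero by simp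
  next
    case (update p w c)
    then have pw: "p \<in> carrier ?F" "w \<in> words_on ?S"
      by (auto simp: carrier_free_algebra keys_update)
    have "h (Poly_Mapping.update w c p) = h (scalar c * Poly_Mapping.single w 1) \<oplus>\<^bsub>?R\<^esub> h p"
      unfolding update_eq_single_add[OF update(1)] scalar_single using h(3)[OF sc[OF pw(2)] pw(1)] by simp
    also have "h (scalar c * Poly_Mapping.single w 1) = smul c (eval w)"
      using h(2)[OF cl(1) sc[OF pw(2)]] h_word[OF pw(2)] by (simp add: smul_def)
    finally show ?case using lin.step[OF _ update.IH[OF pw(1)]] pw(2) by simp
  qed
  then have "carrier ?R \<subseteq> lin (eval ` words_on ?S)" unfolding C by blast
  then have "R.finite_dimension (range (\<lambda>c. h (scalar c))) (carrier ?R)"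
    by (rule finite_dimensional[OF fin_words_posgraph[OF posgraph_spherical[OF assms]]])
  then show ?thesis by (simp add: BMW_scalars_def h_def)
qed

end
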